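(* For each of the following profiles $\mathrm b$, one has for every $C\ge 0$ $$\limsup_{r\to\infty}\ \limsup_{n\to\infty}\ \mathbb P\left(\left|Z^{\mathrm b}[Cn^{2/3}]_n\right|\ge r n^{2/3}\right)=0:$$ (i) the narrow wedge $\mathrm w(0)=0$, $\mathrm w(k)=-\infty$ for $k\neq 0$; (ii) the flat profile $\mathrm f(k)=0$ for all $k\in\mathbb Z$; (iii) wedge to flat: $\mathrm{wf}(k)=-\infty$ for $k<0$ and $\mathrm{wf}(k)=0$ for $k\ge 0$; (iv) wedge to stationary: $\mathrm{ws}(k)=-\infty$ for $k<0$, $\mathrm{ws}(0)=0$, $\mathrm{ws}(k)=\sum_{i=1}^k\zeta_i$ for $k>0$; (v) flat to stationary: $\mathrm{fs}(k)=0$ for $k\le 0$, $\mathrm{fs}(k)=\sum_{i=1}^k\zeta_i$ for $k>0$; where in (iv) and (v) the $\zeta_i$ are i.i.d. copies of $X(1/2)$, independent of $\omega$.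
   Context: Let $\omega=\{\omega_{i,j}:(i,j)\in\mathbb Z^2,\ i+j>0\}$ be i.i.d. exponential random variables with parameter $1$. Write $(i,j)\le(k,l)$ if $i\le k$ and $j\le l$. An up-right path from $\mathbf x$ to $\mathbf y$ is a sequence $\mathbf x=\mathbf x_0,\dots,\mathbf x_m=\mathbf y$ with increments in $\{(1,0),(0,1)\}$; its passage time is $\sum_{i=1}^m\omega_{\mathbf x_i}$ (starting point excluded). For $\mathbf x=(i,j)\le\mathbf y$ with $i+j\ge0$, $L(\mathbf x,\mathbf y)$ is the maximal passage time over up-right paths from $\mathbf x$ to $\mathbf y$. Set $L_k(\mathbf x)=L((k,-k),\mathbf x)$ and $C^{\mathbf x}=\{k\in\mathbb Z:(k,-k)\le\mathbf x\}$. For integer $k$, $[k]_n:=(n+k,n-k)$; for real $x$, $[x]_n:=[\lfloor x\rfloor]_n$. For a profile $\mathrm b:\mathbb Z\to\mathbb R\cup\{-\infty\}$ with $\mathrm b(0)=0$ (possibly random and independent of $\omega$), $L^{\mathrm b}(\mathbf x):=\max_{k\in C^{\mathbf x}}\{\mathrm b(k)+L_k(\mathbf x)\}$, and the exit point $Z^{\mathrm b}(\mathbf x)$ is the largest $k\in C^{\mathbf x}$ attaining this maximum. For $\rho\in(0,1)$, $X(\rho):=E_1-E_2$ where $E_1,E_2$ are independent exponential variables with rates $1-\rho$ and $\rho$ respectively (means $1/(1-\rho)$ and $1/\rho$). *)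

theory Defs
  imports "HOL-Probability.Probability"
begin

type_synonym pt = "int \<times> int"

definition up_right_path :: "pt list \<Rightarrow> pt \<Rightarrow> pt \<Rightarrow> bool" where
  "up_right_path ps x y \<longleftrightarrow> ps \<noteq> [] \<and> hd ps = x \<and> last ps = y \<and>
     (\<forall>i. Suc i < length ps \<longrightarrow>
        ps ! Suc i = (fst (ps ! i) + 1, snd (ps ! i)) \<or> ps ! Suc i = (fst (ps ! i), snd (ps ! i) + 1))"

definition passage_time :: "(pt \<Rightarrow> real) \<Rightarrow> pt list \<Rightarrow> real" where
  "passage_time w ps = sum_list (map w (tl ps))"

definition LPP :: "(pt \<Rightarrow> real) \<Rightarrow> pt \<Rightarrow> pt \<Rightarrow> real" where
  "LPP w x y = Max (passage_time w ` {ps. up_right_path ps x y})"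

definition Lk :: "(pt \<Rightarrow> real) \<Rightarrow> int \<Rightarrow> pt \<Rightarrow> real" where
  "Lk w k x = LPP w (k, -k) x"

definition Cset :: "pt \<Rightarrow> int set" where
  "Cset x = {k. k \<le> fst x \<and> - k \<le> snd x}"

definition Lb :: "(pt \<Rightarrow> real) \<Rightarrow> (int \<Rightarrow> ereal) \<Rightarrow> pt \<Rightarrow> ereal" where
  "Lb w b x = Max ((\<lambda>k. b k + ereal (Lk w k x)) ` Cset x)"

definition exit_pt :: "(pt \<Rightarrow> real) \<Rightarrow> (int \<Rightarrow> ereal) \<Rightarrow> pt \<Rightarrow> int" where
  "exit_pt w b x = Max {k \<in> Cset x. b k + ereal (Lk w k x) = Lb w b x}"

definition brk :: "real \<Rightarrow> nat \<Rightarrow> pt" where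
  "brk x n = (int n + \<lfloor>x\<rfloor>, int n - \<lfloor>x\<rfloor>)"

definition X_law :: "real \<Rightarrow> real measure" where
  "X_law \<rho> = distr (density lborel (exponential_density (1 - \<rho>)) \<Otimes>\<^sub>M density lborel (exponential_density \<rho>))
                borel (\<lambda>(a, b). a - b)"

definition wedge :: "int \<Rightarrow> ereal" where
  "wedge k = (if k = 0 then 0 else -\<infinity>)"

definition flat :: "int \<Rightarrow> ereal" where
  "flat k = 0"

definition wedge_flat :: "int \<Rightarrow> ereal" where
  "wedge_flat k = (if k < 0 then -\<infinity> else 0)"

definition wedge_stat :: "(nat \<Rightarrow> real) \<Rightarrow> int \<Rightarrow> ereal" where
  "wedge_stat z k = (if k < 0 then -\<infinity> else ereal (\<Sum>i=1..nat k. z i))"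

definition flat_stat :: "(nat \<Rightarrow> real) \<Rightarrow> int \<Rightarrow> ereal" where
  "flat_stat z k = (if k \<le> 0 then 0 else ereal (\<Sum>i=1..nat k. z i))"

definition tightness :: "'s measure \<Rightarrow> (pt \<Rightarrow> 's \<Rightarrow> real) \<Rightarrow> ('s \<Rightarrow> int \<Rightarrow> ereal) \<Rightarrow> real \<Rightarrow> ereal" where
  "tightness M \<omega> b C = Limsup at_top (\<lambda>r::real. Limsup sequentially (\<lambda>n::nat.
     ereal (measure M {s \<in> space M.
        real_of_int \<bar>exit_pt (\<lambda>p. \<omega> p s) (b s) (brk (C * real n powr (2/3)) n)\<bar> \<ge> r * real n powr (2/3)})))"

end

theory Submission
  imports Defs
begin

text \<open>Seen from the target, \<open>L\<^sub>k\<close> is the last passage time \<open>L\<close> from a corner to the points of an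
antidiagonal. Add independent exponential weights of rates \<open>w\<close> and \<open>1 - w\<close> on the two axes. The
resulting stationary process has independent increments along down-right paths, because replacing
\<open>(I, J, v)\<close> by \<open>(v + (I - J)\<^sup>+, v + (J - I)\<^sup>+, min I J)\<close> preserves the product law.

With different rates \<open>w\<close> and \<open>1 - z\<close> the passage time \<open>G\<close> to \<open>(m, n)\<close> satisfies
\<open>E exp ((w - z) G) = (w / z) ^ m * ((1 - z) / (1 - w)) ^ n\<close>. Let \<open>H\<close> and \<open>V\<close> be the passage
times using only the horizontal or only the vertical boundary, so that \<open>G = max H V\<close>. The formula
with \<open>w > z\<close> bounds the upper tail of \<open>H\<close>; with \<open>w < z\<close> it bounds the lower tail of \<open>G\<close>. Hence
\<open>V \<ge> H\<close> with high probability as soon as \<open>w\<close> exceeds the characteristic parameter of \<open>(m, n)\<close> by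
a large multiple of \<open>n powr (-1/3)\<close>.

On \<open>V \<ge> H\<close> the increments of \<open>L\<close> along the antidiagonal are dominated by those of the stationary
process, a random walk. Take \<open>k0\<close> a large multiple of \<open>n powr (2/3)\<close> and \<open>w\<close> slightly below
\<open>1/2\<close>. Then \<open>L\<^sub>k - L\<^sub>k\<^sub>0\<close> is dominated for \<open>k \<ge> k0\<close> by a walk with drift of order
\<open>- n powr (-1/3)\<close>, while \<open>L\<^sub>k\<^sub>0 - L\<^sub>0\<close> is of order \<open>n powr (1/3)\<close> by a second comparison with
\<open>w > 1/2\<close>. The profile adds at most an independent centred walk, and a maximal inequality excludes
exit points beyond \<open>r * n powr (2/3)\<close>. Exit points on the left follow by reflection.\<close>

section \<open>Last passage recursion and sweeps\<close>

text \<open>A negative drift needs a comparison parameter below \<open>1/2\<close>, but a comparison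
  based at a point is valid only for parameters above the characteristic one there. Near the
  diagonal that one is about \<open>1/2\<close>, so the comparison cannot start at
  \<open>k = 0\<close>; it starts at \<open>k0\<close>, where the characteristic parameter has
  dropped by a multiple of \<open>n powr (-1/3)\<close>. The stretch from \<open>0\<close> to
  \<open>k0\<close> must then be crossed with a parameter above \<open>1/2\<close>, whose drift has
  the wrong sign; over about \<open>n powr (2/3)\<close> steps this costs only order
  \<open>n powr (1/3)\<close>, which the negative drift beyond \<open>k0\<close> recovers once
  \<open>r\<close> is large. The exponent \<open>1/3\<close> arises because the second derivative of
  the logarithmic moment vanishes at the characteristic parameter: a deviation \<open>h\<close> is
  felt through \<open>(m + n) * h^3\<close>. Independence of increments is obtained without
  conditioning: a deterministic map that preserves a finite product law sends the weights to the
  increments. Hence the estimates live on finite products of coordinates, and the given model is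
  coupled to them only at the end.\<close>

text \<open>For a target \<open>(x1, x2)\<close>, \<open>Blk i j\<close> is the weight at \<open>(x1 - i, x2 - j)\<close>, which the recursion
  \<open>lp\<close> uses at the lattice point \<open>(i + 1, j + 1)\<close>; \<open>Hor i\<close> and \<open>Ver j\<close> are auxiliary boundary
  weights and \<open>Zet k\<close> is the \<open>k\<close>-th increment of the profile. All weights are exponential of rate
  \<open>1\<close>; the factors \<open>a\<close> and \<open>b\<close> set the means of the boundary weights. The absolute values are
  almost surely redundant and spare the deterministic lemmas a positivity hypothesis.\<close>

datatype idx = Hor nat | Ver nat | Blk nat nat | Zet nat

fun lp :: "real \<Rightarrow> real \<Rightarrow> (idx \<Rightarrow> real) \<Rightarrow> nat \<Rightarrow> nat \<Rightarrow> real" where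
  "lp a b f 0 0 = 0"
| "lp a b f (Suc i) 0 = lp a b f i 0 + a * \<bar>f (Hor i)\<bar>"
| "lp a b f 0 (Suc j) = lp a b f 0 j + b * \<bar>f (Ver j)\<bar>"
| "lp a b f (Suc i) (Suc j) = max (lp a b f i (Suc j)) (lp a b f (Suc i) j) + \<bar>f (Blk i j)\<bar>"

lemma lp_nonneg: "0 \<le> a \<Longrightarrow> 0 \<le> b \<Longrightarrow> 0 \<le> lp a b f i j"
  by (induction a b f i j rule: lp.induct) auto

lemma lp_mono: "0 \<le> a \<Longrightarrow> 0 \<le> b \<Longrightarrow> a \<le> a' \<Longrightarrow> b \<le> b' \<Longrightarrow> lp a b f i j \<le> lp a' b' f i j"
  by (induction a b f i j rule: lp.induct) (auto intro!: add_mono mult_right_mono max.mono)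

text \<open>A path leaves the origin along one axis and never collects weights of the other, so the
  two boundaries compete through a maximum. On an axis the competing value is 0, which cannot win
  against nonnegative weights.\<close>

lemma lp_max: "0 \<le> a \<Longrightarrow> 0 \<le> b \<Longrightarrow> lp a b f i j = max (lp a 0 f i j) (lp 0 b f i j)"
proof (induction a b f i j rule: lp.induct)
  case (2 a b f i)
  have "lp 0 b f (k::nat) 0 = 0" for k by (induction k) auto
  moreover have "0 \<le> lp a 0 f i 0" using 2 by (intro lp_nonneg) auto
  ultimately show ?case using 2 by simp
next
  case (3 a b f j)
  have "lp a 0 f 0 (k::nat) = 0" for k by (induction k) auto
  moreover have "0 \<le> lp 0 b f 0 j" using 3 by (intro lp_nonneg) auto
  ultimately show ?case using 3 by simp
next
  case (4 a b f i j)
  then show ?case by (simp add: max.assoc max.left_commute max_add_distrib_left)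
qed auto

lemma lp00_cong:
  assumes "\<And>k l. k < i \<Longrightarrow> l < j \<Longrightarrow> f (Blk k l) = g (Blk k l)"
  shows "lp 0 0 f i j = lp 0 0 g i j"
  using assms by (induction "0::real" "0::real" f i j rule: lp.induct) auto

text \<open>Across a cell of weight \<open>v\<close> with lower increment \<open>I\<close> and left
  increment \<open>J\<close>, the upper and right increments are \<open>v + max (I - J) 0\<close>
  and \<open>v + max (J - I) 0\<close>. These are monotone in one argument and antitone in the
  other, so an ordering of the boundaries spreads to all cells.\<close>

lemma lp_increments_mono:
  assumes "a \<le> a'" "b' \<le> b"
  shows "lp a b f (Suc i) j - lp a b f i j \<le> lp a' b' f (Suc i) j - lp a' b' f i j"
    and "lp a' b' f i (Suc j) - lp a' b' f i j \<le> lp a b f i (Suc j) - lp a b f i j"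
proof -
  let ?H = "\<lambda>i j. lp a b f (Suc i) j - lp a b f i j \<le> lp a' b' f (Suc i) j - lp a' b' f i j"
  let ?V = "\<lambda>i j. lp a' b' f i (Suc j) - lp a' b' f i j \<le> lp a b f i (Suc j) - lp a b f i j"
  \<comment> \<open>In a row, \<open>?V\<close> moves rightwards from the left boundary with the
    help of \<open>?H\<close> in that row; \<open>?H\<close> then climbs to the next row.\<close>
  have V: "?V i j" if "\<And>i. ?H i j" for i j
  proof (induction i)
    case 0
    then show ?case using assms by (simp add: mult_right_mono)
  next
    case (Suc i)
    with that[of i] show ?case by (simp only: lp.simps; linarith)
  qed
  have H: "?H i j" for i j
  proof (induction j arbitrary: i)
    case 0
    then show ?case using assms by (simp add: mult_right_mono)
  next
    case (Suc j)
    show ?case using V[OF Suc, of i] Suc[of i] by (simp only: lp.simps; linarith)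
  qed
  show "?H i j" by (rule H)
  show "?V i j" by (rule V[OF H])
qed

text \<open>A step up and left adds a vertical increment and subtracts a horizontal one; a vertical
  boundary raises the former and lowers the latter. The horizontal boundary can then be added as
  well: by assumption it does not change the value at \<open>(m, n)\<close>, and elsewhere it can
  only increase it.\<close>

lemma lp_antidiagonal_compare:
  assumes "0 \<le> a" "0 \<le> b" "lp a 0 f m n \<le> lp 0 b f m n" "t \<le> m"
  shows "lp 0 0 f (m - t) (n + t) - lp 0 0 f m n \<le> lp a b f (m - t) (n + t) - lp a b f m n"
proof -
  have "lp 0 0 f (m - t) (n + t) - lp 0 0 f m n \<le> lp 0 b f (m - t) (n + t) - lp 0 b f m n"
    using \<open>t \<le> m\<close>
  proof (induction t)
    case (Suc t)
    then have m: "m - t = Suc (m - Suc t)" by simp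
    show ?case
      using Suc lp_increments_mono(1)[of 0 0 0 b f "m - Suc t" "n + t"]
        lp_increments_mono(2)[of 0 0 0 b f "m - Suc t" "n + t"] \<open>0 \<le> b\<close>
      unfolding m by simp
  qed simp
  also have "\<dots> \<le> lp a b f (m - t) (n + t) - lp a b f m n"
    using assms lp_max[of a b f m n] lp_max[of a b f "m - t" "n + t"] by simp
  finally show ?thesis .
qed

text \<open>A flip stores the increments rescaled by \<open>w\<close> and \<open>1 - w\<close>, so that every coordinate keeps the
  exponential law of rate \<open>1\<close>. Once all cells of a down-closed set \<open>S\<close> have been flipped in place,
  \<open>Hor i\<close> and \<open>Ver j\<close> hold the increments along the boundary of \<open>S\<close>.\<close>

definition flip :: "real \<Rightarrow> nat \<Rightarrow> nat \<Rightarrow> (idx \<Rightarrow> real) \<Rightarrow> idx \<Rightarrow> real" where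
  "flip w i j f = (let I = \<bar>f (Hor i)\<bar> / w; J = \<bar>f (Ver j)\<bar> / (1 - w) in
     f(Hor i := w * (\<bar>f (Blk i j)\<bar> + max (I - J) 0),
       Ver j := (1 - w) * (\<bar>f (Blk i j)\<bar> + max (J - I) 0),
       Blk i j := min I J))"

definition down_closed :: "(nat \<times> nat) set \<Rightarrow> bool" where
  "down_closed S \<longleftrightarrow> (\<forall>i j i' j'. (i, j) \<in> S \<longrightarrow> i' \<le> i \<longrightarrow> j' \<le> j \<longrightarrow> (i', j') \<in> S)"

definition swept :: "real \<Rightarrow> (nat \<times> nat) set \<Rightarrow> (idx \<Rightarrow> real) \<Rightarrow> (idx \<Rightarrow> real) \<Rightarrow> bool" where
  "swept w S f g \<longleftrightarrow>
     (\<forall>i j. (i, j) \<notin> S \<longrightarrow> g (Blk i j) = f (Blk i j)) \<and> (\<forall>k. g (Zet k) = f (Zet k)) \<and>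
     (\<forall>i j. (j = 0 \<or> (i, j - 1) \<in> S) \<longrightarrow> (i, j) \<notin> S \<longrightarrow>
        \<bar>g (Hor i)\<bar> = w * (lp (1/w) (1/(1-w)) f (Suc i) j - lp (1/w) (1/(1-w)) f i j)) \<and>
     (\<forall>i j. (i = 0 \<or> (i - 1, j) \<in> S) \<longrightarrow> (i, j) \<notin> S \<longrightarrow>
        \<bar>g (Ver j)\<bar> = (1-w) * (lp (1/w) (1/(1-w)) f i (Suc j) - lp (1/w) (1/(1-w)) f i j))"

lemma sweptD:
  assumes "swept w S f g"
  shows "(i, j) \<notin> S \<Longrightarrow> g (Blk i j) = f (Blk i j)"
    and "g (Zet k) = f (Zet k)"
    and "j = 0 \<or> (i, j - 1) \<in> S \<Longrightarrow> (i, j) \<notin> S \<Longrightarrow>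
        \<bar>g (Hor i)\<bar> = w * (lp (1/w) (1/(1-w)) f (Suc i) j - lp (1/w) (1/(1-w)) f i j)"
    and "i = 0 \<or> (i - 1, j) \<in> S \<Longrightarrow> (i, j) \<notin> S \<Longrightarrow>
        \<bar>g (Ver j)\<bar> = (1-w) * (lp (1/w) (1/(1-w)) f i (Suc j) - lp (1/w) (1/(1-w)) f i j)"
  using assms unfolding swept_def by blast+

lemma swept_empty:
  assumes "0 < w" "w < 1"
  shows "swept w {} f f"
  using assms by (auto simp: swept_def)

text \<open>The cell is a corner of the complement of \<open>S\<close>, so \<open>Hor i0\<close> and
  \<open>Ver j0\<close> hold the increments on its lower and left sides. The flip performs the
  recursion of \<open>lp\<close> on increments and leaves those of the upper and right sides; other
  rows and columns keep their boundary.\<close>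

lemma swept_flip:
  assumes w: "0 < w" "w < 1" and S: "down_closed S" "down_closed (insert (i0, j0) S)" "(i0, j0) \<notin> S"
    and sw: "swept w S f g"
  shows "swept w (insert (i0, j0) S) f (flip w i0 j0 g)"
proof -
  define G where "G = lp (1/w) (1/(1-w)) f"
  have dc: "(i', j') \<in> insert (i0, j0) S" if "i' \<le> i0" "j' \<le> j0" for i' j'
    using S(2) that unfolding down_closed_def by blast
  have beyond: "(i, j) \<notin> S" if "i0 \<le> i" "j0 \<le> j" for i j
    using S(1,3) that unfolding down_closed_def by blast
  have H: "\<bar>g (Hor i0)\<bar> = w * (G (Suc i0) j0 - G i0 j0)"
    unfolding G_def
  proof (rule sweptD(3)[OF sw _ S(3)])
    show "j0 = 0 \<or> (i0, j0 - 1) \<in> S" using dc[of i0 "j0 - 1"] by (cases j0) auto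
  qed
  have V: "\<bar>g (Ver j0)\<bar> = (1 - w) * (G i0 (Suc j0) - G i0 j0)"
    unfolding G_def
  proof (rule sweptD(4)[OF sw _ S(3)])
    show "i0 = 0 \<or> (i0 - 1, j0) \<in> S" using dc[of "i0 - 1" j0] by (cases i0) auto
  qed
  have B: "g (Blk i0 j0) = f (Blk i0 j0)"
    using sw S(3) unfolding swept_def by blast
  have G: "G (Suc i0) (Suc j0) = max (G i0 (Suc j0)) (G (Suc i0) j0) + \<bar>f (Blk i0 j0)\<bar>"
    unfolding G_def by simp
  let ?h = "flip w i0 j0 g"
  have nH: "\<bar>?h (Hor i0)\<bar> = w * (G (Suc i0) (Suc j0) - G i0 (Suc j0))"
    using w by (simp add: flip_def Let_def H V B G abs_mult max_def)
  have nV: "\<bar>?h (Ver j0)\<bar> = (1 - w) * (G (Suc i0) (Suc j0) - G (Suc i0) j0)"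
    using w by (simp add: flip_def Let_def H V B G abs_mult max_def)
  have oth: "?h (Hor i) = g (Hor i)" if "i \<noteq> i0" for i
    using that by (simp add: flip_def Let_def)
  have otv: "?h (Ver i) = g (Ver i)" if "i \<noteq> j0" for i
    using that by (simp add: flip_def Let_def)
  have otb: "?h (Blk i j) = g (Blk i j)" if "(i, j) \<noteq> (i0, j0)" for i j
    using that by (auto simp add: flip_def Let_def)
  have otz: "?h (Zet k) = g (Zet k)" for k
    by (auto simp add: flip_def Let_def)
  show ?thesis
    unfolding swept_def G_def[symmetric]
  proof (intro conjI allI impI)
    fix i j assume "(i, j) \<notin> insert (i0, j0) S"
    then show "?h (Blk i j) = f (Blk i j)"
      using sweptD(1)[OF sw, of i j] by (subst otb) auto
  next
    fix k show "?h (Zet k) = f (Zet k)" using sweptD(2)[OF sw] by (simp add: otz)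
  next
    fix i j assume 1: "j = 0 \<or> (i, j - 1) \<in> insert (i0, j0) S" and 2: "(i, j) \<notin> insert (i0, j0) S"
    show "\<bar>?h (Hor i)\<bar> = w * (G (Suc i) j - G i j)"
    proof (cases "i = i0")
      case True
      \<comment> \<open>After the flip the boundary crosses column \<open>i0\<close> at height
        \<open>Suc j0\<close> only.\<close>
      have "j > j0" using dc[of i j] 2 True by (meson leI order_refl)
      moreover have "j - 1 = j0" using 1 True \<open>j > j0\<close> beyond[of i "j - 1"] by auto
      ultimately have "j = Suc j0" by simp
      then show ?thesis using nH True by simp
    next
      case False
      then show ?thesis using oth[OF False] sweptD(3)[OF sw, of j i] 1 2 unfolding G_def by auto
    qed
  next
    fix i j assume 1: "i = 0 \<or> (i - 1, j) \<in> insert (i0, j0) S" and 2: "(i, j) \<notin> insert (i0, j0) S"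
    show "\<bar>?h (Ver j)\<bar> = (1 - w) * (G i (Suc j) - G i j)"
    proof (cases "j = j0")
      case True
      have "i > i0" using dc[of i j] 2 True by (meson leI order_refl)
      moreover have "i - 1 = i0" using 1 True \<open>i > i0\<close> beyond[of "i - 1" j] by auto
      ultimately have "i = Suc i0" by simp
      then show ?thesis using nV True by simp
    next
      case False
      then show ?thesis using otv[OF False] sweptD(4)[OF sw, of i j] 1 2 unfolding G_def by auto
    qed
  qed
qed

text \<open>A cell with maximal \<open>i + j\<close> lies below no other cell of \<open>S\<close>,
  so removing it leaves no gap. It is the cell to be flipped last.\<close>

lemma down_closed_remove_maximal:
  assumes "finite S" "S \<noteq> {}" "down_closed S"
  obtains i j where "(i, j) \<in> S" "down_closed (S - {(i, j)})"
proof -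
  obtain p where p: "p \<in> S" "\<And>q. q \<in> S \<Longrightarrow> fst q + snd q \<le> fst p + snd p"
    using Max_in[of "(\<lambda>q. fst q + snd q) ` S"] assms(1,2)
    by (smt (verit, ccfv_threshold) Max_ge finite_imageI imageE imageI image_is_empty)
  have "down_closed (S - {(fst p, snd p)})"
    unfolding down_closed_def
  proof (intro allI impI)
    fix i j i' j' assume h: "(i, j) \<in> S - {(fst p, snd p)}" "i' \<le> i" "j' \<le> j"
    then have "(i', j') \<in> S" using assms(3) unfolding down_closed_def by blast
    moreover have "(i', j') \<noteq> (fst p, snd p)" using p(2)[of "(i, j)"] h by auto
    ultimately show "(i', j') \<in> S - {(fst p, snd p)}" by simp
  qed
  with p(1) that show ?thesis by (metis prod.collapse)
qed

section \<open>Exponential variables\<close>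

definition Exp1 :: "real measure" where
  "Exp1 = density lborel (exponential_density 1)"

lemma prob_space_Exp1: "prob_space Exp1"
  unfolding Exp1_def by (rule prob_space_exponential_density) simp

lemma sets_Exp1 [simp, measurable_cong]: "sets Exp1 = sets borel"
  by (simp add: Exp1_def)

lemma space_Exp1 [simp]: "space Exp1 = UNIV"
  by (simp add: Exp1_def)

lemma nn_integral_Exp1:
  assumes [measurable]: "h \<in> borel_measurable borel"
  shows "(\<integral>\<^sup>+x. h x \<partial>Exp1) = (\<integral>\<^sup>+x. ennreal (exp (-x)) * indicator {0..} x * h x \<partial>lborel)"
  unfolding Exp1_def
  by (subst nn_integral_density)
     (auto intro!: nn_integral_cong simp: exponential_density_def indicator_def)

lemma AE_Exp1_nonneg: "AE x in Exp1. 0 \<le> x"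
  unfolding Exp1_def by (subst AE_density) (auto simp: exponential_density_def)

text \<open>The factor is the likelihood ratio of an exponential of mean \<open>c\<close> against
  one of mean \<open>1\<close>. It is the device by which boundary rates are changed later.\<close>

lemma nn_integral_Exp1_scale:
  assumes c: "0 < c" and [measurable]: "h \<in> borel_measurable borel"
  shows "(\<integral>\<^sup>+x. h (c * x) \<partial>Exp1) = (\<integral>\<^sup>+x. ennreal (exp (-(1/c - 1) * x) / c) * h x \<partial>Exp1)"
proof -
  have "(\<integral>\<^sup>+x. ennreal (exp (-(1/c - 1) * x) / c) * h x \<partial>Exp1)
    = (\<integral>\<^sup>+x. ennreal (exp (-x)) * indicator {0..} x * (ennreal (exp (-(1/c - 1) * x) / c) * h x) \<partial>lborel)"
    by (rule nn_integral_Exp1) simp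
  also have "\<dots> = c * (\<integral>\<^sup>+x. ennreal (exp (-(0 + c*x))) * indicator {0..} (0+c*x) * (ennreal (exp (-(1/c - 1) * (0+c*x)) / c) * h (0+c*x)) \<partial>lborel)"
    using c by (subst nn_integral_real_affine[where t=0 and c=c]) auto
  also have "\<dots> = (\<integral>\<^sup>+x. ennreal (exp (-x)) * indicator {0..} x * h (c * x) \<partial>lborel)"
  proof (subst nn_integral_cmult[symmetric], simp, intro nn_integral_cong)
    fix x :: real
    have "c * (exp (-(c*x)) * (exp (-(1/c - 1) * (c*x)) / c)) = exp (-x)"
      using c by (simp add: exp_add[symmetric] field_simps)
    then have "ennreal c * (ennreal (exp (-(c*x))) * ennreal (exp (-(1/c - 1) * (c*x)) / c)) = ennreal (exp (-x))"
      using c by (simp add: ennreal_mult[symmetric])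
    then show "ennreal c * (ennreal (exp (- (0 + c * x))) * indicator {0..} (0 + c * x) *
          (ennreal (exp (- (1 / c - 1) * (0 + c * x)) / c) * h (0 + c * x))) =
         ennreal (exp (- x)) * indicator {0..} x * h (c * x)"
      using c by (auto simp: indicator_def zero_le_mult_iff simp flip: mult.assoc)
  qed
  also have "\<dots> = (\<integral>\<^sup>+x. h (c * x) \<partial>Exp1)"
    by (rule nn_integral_Exp1[symmetric]) simp
  finally show ?thesis by simp
qed

text \<open>With the constant function 1 the scaling identity says that the likelihood ratio has
  total mass 1; this is the moment for the mean \<open>d = 1 / (1 - c)\<close>.\<close>

lemma nn_integral_Exp1_exp:
  assumes "c < 1"
  shows "(\<integral>\<^sup>+x. ennreal (exp (c * x)) \<partial>Exp1) = ennreal (1 / (1 - c))"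
proof -
  interpret prob_space Exp1 by (rule prob_space_Exp1)
  define d where "d = 1 / (1 - c)"
  have d: "0 < d" "1 / d - 1 = - c" using assms by (simp_all add: d_def)
  have "(\<integral>\<^sup>+x. ennreal (exp (c * x)) \<partial>Exp1) = (\<integral>\<^sup>+x. ennreal d * (ennreal (exp (-(1/d - 1) * x) / d) * 1) \<partial>Exp1)"
    using d by (intro nn_integral_cong) (simp add: ennreal_mult[symmetric])
  also have "\<dots> = ennreal d * (\<integral>\<^sup>+x. 1 \<partial>Exp1)"
    using nn_integral_Exp1_scale[OF d(1), of "\<lambda>_. 1"] by (subst nn_integral_cmult) simp_all
  also have "\<dots> = ennreal d" using emeasure_space_1 by simp
  finally show ?thesis by (simp add: d_def)
qed

text \<open>Translating the larger of the two variables by the smaller one turns the density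
  \<open>exp (- w x - (1 - w) y - v)\<close> into a function symmetric in the smaller variable and \<open>v\<close>.\<close>

abbreviation borel3 :: "(real \<times> real \<times> real) measure" where
  "borel3 \<equiv> borel \<Otimes>\<^sub>M borel \<Otimes>\<^sub>M borel"

lemma exponential_triple_half:
  fixes h :: "real \<times> real \<times> real \<Rightarrow> ennreal" and w :: real
  assumes [measurable]: "h \<in> borel_measurable borel3" "Measurable.pred borel Q"
  shows "(\<integral>\<^sup>+y. \<integral>\<^sup>+v. \<integral>\<^sup>+x. ennreal (exp (-(w*x+(1-w)*y+v))) * indicator {0..} y * indicator {0..} v
            * indicator {d. 0 \<le> d \<and> Q d} (x - y) * h (v + (x - y), v, y) \<partial>lborel \<partial>lborel \<partial>lborel)
       = (\<integral>\<^sup>+y. \<integral>\<^sup>+v. \<integral>\<^sup>+x. ennreal (exp (-(w*x+(1-w)*y+v))) * indicator {0..} y * indicator {0..} v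
            * indicator {d. 0 \<le> d \<and> Q d} (x - y) * h (x, y, v) \<partial>lborel \<partial>lborel \<partial>lborel)"
proof -
  have sh: "(\<integral>\<^sup>+x. g (x - y) \<partial>lborel) = (\<integral>\<^sup>+x. g x \<partial>lborel)"
    if [measurable]: "g \<in> borel_measurable borel" for g :: "real \<Rightarrow> ennreal" and y
    using nn_integral_real_affine[of "\<lambda>x. g (x - y)" 1 y] by simp
  define K where "K = (\<lambda>(y, v, d). ennreal (exp (-(w*d+y+v))) * indicator {0..} y * indicator {0..} v
            * indicator {d. 0 \<le> d \<and> Q d} d)"
  have [measurable]: "K \<in> borel_measurable borel3"
    unfolding K_def by measurable
  have K_sym: "K (y, v, d) = K (v, y, d)" for y v d
  proof -
    have "-(w*d+y+v) = -(w*d+v+y)" by simp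
    then show ?thesis unfolding K_def prod.case by (simp only: mult_ac)
  qed
  have e: "exp (-(w*x+(1-w)*y+v)) = exp (-(w*(x-y)+y+v))" for x y v :: real
    by (simp add: algebra_simps)
  have "(\<integral>\<^sup>+y. \<integral>\<^sup>+v. \<integral>\<^sup>+x. ennreal (exp (-(w*x+(1-w)*y+v))) * indicator {0..} y * indicator {0..} v
            * indicator {d. 0 \<le> d \<and> Q d} (x - y) * h (v + (x - y), v, y) \<partial>lborel \<partial>lborel \<partial>lborel)
    = (\<integral>\<^sup>+y. \<integral>\<^sup>+v. \<integral>\<^sup>+x. K (y, v, x - y) * h (v + (x - y), v, y) \<partial>lborel \<partial>lborel \<partial>lborel)"
    unfolding K_def e by simp
  also have "\<dots> = (\<integral>\<^sup>+y. \<integral>\<^sup>+v. \<integral>\<^sup>+x. K (y, v, x) * h (v + x, v, y) \<partial>lborel \<partial>lborel \<partial>lborel)"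
    by (intro nn_integral_cong sh) measurable
  also have "\<dots> = (\<integral>\<^sup>+v. \<integral>\<^sup>+y. \<integral>\<^sup>+x. K (y, v, x) * h (v + x, v, y) \<partial>lborel \<partial>lborel \<partial>lborel)"
    by (rule lborel_pair.Fubini') measurable
  also have "\<dots> = (\<integral>\<^sup>+y. \<integral>\<^sup>+v. \<integral>\<^sup>+x. K (y, v, x) * h (y + x, y, v) \<partial>lborel \<partial>lborel \<partial>lborel)"
    by (simp only: K_sym)
  also have "\<dots> = (\<integral>\<^sup>+y. \<integral>\<^sup>+v. \<integral>\<^sup>+x. K (y, v, x - y) * h (y + (x - y), y, v) \<partial>lborel \<partial>lborel \<partial>lborel)"
    by (intro nn_integral_cong sh[symmetric]) measurable
  also have "\<dots> = (\<integral>\<^sup>+y. \<integral>\<^sup>+v. \<integral>\<^sup>+x. ennreal (exp (-(w*x+(1-w)*y+v))) * indicator {0..} y * indicator {0..} v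
            * indicator {d. 0 \<le> d \<and> Q d} (x - y) * h (x, y, v) \<partial>lborel \<partial>lborel \<partial>lborel)"
    unfolding K_def e by simp
  finally show ?thesis .
qed

lemma nn_integral_triple_rotate:
  fixes g :: "real \<times> real \<times> real \<Rightarrow> ennreal"
  assumes [measurable]: "g \<in> borel_measurable borel3"
  shows "(\<integral>\<^sup>+x. \<integral>\<^sup>+y. \<integral>\<^sup>+v. g (x, y, v) \<partial>lborel \<partial>lborel \<partial>lborel)
       = (\<integral>\<^sup>+y. \<integral>\<^sup>+v. \<integral>\<^sup>+x. g (x, y, v) \<partial>lborel \<partial>lborel \<partial>lborel)"
    and "(\<integral>\<^sup>+x. \<integral>\<^sup>+y. \<integral>\<^sup>+v. g (x, y, v) \<partial>lborel \<partial>lborel \<partial>lborel)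
       = (\<integral>\<^sup>+x. \<integral>\<^sup>+v. \<integral>\<^sup>+y. g (x, y, v) \<partial>lborel \<partial>lborel \<partial>lborel)"
proof -
  have "(\<integral>\<^sup>+x. \<integral>\<^sup>+y. \<integral>\<^sup>+v. g (x, y, v) \<partial>lborel \<partial>lborel \<partial>lborel)
       = (\<integral>\<^sup>+y. \<integral>\<^sup>+x. \<integral>\<^sup>+v. g (x, y, v) \<partial>lborel \<partial>lborel \<partial>lborel)"
    by (rule lborel_pair.Fubini') measurable
  also have "\<dots> = (\<integral>\<^sup>+y. \<integral>\<^sup>+v. \<integral>\<^sup>+x. g (x, y, v) \<partial>lborel \<partial>lborel \<partial>lborel)"
    by (intro nn_integral_cong lborel_pair.Fubini') measurable
  finally show "(\<integral>\<^sup>+x. \<integral>\<^sup>+y. \<integral>\<^sup>+v. g (x, y, v) \<partial>lborel \<partial>lborel \<partial>lborel)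
       = (\<integral>\<^sup>+y. \<integral>\<^sup>+v. \<integral>\<^sup>+x. g (x, y, v) \<partial>lborel \<partial>lborel \<partial>lborel)" .
  show "(\<integral>\<^sup>+x. \<integral>\<^sup>+y. \<integral>\<^sup>+v. g (x, y, v) \<partial>lborel \<partial>lborel \<partial>lborel)
       = (\<integral>\<^sup>+x. \<integral>\<^sup>+v. \<integral>\<^sup>+y. g (x, y, v) \<partial>lborel \<partial>lborel \<partial>lborel)"
    by (intro nn_integral_cong lborel_pair.Fubini') measurable
qed

text \<open>The triple is split by which of \<open>x\<close> and \<open>y\<close> is larger, and
  each half is mapped to itself with the same density. The predicate \<open>Q\<close> of the half
  statement assigns the ties to the first half only. The second half is the first one with
  \<open>x\<close> and \<open>y\<close>, and with \<open>w\<close> and \<open>1 - w\<close>,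
  interchanged.\<close>

lemma exponential_triple_flip:
  fixes h :: "real \<times> real \<times> real \<Rightarrow> ennreal" and w :: real
  assumes [measurable]: "h \<in> borel_measurable borel3"
  defines "D \<equiv> \<lambda>x y v. ennreal (exp (-(w*x+(1-w)*y+v))) * indicator {0..} x * indicator {0..} y * indicator {0..} v"
  shows "(\<integral>\<^sup>+x. \<integral>\<^sup>+y. \<integral>\<^sup>+v. D x y v * h (v + max (x - y) 0, v + max (y - x) 0, min x y) \<partial>lborel \<partial>lborel \<partial>lborel)
       = (\<integral>\<^sup>+x. \<integral>\<^sup>+y. \<integral>\<^sup>+v. D x y v * h (x, y, v) \<partial>lborel \<partial>lborel \<partial>lborel)"
proof -
  define D1 where "D1 = (\<lambda>(x, y, v). ennreal (exp (-(w*x+(1-w)*y+v))) * indicator {0..} y * indicator {0..} v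
            * indicator {d. 0 \<le> d \<and> True} (x - y))"
  define D2 where "D2 = (\<lambda>(x, y, v). ennreal (exp (-(w*x+(1-w)*y+v))) * indicator {0..} x * indicator {0..} v
            * indicator {d. 0 \<le> d \<and> d \<noteq> 0} (y - x))"
  have [measurable]: "D1 \<in> borel_measurable borel3" "D2 \<in> borel_measurable borel3"
    unfolding D1_def D2_def by measurable
  define I where "I g = (\<integral>\<^sup>+x. \<integral>\<^sup>+y. \<integral>\<^sup>+v. g (x, y, v) \<partial>lborel \<partial>lborel \<partial>lborel)" for g :: "real \<times> real \<times> real \<Rightarrow> ennreal"
  have Iadd: "I (\<lambda>p. g p + g' p) = I g + I g'"
    if [measurable]: "g \<in> borel_measurable borel3" "g' \<in> borel_measurable borel3" for g g'
    unfolding I_def by (simp add: nn_integral_add)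
  have split: "D x y v = D1 (x, y, v) + D2 (x, y, v)" for x y v
    by (auto simp: D_def D1_def D2_def indicator_def)
  have 1: "I (\<lambda>(x, y, v). D1 (x, y, v) * h (v + (x - y), v, y)) = I (\<lambda>(x, y, v). D1 (x, y, v) * h (x, y, v))"
    unfolding I_def
    apply (subst (1 2) nn_integral_triple_rotate(1))
      apply measurable
    using exponential_triple_half[of h "\<lambda>_. True" w] by (simp add: D1_def)
  have 2: "I (\<lambda>(x, y, v). D2 (x, y, v) * h (v, v + (y - x), x)) = I (\<lambda>(x, y, v). D2 (x, y, v) * h (x, y, v))"
    unfolding I_def
    apply (subst (1 2) nn_integral_triple_rotate(2))
      apply measurable
    using exponential_triple_half[of "\<lambda>(x, y, v). h (y, x, v)" "\<lambda>d. d \<noteq> 0" "1 - w"]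
    by (simp add: D2_def add.commute add.left_commute)
  have "(\<integral>\<^sup>+x. \<integral>\<^sup>+y. \<integral>\<^sup>+v. D x y v * h (v + max (x - y) 0, v + max (y - x) 0, min x y) \<partial>lborel \<partial>lborel \<partial>lborel)
      = I (\<lambda>p. (case p of (x, y, v) \<Rightarrow> D1 (x, y, v) * h (v + (x - y), v, y))
             + (case p of (x, y, v) \<Rightarrow> D2 (x, y, v) * h (v, v + (y - x), x)))"
    unfolding I_def split by (intro nn_integral_cong) (auto simp: D1_def D2_def indicator_def max_def min_def)
  also have "\<dots> = I (\<lambda>(x, y, v). D1 (x, y, v) * h (x, y, v)) + I (\<lambda>(x, y, v). D2 (x, y, v) * h (x, y, v))"
    by (subst Iadd) (measurable, simp only: 1 2)
  also have "\<dots> = I (\<lambda>p. (case p of (x, y, v) \<Rightarrow> D1 (x, y, v) * h (x, y, v))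
             + (case p of (x, y, v) \<Rightarrow> D2 (x, y, v) * h (x, y, v)))"
    by (rule Iadd[symmetric]) measurable
  also have "\<dots> = (\<integral>\<^sup>+x. \<integral>\<^sup>+y. \<integral>\<^sup>+v. D x y v * h (x, y, v) \<partial>lborel \<partial>lborel \<partial>lborel)"
    unfolding I_def split by (simp add: distrib_right)
  finally show ?thesis .
qed

lemma nn_integral_Exp1_rate:
  assumes r: "0 < r" and [measurable]: "k \<in> borel_measurable borel"
  shows "(\<integral>\<^sup>+x. k x \<partial>Exp1) = ennreal r * (\<integral>\<^sup>+x. ennreal (exp (-(r*x))) * indicator {0..} x * k (r * x) \<partial>lborel)"
proof -
  have "(\<integral>\<^sup>+x. k x \<partial>Exp1) = (\<integral>\<^sup>+x. ennreal (exp (-x)) * indicator {0..} x * k x \<partial>lborel)"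
    by (rule nn_integral_Exp1) simp
  also have "\<dots> = ennreal r * (\<integral>\<^sup>+x. ennreal (exp (-(r*x))) * indicator {0..} (r*x) * k (r * x) \<partial>lborel)"
    using r by (subst nn_integral_real_affine[where t=0 and c=r]) auto
  also have "\<dots> = ennreal r * (\<integral>\<^sup>+x. ennreal (exp (-(r*x))) * indicator {0..} x * k (r * x) \<partial>lborel)"
    using r by (auto intro!: nn_integral_cong arg_cong2[where f="(*)"] simp: indicator_def zero_le_mult_iff)
  finally show ?thesis .
qed

lemma nn_integral_Exp1_triple:
  fixes k :: "real \<times> real \<times> real \<Rightarrow> ennreal"
  assumes w: "0 < w" "w < 1" and [measurable]: "k \<in> borel_measurable borel3"
  shows "(\<integral>\<^sup>+x. \<integral>\<^sup>+y. \<integral>\<^sup>+v. k (x, y, v) \<partial>Exp1 \<partial>Exp1 \<partial>Exp1) = ennreal w * (ennreal (1 - w) *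
     (\<integral>\<^sup>+x. \<integral>\<^sup>+y. \<integral>\<^sup>+v. ennreal (exp (-(w*x+(1-w)*y+v))) * indicator {0..} x * indicator {0..} y * indicator {0..} v
        * k (w * x, (1 - w) * y, v) \<partial>lborel \<partial>lborel \<partial>lborel))"
proof -
  interpret E: prob_space Exp1 by (rule prob_space_Exp1)
  define A where "A r x = ennreal (exp (-(r*x))) * indicator {0..} x" for r x :: real
  have [measurable]: "A r \<in> borel_measurable borel" for r
    unfolding A_def by measurable
  have rate: "(\<integral>\<^sup>+x. g x \<partial>Exp1) = ennreal r * (\<integral>\<^sup>+x. A r x * g (r * x) \<partial>lborel)"
    if "0 < r" "g \<in> borel_measurable borel" for r and g :: "real \<Rightarrow> ennreal"
    unfolding A_def by (rule nn_integral_Exp1_rate[OF that])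
  have 3: "(\<integral>\<^sup>+v. k (x, y, v) \<partial>Exp1) = (\<integral>\<^sup>+v. A 1 v * k (x, y, v) \<partial>lborel)" for x y
    by (subst rate[of 1]) simp_all
  have 2: "(\<integral>\<^sup>+y. \<integral>\<^sup>+v. k (x, y, v) \<partial>Exp1 \<partial>Exp1)
    = ennreal (1-w) * (\<integral>\<^sup>+y. A (1-w) y * (\<integral>\<^sup>+v. A 1 v * k (x, (1-w)*y, v) \<partial>lborel) \<partial>lborel)" for x
    unfolding 3
  proof (rule rate)
    show "0 < 1 - w" using w by simp
  qed measurable
  have 1: "(\<integral>\<^sup>+x. \<integral>\<^sup>+y. \<integral>\<^sup>+v. k (x, y, v) \<partial>Exp1 \<partial>Exp1 \<partial>Exp1)
    = ennreal w * (\<integral>\<^sup>+x. A w x * (ennreal (1-w) * (\<integral>\<^sup>+y. A (1-w) y * (\<integral>\<^sup>+v. A 1 v * k (w*x, (1-w)*y, v) \<partial>lborel) \<partial>lborel)) \<partial>lborel)"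
    unfolding 2 by (rule rate[OF w(1)]) measurable
  also have "\<dots> = ennreal w * (ennreal (1 - w) * (\<integral>\<^sup>+x. \<integral>\<^sup>+y. \<integral>\<^sup>+v. A w x * (A (1-w) y * (A 1 v * k (w*x, (1-w)*y, v))) \<partial>lborel \<partial>lborel \<partial>lborel))"
    by (simp add: nn_integral_cmult mult.left_commute[of "A w _" "ennreal (1 - w)"])
  also have "(\<lambda>x y v. A w x * (A (1-w) y * (A 1 v * k (w*x, (1-w)*y, v))))
     = (\<lambda>x y v. ennreal (exp (-(w*x+(1-w)*y+v))) * indicator {0..} x * indicator {0..} y * indicator {0..} v
        * k (w * x, (1 - w) * y, v))"
  proof (intro ext)
    fix x y v :: real
    have "ennreal (exp (-(w*x+(1-w)*y+v))) = ennreal (exp (-(w*x))) * ennreal (exp (-((1-w)*y))) * ennreal (exp (-(1 * v)))"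
      by (simp add: ennreal_mult[symmetric] exp_add[symmetric])
    then show "A w x * (A (1-w) y * (A 1 v * k (w*x, (1-w)*y, v))) =
      ennreal (exp (-(w*x+(1-w)*y+v))) * indicator {0..} x * indicator {0..} y * indicator {0..} v
        * k (w * x, (1 - w) * y, v)" unfolding A_def by (simp only: mult_ac)
  qed
  finally show ?thesis .
qed

text \<open>If \<open>x\<close> has rate 1 then \<open>x / w\<close> has rate \<open>w\<close>, so
  this is the flip of the exponential triple in rescaled coordinates. The normalising constants
  agree on both sides, and the absolute values disappear on the support.\<close>

lemma Exp1_triple_flip:
  fixes k :: "real \<times> real \<times> real \<Rightarrow> ennreal"
  assumes w: "0 < w" "w < 1" and [measurable]: "k \<in> borel_measurable borel3"
  shows "(\<integral>\<^sup>+x. \<integral>\<^sup>+y. \<integral>\<^sup>+v. k (w * (\<bar>v\<bar> + max (\<bar>x\<bar> / w - \<bar>y\<bar> / (1-w)) 0),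
        (1-w) * (\<bar>v\<bar> + max (\<bar>y\<bar> / (1-w) - \<bar>x\<bar> / w) 0), min (\<bar>x\<bar> / w) (\<bar>y\<bar> / (1-w))) \<partial>Exp1 \<partial>Exp1 \<partial>Exp1)
     = (\<integral>\<^sup>+x. \<integral>\<^sup>+y. \<integral>\<^sup>+v. k (x, y, v) \<partial>Exp1 \<partial>Exp1 \<partial>Exp1)"
proof -
  define k' where "k' = (\<lambda>(x, y, v). k (w * (\<bar>v\<bar> + max (\<bar>x\<bar> / w - \<bar>y\<bar> / (1-w)) 0),
        (1-w) * (\<bar>v\<bar> + max (\<bar>y\<bar> / (1-w) - \<bar>x\<bar> / w) 0), min (\<bar>x\<bar> / w) (\<bar>y\<bar> / (1-w))))"
  have [measurable]: "k' \<in> borel_measurable borel3"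
    unfolding k'_def by measurable
  have [measurable]: "(\<lambda>(x, y, v). k (w * x, (1 - w) * y, v)) \<in> borel_measurable borel3"
    by measurable
  have "(\<integral>\<^sup>+x. \<integral>\<^sup>+y. \<integral>\<^sup>+v. ennreal (exp (-(w*x+(1-w)*y+v))) * indicator {0..} x * indicator {0..} y * indicator {0..} v
        * k' (w * x, (1 - w) * y, v) \<partial>lborel \<partial>lborel \<partial>lborel)
    = (\<integral>\<^sup>+x. \<integral>\<^sup>+y. \<integral>\<^sup>+v. ennreal (exp (-(w*x+(1-w)*y+v))) * indicator {0..} x * indicator {0..} y * indicator {0..} v
        * (case (v + max (x - y) 0, v + max (y - x) 0, min x y) of (x, y, v) \<Rightarrow> k (w * x, (1 - w) * y, v)) \<partial>lborel \<partial>lborel \<partial>lborel)"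
    using w by (intro nn_integral_cong) (auto simp: k'_def indicator_def abs_mult)
  also have "\<dots> = (\<integral>\<^sup>+x. \<integral>\<^sup>+y. \<integral>\<^sup>+v. ennreal (exp (-(w*x+(1-w)*y+v))) * indicator {0..} x * indicator {0..} y * indicator {0..} v
        * k (w * x, (1 - w) * y, v) \<partial>lborel \<partial>lborel \<partial>lborel)"
    by (subst exponential_triple_flip) simp_all
  finally have "(\<integral>\<^sup>+x. \<integral>\<^sup>+y. \<integral>\<^sup>+v. k' (x, y, v) \<partial>Exp1 \<partial>Exp1 \<partial>Exp1)
     = (\<integral>\<^sup>+x. \<integral>\<^sup>+y. \<integral>\<^sup>+v. k (x, y, v) \<partial>Exp1 \<partial>Exp1 \<partial>Exp1)"
    using w by (simp only: nn_integral_Exp1_triple[OF w \<open>k' \<in> _\<close>] nn_integral_Exp1_triple[OF w assms(3)])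
  then show ?thesis by (simp add: k'_def)
qed

lemma sets_X_law [simp, measurable_cong]: "sets (X_law \<rho>) = sets borel"
  by (simp add: X_law_def)

lemma prob_space_X_law:
  assumes "0 < \<rho>" "\<rho> < 1"
  shows "prob_space (X_law \<rho>)"
proof -
  interpret A: prob_space "density lborel (exponential_density (1 - \<rho>))"
    using assms by (intro prob_space_exponential_density) simp
  interpret B: prob_space "density lborel (exponential_density \<rho>)"
    using assms by (intro prob_space_exponential_density) simp
  interpret pair_prob_space "density lborel (exponential_density (1 - \<rho>))" "density lborel (exponential_density \<rho>)" ..
  show ?thesis unfolding X_law_def by (rule prob_space_distr) measurable
qed

section \<open>The product space of weights and the invariance of its law under flips\<close>

definition wlaw :: "idx \<Rightarrow> real measure" where
  "wlaw k = (case k of Zet _ \<Rightarrow> X_law (1/2) | _ \<Rightarrow> Exp1)"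

lemma wlaw_simps [simp]:
  "wlaw (Hor i) = Exp1" "wlaw (Ver i) = Exp1" "wlaw (Blk i j) = Exp1" "wlaw (Zet i) = X_law (1/2)"
  by (simp_all add: wlaw_def)

lemma sets_wlaw [simp, measurable_cong]: "sets (wlaw k) = sets borel"
  by (simp add: wlaw_def split: idx.split)

lemma space_wlaw [simp]: "space (wlaw k) = UNIV"
  using sets_eq_imp_space_eq[OF sets_wlaw] by simp

lemma prob_space_wlaw: "prob_space (wlaw k)"
  by (simp add: wlaw_def prob_space_Exp1 prob_space_X_law split: idx.split)

interpretation wl: product_sigma_finite wlaw
  by (intro product_sigma_finite.intro prob_space_imp_sigma_finite prob_space_wlaw)

abbreviation weights :: "idx set \<Rightarrow> (idx \<Rightarrow> real) measure" where
  "weights J \<equiv> PiM J wlaw"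

lemma prob_space_weights: "prob_space (weights J)"
  by (intro prob_space_PiM prob_space_wlaw)

lemma borel_measurable_integral_component:
  assumes "G \<in> borel_measurable (weights (insert i I))"
  shows "(\<lambda>x. \<integral>\<^sup>+y. G (x(i := y)) \<partial>wlaw i) \<in> borel_measurable (weights I)"
proof -
  interpret i: prob_space "wlaw i" by (rule prob_space_wlaw)
  have "(\<lambda>(x, y). G (x(i := y))) \<in> borel_measurable (weights I \<Otimes>\<^sub>M wlaw i)"
    using measurable_compose[OF measurable_add_dim assms] by (simp add: split_beta')
  then show ?thesis by measurable
qed

lemma measurable_flip:
  assumes J: "Hor i \<in> J" "Ver j \<in> J" "Blk i j \<in> J"
  shows "flip w i j \<in> measurable (weights J) (weights J)"
proof (rule measurable_PiM_single')
  fix k assume k: "k \<in> J"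
  show "(\<lambda>f. flip w i j f k) \<in> measurable (weights J) (wlaw k)"
    using J k by (cases "k = Blk i j"; cases "k = Ver j"; cases "k = Hor i")
      (auto simp: flip_def Let_def cong: measurable_cong_sets)
next
  show "(\<lambda>f k. flip w i j f k) \<in> space (weights J) \<rightarrow> (\<Pi>\<^sub>E k\<in>J. space (wlaw k))"
    using J by (auto simp: space_PiM PiE_def extensional_def flip_def Let_def)
qed

text \<open>A flip reads and writes three coordinates only. Fubini freezes all others and leaves the
  invariance of the exponential triple.\<close>

lemma nn_integral_flip:
  assumes w: "0 < w" "w < 1" and J: "finite J" "Hor i \<in> J" "Ver j \<in> J" "Blk i j \<in> J"
    and F[measurable]: "F \<in> borel_measurable (weights J)"
  shows "(\<integral>\<^sup>+f. F (flip w i j f) \<partial>weights J) = (\<integral>\<^sup>+f. F f \<partial>weights J)"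
proof -
  define J0 where "J0 = J - {Hor i, Ver j, Blk i j}"
  have Jeq: "J = insert (Blk i j) (insert (Ver j) (insert (Hor i) J0))"
    using J by (auto simp: J0_def)
  have fin: "finite J0" using J by (simp add: J0_def)
  have upd [measurable]: "(\<lambda>(x, y, v). g(Hor i := x, Ver j := y, Blk i j := v)) \<in> measurable borel3 (weights J)"
    if "g \<in> space (weights J0)" for g
  proof (rule measurable_PiM_single')
    fix k assume "k \<in> J"
    have "(\<lambda>p :: real \<times> real \<times> real. case p of (x, y, v) \<Rightarrow> (if k = Blk i j then v else if k = Ver j then y else if k = Hor i then x else g k)) \<in> borel_measurable borel3"
      by (cases "k = Blk i j"; cases "k = Ver j"; cases "k = Hor i") (auto simp: split_beta)
    moreover have "(\<lambda>p. (case p of (x, y, v) \<Rightarrow> g(Hor i := x, Ver j := y, Blk i j := v)) k)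
      = (\<lambda>p. case p of (x, y, v) \<Rightarrow> (if k = Blk i j then v else if k = Ver j then y else if k = Hor i then x else g k))"
      by (auto simp: fun_eq_iff)
    ultimately show "(\<lambda>p. (case p of (x, y, v) \<Rightarrow> g(Hor i := x, Ver j := y, Blk i j := v)) k) \<in> measurable borel3 (wlaw k)"
      by (simp cong: measurable_cong_sets)
  next
    show "(\<lambda>p k. (case p of (x, y, v) \<Rightarrow> g(Hor i := x, Ver j := y, Blk i j := v)) k) \<in> space borel3 \<rightarrow> (\<Pi>\<^sub>E k\<in>J. space (wlaw k))"
      using that unfolding Jeq by (auto simp: space_PiM PiE_def extensional_def)
  qed
  have iterate: "(\<integral>\<^sup>+f. G f \<partial>weights J)
      = (\<integral>\<^sup>+g. \<integral>\<^sup>+x. \<integral>\<^sup>+y. \<integral>\<^sup>+v. G (g(Hor i := x, Ver j := y, Blk i j := v)) \<partial>Exp1 \<partial>Exp1 \<partial>Exp1 \<partial>weights J0)"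
    if G[measurable]: "G \<in> borel_measurable (weights J)" for G
  proof -
    define I1 where "I1 = insert (Hor i) J0"
    define I2 where "I2 = insert (Ver j) I1"
    have I: "finite I1" "finite I2" "Hor i \<notin> J0" "Ver j \<notin> I1" "Blk i j \<notin> I2" "J = insert (Blk i j) I2"
      using fin J by (auto simp: I1_def I2_def J0_def)
    have m1: "(\<lambda>x. \<integral>\<^sup>+v. G (x(Blk i j := v)) \<partial>Exp1) \<in> borel_measurable (weights I2)"
      using borel_measurable_integral_component[OF G[unfolded I(6)]] by simp
    have m2: "(\<lambda>x. \<integral>\<^sup>+y. \<integral>\<^sup>+v. G (x(Ver j := y, Blk i j := v)) \<partial>Exp1 \<partial>Exp1) \<in> borel_measurable (weights I1)"
      using borel_measurable_integral_component[OF m1[unfolded I2_def]] by simp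
    have "(\<integral>\<^sup>+f. G f \<partial>weights J) = (\<integral>\<^sup>+f. \<integral>\<^sup>+v. G (f(Blk i j := v)) \<partial>Exp1 \<partial>weights I2)"
      using wl.product_nn_integral_insert[OF I(2,5), of G] G by (simp add: I(6))
    also have "\<dots> = (\<integral>\<^sup>+f. \<integral>\<^sup>+y. \<integral>\<^sup>+v. G (f(Ver j := y, Blk i j := v)) \<partial>Exp1 \<partial>Exp1 \<partial>weights I1)"
      using wl.product_nn_integral_insert[OF I(1,4), of "\<lambda>x. \<integral>\<^sup>+v. G (x(Blk i j := v)) \<partial>Exp1"] m1 by (simp add: I2_def)
    also have "\<dots> = (\<integral>\<^sup>+g. \<integral>\<^sup>+x. \<integral>\<^sup>+y. \<integral>\<^sup>+v. G (g(Hor i := x, Ver j := y, Blk i j := v)) \<partial>Exp1 \<partial>Exp1 \<partial>Exp1 \<partial>weights J0)"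
      using wl.product_nn_integral_insert[OF fin I(3), of "\<lambda>x. \<integral>\<^sup>+y. \<integral>\<^sup>+v. G (x(Ver j := y, Blk i j := v)) \<partial>Exp1 \<partial>Exp1"] m2 by (simp add: I1_def)
    finally show ?thesis .
  qed
  note measurable_flip[OF J(2-4), measurable]
  have "(\<integral>\<^sup>+f. F (flip w i j f) \<partial>weights J)
      = (\<integral>\<^sup>+g. \<integral>\<^sup>+x. \<integral>\<^sup>+y. \<integral>\<^sup>+v. F (flip w i j (g(Hor i := x, Ver j := y, Blk i j := v))) \<partial>Exp1 \<partial>Exp1 \<partial>Exp1 \<partial>weights J0)"
    by (rule iterate) measurable
  also have "\<dots> = (\<integral>\<^sup>+g. \<integral>\<^sup>+x. \<integral>\<^sup>+y. \<integral>\<^sup>+v. F (g(Hor i := x, Ver j := y, Blk i j := v)) \<partial>Exp1 \<partial>Exp1 \<partial>Exp1 \<partial>weights J0)"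
  proof (rule nn_integral_cong)
    fix g assume g: "g \<in> space (weights J0)"
    have flip_eq: "flip w i j (g(Hor i := x, Ver j := y, Blk i j := v)) =
      g(Hor i := w * (\<bar>v\<bar> + max (\<bar>x\<bar> / w - \<bar>y\<bar> / (1-w)) 0),
        Ver j := (1-w) * (\<bar>v\<bar> + max (\<bar>y\<bar> / (1-w) - \<bar>x\<bar> / w) 0), Blk i j := min (\<bar>x\<bar> / w) (\<bar>y\<bar> / (1-w)))" for x y v
      by (auto simp: flip_def Let_def)
    define H where "H = (\<lambda>p. F (case p of (x, y, v) \<Rightarrow> g(Hor i := x, Ver j := y, Blk i j := v)))"
    have H: "H \<in> borel_measurable borel3"
      unfolding H_def by (rule measurable_compose[OF upd[OF g] F])
    show "(\<integral>\<^sup>+x. \<integral>\<^sup>+y. \<integral>\<^sup>+v. F (flip w i j (g(Hor i := x, Ver j := y, Blk i j := v))) \<partial>Exp1 \<partial>Exp1 \<partial>Exp1)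
      = (\<integral>\<^sup>+x. \<integral>\<^sup>+y. \<integral>\<^sup>+v. F (g(Hor i := x, Ver j := y, Blk i j := v)) \<partial>Exp1 \<partial>Exp1 \<partial>Exp1)"
      using Exp1_triple_flip[OF w H] by (simp add: flip_eq H_def)
  qed
  also have "\<dots> = (\<integral>\<^sup>+f. F f \<partial>weights J)"
    by (rule iterate[symmetric]) measurable
  finally show ?thesis .
qed

section \<open>Stationarity and the exponential moment\<close>

definition rect_coords :: "nat \<Rightarrow> nat \<Rightarrow> idx set" where
  "rect_coords m n = Hor ` {..<m} \<union> Ver ` {..<n} \<union> (\<lambda>(i, j). Blk i j) ` ({..<m} \<times> {..<n})"

lemma finite_rect_coords [simp]: "finite (rect_coords m n)"
  by (simp add: rect_coords_def)

lemma rect_coords_mem [simp]: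
  "Hor i \<in> rect_coords m n \<longleftrightarrow> i < m" "Ver j \<in> rect_coords m n \<longleftrightarrow> j < n" "Blk i j \<in> rect_coords m n \<longleftrightarrow> i < m \<and> j < n"
  "Zet k \<notin> rect_coords m n"
  by (auto simp: rect_coords_def)

lemma rect_coords_mono: "m \<le> m' \<Longrightarrow> n \<le> n' \<Longrightarrow> rect_coords m n \<subseteq> rect_coords m' n'"
  by (auto simp: rect_coords_def)

lemma measurable_coordinate: "k \<in> J \<Longrightarrow> (\<lambda>f. f k) \<in> borel_measurable (weights J)"
  using measurable_component_singleton[of k J wlaw] by (simp cong: measurable_cong_sets)

lemma measurable_lp:
  assumes "rect_coords m n \<subseteq> J"
  shows "(\<lambda>f. lp a b f m n) \<in> borel_measurable (weights J)"
  using assms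
proof (induction a b "\<lambda>_ :: idx. 0 :: real" m n rule: lp.induct)
  case (2 a b i)
  then have "rect_coords i 0 \<subseteq> J" "Hor i \<in> J"
    using rect_coords_mono[of i "Suc i" 0 0] subsetD[of "rect_coords (Suc i) 0" J "Hor i"] by auto
  with 2 measurable_coordinate[of "Hor i" J] show ?case by simp
next
  case (3 a b j)
  then have "rect_coords 0 j \<subseteq> J" "Ver j \<in> J"
    using rect_coords_mono[of 0 0 j "Suc j"] subsetD[of "rect_coords 0 (Suc j)" J "Ver j"] by auto
  with 3 measurable_coordinate[of "Ver j" J] show ?case by simp
next
  case (4 a b i j)
  then have "rect_coords i (Suc j) \<subseteq> J" "rect_coords (Suc i) j \<subseteq> J" "Blk i j \<in> J"
    using rect_coords_mono[of i "Suc i" "Suc j" "Suc j"] rect_coords_mono[of "Suc i" "Suc i" j "Suc j"]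
      subsetD[of "rect_coords (Suc i) (Suc j)" J "Blk i j"] by auto
  with 4 measurable_coordinate[of "Blk i j" J] show ?case by simp
qed simp

lemma AE_weights_nonneg:
  assumes "k \<in> J" "wlaw k = Exp1"
  shows "AE f in weights J. 0 \<le> f k"
  by (rule AE_PiM_component[OF prob_space_wlaw assms(1)]) (unfold assms(2), rule AE_Exp1_nonneg)

lemma weights_insert_integral:
  assumes "finite J" "k \<in> J" and F: "F \<in> borel_measurable (weights J)"
  shows "(\<integral>\<^sup>+f. F f \<partial>weights J) = (\<integral>\<^sup>+f. \<integral>\<^sup>+y. F (f(k := y)) \<partial>wlaw k \<partial>weights (J - {k}))"
  using wl.product_nn_integral_insert[of "J - {k}" k F] assms by (simp add: insert_absorb)

text \<open>Independence of one coordinate from the rest, where not depending on coordinate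
  \<open>k\<close> is expressed as invariance under updates at \<open>k\<close>; no sigma algebras
  have to be handled.\<close>

lemma nn_integral_weights_peel:
  assumes J: "finite J" "k \<in> J" and X: "X \<in> borel_measurable (weights J)"
    and u: "u \<in> borel_measurable borel" and indep: "\<And>f y. X (f(k := y)) = X f"
  shows "(\<integral>\<^sup>+f. X f * u (f k) \<partial>weights J) = (\<integral>\<^sup>+f. X f \<partial>weights J) * (\<integral>\<^sup>+y. u y \<partial>wlaw k)"
proof -
  interpret k: prob_space "wlaw k" by (rule prob_space_wlaw)
  have uk [measurable]: "u \<in> borel_measurable (wlaw k)"
    using u by (simp cong: measurable_cong_sets)
  have m: "(\<lambda>f. X f * u (f k)) \<in> borel_measurable (weights J)"
    by (intro borel_measurable_times_ennreal X measurable_compose[OF measurable_coordinate[OF J(2)] u])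
  have X': "X \<in> borel_measurable (weights (insert k (J - {k})))"
    using X J by (simp add: insert_absorb)
  have Xm: "(\<lambda>f. \<integral>\<^sup>+y. X (f(k := y)) \<partial>wlaw k) \<in> borel_measurable (weights (J - {k}))"
    by (rule borel_measurable_integral_component[OF X'])
  have "(\<integral>\<^sup>+f. X f * u (f k) \<partial>weights J) = (\<integral>\<^sup>+f. X f * (\<integral>\<^sup>+y. u y \<partial>wlaw k) \<partial>weights (J - {k}))"
    by (subst weights_insert_integral[OF J m]) (simp add: indep nn_integral_cmult)
  also have "\<dots> = (\<integral>\<^sup>+f. X f \<partial>weights (J - {k})) * (\<integral>\<^sup>+y. u y \<partial>wlaw k)"
    using Xm by (intro nn_integral_multc) (simp add: indep k.emeasure_space_1[simplified])
  also have "(\<integral>\<^sup>+f. X f \<partial>weights (J - {k})) = (\<integral>\<^sup>+f. X f \<partial>weights J)"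
    by (subst weights_insert_integral[OF J X]) (simp add: indep k.emeasure_space_1[simplified])
  finally show ?thesis .
qed

lemma nn_integral_weights_prod:
  assumes J: "finite J" "K \<subseteq> J" and u: "\<And>k. k \<in> K \<Longrightarrow> u k \<in> borel_measurable borel"
  shows "(\<integral>\<^sup>+f. (\<Prod>k\<in>K. u k (f k)) \<partial>weights J) = (\<Prod>k\<in>K. \<integral>\<^sup>+y. u k y \<partial>wlaw k)"
proof -
  have "finite K" using J finite_subset by blast
  then show ?thesis using J(2) u
  proof (induction K)
    case empty
    then show ?case using prob_space.emeasure_space_1[OF prob_space_weights] by simp
  next
    case (insert k K)
    have "(\<integral>\<^sup>+f. (\<Prod>k\<in>K. u k (f k)) * u k (f k) \<partial>weights J)
        = (\<integral>\<^sup>+f. (\<Prod>k\<in>K. u k (f k)) \<partial>weights J) * (\<integral>\<^sup>+y. u k y \<partial>wlaw k)"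
    proof (rule nn_integral_weights_peel)
      show "(\<lambda>f. \<Prod>k\<in>K. u k (f k)) \<in> borel_measurable (weights J)"
      proof (rule borel_measurable_prod_ennreal)
        fix i assume "i \<in> K"
        then show "(\<lambda>x. u i (x i)) \<in> borel_measurable (weights J)"
          using insert.prems by (intro measurable_compose[OF measurable_coordinate]) auto
      qed
    next
      fix f y show "(\<Prod>ka\<in>K. u ka ((f(k := y)) ka)) = (\<Prod>k\<in>K. u k (f k))"
        using insert.hyps by (intro prod.cong) auto
    qed (use J insert.prems in auto)
    then show ?case using insert by (simp add: mult.commute)
  qed
qed

text \<open>Burke's property in the form of a map: the composition of the flips, lower cells first,
  preserves the product law and carries the weights to the increments along the boundary of
  \<open>S\<close>, which are therefore independent exponentials.\<close>

lemma sweep_exists: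
  assumes w: "0 < w" "w < 1" and J: "finite J" and S: "finite S" "down_closed S"
    and cells: "\<And>i j. (i, j) \<in> S \<Longrightarrow> Hor i \<in> J \<and> Ver j \<in> J \<and> Blk i j \<in> J"
  shows "\<exists>\<Phi>. \<Phi> \<in> measurable (weights J) (weights J)
    \<and> (\<forall>F \<in> borel_measurable (weights J). (\<integral>\<^sup>+f. F (\<Phi> f) \<partial>weights J) = (\<integral>\<^sup>+f. F f \<partial>weights J))
    \<and> (\<forall>f. swept w S f (\<Phi> f))"
  using S cells
proof (induction "card S" arbitrary: S)
  case 0
  then have "S = {}" by simp
  then show ?case using swept_empty[OF w] by (intro exI[of _ "\<lambda>f. f"]) auto
next
  case (Suc c)
  then have "S \<noteq> {}" by auto
  then obtain i j where ij: "(i, j) \<in> S" "down_closed (S - {(i, j)})"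
    using down_closed_remove_maximal[OF Suc.prems(1) _ Suc.prems(2)] by blast
  let ?S = "S - {(i, j)}"
  have ins: "insert (i, j) ?S = S" using ij by auto
  have "\<exists>\<Phi>. \<Phi> \<in> measurable (weights J) (weights J)
    \<and> (\<forall>F \<in> borel_measurable (weights J). (\<integral>\<^sup>+f. F (\<Phi> f) \<partial>weights J) = (\<integral>\<^sup>+f. F f \<partial>weights J))
    \<and> (\<forall>f. swept w ?S f (\<Phi> f))"
  proof (rule Suc.hyps(1))
    show "c = card ?S" using Suc.hyps(2) Suc.prems(1) ij(1) by simp
    show "Hor i' \<in> J \<and> Ver j' \<in> J \<and> Blk i' j' \<in> J" if "(i', j') \<in> ?S" for i' j'
      using Suc.prems(3) that by blast
  qed (use Suc.prems(1) ij(2) in auto)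
  then obtain \<Phi> where \<Phi>: "\<Phi> \<in> measurable (weights J) (weights J)"
    "\<And>F. F \<in> borel_measurable (weights J) \<Longrightarrow> (\<integral>\<^sup>+f. F (\<Phi> f) \<partial>weights J) = (\<integral>\<^sup>+f. F f \<partial>weights J)"
    "\<And>f. swept w ?S f (\<Phi> f)" by blast
  have J': "Hor i \<in> J" "Ver j \<in> J" "Blk i j \<in> J" using Suc.prems(3) ij by auto
  note mf = measurable_flip[OF J']
  show ?case
  proof (intro exI[of _ "\<lambda>f. flip w i j (\<Phi> f)"] conjI ballI allI)
    show "(\<lambda>f. flip w i j (\<Phi> f)) \<in> measurable (weights J) (weights J)"
      by (rule measurable_compose[OF \<Phi>(1) mf])
    fix F :: "(idx \<Rightarrow> real) \<Rightarrow> ennreal" assume F: "F \<in> borel_measurable (weights J)"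
    show "(\<integral>\<^sup>+f. F (flip w i j (\<Phi> f)) \<partial>weights J) = (\<integral>\<^sup>+f. F f \<partial>weights J)"
      using \<Phi>(2)[OF measurable_compose[OF mf F]] nn_integral_flip[OF w J J' F] by simp
  next
    fix f show "swept w S f (flip w i j (\<Phi> f))"
      using swept_flip[OF w ij(2) _ _ \<Phi>(3)[of f], of i j] Suc.prems(2) unfolding ins by simp
  qed
qed

lemma nn_integral_Exp1_exp_abs:
  assumes "c < 1"
  shows "(\<integral>\<^sup>+x. ennreal (exp (c * \<bar>x\<bar>)) \<partial>Exp1) = ennreal (1 / (1 - c))"
proof -
  have "AE x in Exp1. ennreal (exp (c * \<bar>x\<bar>)) = ennreal (exp (c * x))"
    by (rule eventually_mono[OF AE_Exp1_nonneg]) simp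
  from nn_integral_cong_AE[OF this] nn_integral_Exp1_exp[OF assms] show ?thesis by simp
qed

lemma lp_bottom_row: "lp a b f 0 n = (\<Sum>j<n. b * \<bar>f (Ver j)\<bar>)"
  by (induction n) auto

section \<open>Changing the rate of the vertical boundary by a change of measure\<close>

lemma nn_integral_scale_coordinate:
  assumes J: "finite J" "k \<in> J" "wlaw k = Exp1" and c: "0 < c" and F: "F \<in> borel_measurable (weights J)"
  shows "(\<integral>\<^sup>+f. F (f(k := c * f k)) \<partial>weights J)
       = (\<integral>\<^sup>+f. F f * ennreal (exp (-(1/c - 1) * f k) / c) \<partial>weights J)"
proof -
  have upd: "(\<lambda>f. f(k := c * f k)) \<in> measurable (weights J) (weights J)"
  proof (rule measurable_PiM_single')
    fix i assume "i \<in> J"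
    then show "(\<lambda>f. (f(k := c * f k)) i) \<in> measurable (weights J) (wlaw i)"
      using measurable_coordinate[of i J] J by (cases "i = k") (simp_all cong: measurable_cong_sets)
  qed (use J in \<open>auto simp: space_PiM PiE_def extensional_def\<close>)
  have m: "(\<lambda>f. F f * ennreal (exp (-(1/c - 1) * f k) / c)) \<in> borel_measurable (weights J)"
    using F measurable_coordinate[OF J(2)] by measurable
  have comp: "(\<lambda>y. F (f(k := y))) \<in> borel_measurable borel" if "f \<in> space (weights (J - {k}))" for f
  proof -
    have "(\<lambda>y. f(k := y)) \<in> measurable (wlaw k) (weights (insert k (J - {k})))"
      using that by (intro measurable_component_update) auto
    from measurable_compose[OF this] F J show ?thesis by (simp add: insert_absorb cong: measurable_cong_sets)
  qed
  have "(\<integral>\<^sup>+f. F (f(k := c * f k)) \<partial>weights J) = (\<integral>\<^sup>+f. \<integral>\<^sup>+y. F (f(k := c * y)) \<partial>Exp1 \<partial>weights (J - {k}))"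
    using weights_insert_integral[OF J(1,2) measurable_compose[OF upd F]] J(3) by simp
  also have "\<dots> = (\<integral>\<^sup>+f. \<integral>\<^sup>+y. F (f(k := y)) * ennreal (exp (-(1/c - 1) * y) / c) \<partial>Exp1 \<partial>weights (J - {k}))"
  proof (rule nn_integral_cong)
    fix f assume "f \<in> space (weights (J - {k}))"
    from nn_integral_Exp1_scale[OF c comp[OF this]]
    show "(\<integral>\<^sup>+y. F (f(k := c * y)) \<partial>Exp1) = (\<integral>\<^sup>+y. F (f(k := y)) * ennreal (exp (-(1/c - 1) * y) / c) \<partial>Exp1)"
      by (simp only: mult.commute)
  qed
  also have "\<dots> = (\<integral>\<^sup>+f. F f * ennreal (exp (-(1/c - 1) * f k) / c) \<partial>weights J)"
    by (subst weights_insert_integral[OF J(1,2) m]) (simp add: J(3))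
  finally show ?thesis .
qed

text \<open>Scaling the coordinates rather than the factor \<open>b\<close> of \<open>lp\<close>
  turns a change of the boundary rate into a substitution, to which the likelihood ratio applies.
  Only the first \<open>n\<close> coordinates are scaled, so the ratio is a finite product.\<close>

definition scale_ver :: "real \<Rightarrow> nat \<Rightarrow> (idx \<Rightarrow> real) \<Rightarrow> idx \<Rightarrow> real" where
  "scale_ver c n f k = (case k of Ver j \<Rightarrow> if j < n then c * f (Ver j) else f (Ver j) | _ \<Rightarrow> f k)"

lemma scale_ver_Suc: "scale_ver c (Suc n) f = scale_ver c n (f(Ver n := c * f (Ver n)))"
  by (auto simp: scale_ver_def fun_eq_iff split: idx.split)

lemma lp_scale_ver:
  assumes "0 < c" "j \<le> n"
  shows "lp a b (scale_ver c n f) i j = lp a (c * b) f i j"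
  using assms(2)
proof (induction a b f i j rule: lp.induct)
  case (3 a b f j)
  then show ?case using assms(1) by (simp add: scale_ver_def abs_mult)
qed (simp_all add: scale_ver_def)

lemma measurable_scale_ver:
  assumes "\<And>j. j < n \<Longrightarrow> Ver j \<in> J"
  shows "scale_ver c n \<in> measurable (weights J) (weights J)"
proof (rule measurable_PiM_single')
  fix i assume "i \<in> J"
  then show "(\<lambda>f. scale_ver c n f i) \<in> measurable (weights J) (wlaw i)"
    using measurable_coordinate[of i J] by (cases i) (auto simp: scale_ver_def cong: measurable_cong_sets)
qed (use assms in \<open>auto simp: space_PiM PiE_def extensional_def scale_ver_def split: idx.split\<close>)

lemma nn_integral_scale_ver:
  assumes J: "finite J" "\<And>j. j < n \<Longrightarrow> Ver j \<in> J" and c: "0 < c" and F: "F \<in> borel_measurable (weights J)"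
  shows "(\<integral>\<^sup>+f. F (scale_ver c n f) \<partial>weights J)
       = (\<integral>\<^sup>+f. F f * (\<Prod>j<n. ennreal (exp (-(1/c - 1) * f (Ver j)) / c)) \<partial>weights J)"
  using J(2) F
proof (induction n arbitrary: F)
  case 0
  have "scale_ver c 0 f = f" for f by (auto simp: scale_ver_def fun_eq_iff split: idx.split)
  then show ?case by simp
next
  case (Suc n)
  have V: "Ver n \<in> J" using Suc.prems by simp
  let ?\<rho> = "\<lambda>f :: idx \<Rightarrow> real. ennreal (exp (-(1/c - 1) * f (Ver n)) / c)"
  have \<rho>: "?\<rho> \<in> borel_measurable (weights J)" using measurable_coordinate[OF V] by measurable
  have "(\<integral>\<^sup>+f. F (scale_ver c (Suc n) f) \<partial>weights J) = (\<integral>\<^sup>+f. F (scale_ver c n f) * ?\<rho> f \<partial>weights J)"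
    unfolding scale_ver_Suc using Suc.prems
    by (intro nn_integral_scale_coordinate[OF J(1) V _ c] measurable_compose[OF measurable_scale_ver]) auto
  also have "\<dots> = (\<integral>\<^sup>+f. F (scale_ver c n f) * ?\<rho> (scale_ver c n f) \<partial>weights J)"
    by (simp add: scale_ver_def)
  also have "\<dots> = (\<integral>\<^sup>+f. F f * ?\<rho> f * (\<Prod>j<n. ennreal (exp (-(1/c - 1) * f (Ver j)) / c)) \<partial>weights J)"
    using Suc.prems \<rho> by (intro Suc.IH) auto
  finally show ?case by (simp add: mult_ac)
qed

text \<open>The exponential moment is exact: changing the rate of the vertical boundary weights from
  \<open>1 - z\<close> to \<open>1 - w\<close> cancels the contribution of the left column, and by stationarity the
  increments along the top row are independent exponentials of rate \<open>w\<close>.\<close>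

lemma nn_integral_exp_lp:
  assumes w: "0 < w" "w < 1" and z: "0 < z" "z < 1" and J: "finite J" "rect_coords m n \<subseteq> J"
  shows "(\<integral>\<^sup>+f. ennreal (exp ((w - z) * lp (1/w) (1/(1-z)) f m n)) \<partial>weights J)
       = ennreal ((w / z) ^ m * ((1 - z) / (1 - w)) ^ n)"
proof -
  \<comment> \<open>Scaling by \<open>c\<close> turns the stationary vertical mean
    \<open>1 / (1 - w)\<close> into \<open>1 / (1 - z)\<close>. The exponent of its likelihood ratio
    is then exactly \<open>w - z\<close> times the stationary boundary weight.\<close>
  define c where "c = (1 - w) / (1 - z)"
  have c: "0 < c" "1 / (1 - z) = c * (1 / (1 - w))" "1 / c - 1 = (w - z) * (1 / (1 - w))"
    using w z by (simp_all add: c_def field_simps)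
  have cn: "(1 / c) ^ n = ((1 - z) / (1 - w)) ^ n" by (simp add: c_def)
  define G where "G = lp (1/w) (1/(1-w))"
  have J': "Ver j \<in> J" if "j < n" for j using subsetD[OF J(2), of "Ver j"] that by simp
  have G_meas: "(\<lambda>f. G f m n) \<in> borel_measurable (weights J)"
    unfolding G_def by (rule measurable_lp[OF J(2)])
  define S where "S = {..<m} \<times> {..<n}"
  have S: "finite S" "down_closed S" by (auto simp: S_def down_closed_def)
  obtain \<Phi> where \<Phi>: "\<Phi> \<in> measurable (weights J) (weights J)"
    "\<And>F. F \<in> borel_measurable (weights J) \<Longrightarrow> (\<integral>\<^sup>+f. F (\<Phi> f) \<partial>weights J) = (\<integral>\<^sup>+f. F f \<partial>weights J)"
    "\<And>f. swept w S f (\<Phi> f)"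
  proof -
    have "Hor i \<in> J \<and> Ver j \<in> J \<and> Blk i j \<in> J" if "(i, j) \<in> S" for i j
      using that subsetD[OF J(2)] by (auto simp: S_def)
    from sweep_exists[OF w J(1) S this] that show thesis by blast
  qed
  have top: "G f m n - G f 0 n = (\<Sum>i<m. 1 / w * \<bar>\<Phi> f (Hor i)\<bar>)" for f
  proof -
    have "\<bar>\<Phi> f (Hor i)\<bar> = w * (G f (Suc i) n - G f i n)" if "i < m" for i
      unfolding G_def using that by (intro sweptD(3)[OF \<Phi>(3)]) (auto simp: S_def)
    then have "(\<Sum>i<m. 1 / w * \<bar>\<Phi> f (Hor i)\<bar>) = (\<Sum>i<m. G f (Suc i) n - G f i n)"
      using w by (intro sum.cong) auto
    then show ?thesis using sum_lessThan_telescope[of "\<lambda>i. G f i n" m] by simp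
  qed
  have "(\<integral>\<^sup>+f. ennreal (exp ((w - z) * lp (1/w) (1/(1-z)) f m n)) \<partial>weights J)
      = (\<integral>\<^sup>+f. ennreal (exp ((w - z) * G (scale_ver c n f) m n)) \<partial>weights J)"
    unfolding G_def c(2) by (simp only: lp_scale_ver[OF c(1) order_refl])
  also have "\<dots> = (\<integral>\<^sup>+f. ennreal (exp ((w - z) * G f m n))
       * (\<Prod>j<n. ennreal (exp (-(1/c - 1) * f (Ver j)) / c)) \<partial>weights J)"
    using G_meas J' by (intro nn_integral_scale_ver[OF J(1) _ c(1)]) auto
  also have "\<dots> = (\<integral>\<^sup>+f. ennreal ((1 / c) ^ n) * (\<Prod>k\<in>Hor ` {..<m}. ennreal (exp ((w - z) / w * \<bar>\<Phi> f k\<bar>))) \<partial>weights J)"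
  proof (rule nn_integral_cong_AE)
    have "AE f in weights J. \<forall>j\<in>{..<n}. 0 \<le> f (Ver j)"
      using J' by (subst AE_finite_all) (auto intro: AE_weights_nonneg)
    then show "AE f in weights J. ennreal (exp ((w - z) * G f m n)) * (\<Prod>j<n. ennreal (exp (-(1/c - 1) * f (Ver j)) / c))
      = ennreal ((1 / c) ^ n) * (\<Prod>k\<in>Hor ` {..<m}. ennreal (exp ((w - z) / w * \<bar>\<Phi> f k\<bar>)))"
    proof (rule eventually_mono)
      fix f :: "idx \<Rightarrow> real" assume pos: "\<forall>j\<in>{..<n}. 0 \<le> f (Ver j)"
      have left: "G f 0 n = (\<Sum>j<n. 1 / (1 - w) * f (Ver j))"
        unfolding G_def lp_bottom_row using pos by (intro sum.cong) auto
      have "(\<Prod>j<n. exp (-(1/c - 1) * f (Ver j)) / c) = (1 / c) ^ n * exp (\<Sum>j<n. -(1/c - 1) * f (Ver j))"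
        by (simp add: prod_dividef exp_sum power_one_over)
      also have "(\<Sum>j<n. -(1/c - 1) * f (Ver j)) = - (w - z) * G f 0 n"
        unfolding left c(3) sum_distrib_left by (intro sum.cong) (simp_all only: mult_minus_left mult.assoc)
      finally have P1: "(\<Prod>j<n. exp (-(1/c - 1) * f (Ver j)) / c) = (1 / c) ^ n * exp (- (w - z) * G f 0 n)" .
      have P2: "(\<Prod>k\<in>Hor ` {..<m}. exp ((w - z) / w * \<bar>\<Phi> f k\<bar>)) = exp ((w - z) * (G f m n - G f 0 n))"
        unfolding top by (subst prod.reindex) (auto simp: inj_on_def exp_sum sum_distrib_left)
      have "exp ((w - z) * G f m n) * (\<Prod>j<n. exp (-(1/c - 1) * f (Ver j)) / c)
        = (1 / c) ^ n * (\<Prod>k\<in>Hor ` {..<m}. exp ((w - z) / w * \<bar>\<Phi> f k\<bar>))"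
        unfolding P1 P2 by (simp add: exp_add[symmetric] algebra_simps)
      then show "ennreal (exp ((w - z) * G f m n)) * (\<Prod>j<n. ennreal (exp (-(1/c - 1) * f (Ver j)) / c))
        = ennreal ((1 / c) ^ n) * (\<Prod>k\<in>Hor ` {..<m}. ennreal (exp ((w - z) / w * \<bar>\<Phi> f k\<bar>)))"
        using c(1) by (simp add: prod_ennreal ennreal_mult[symmetric] prod_nonneg)
    qed
  qed
  also have "\<dots> = (\<integral>\<^sup>+f. ennreal ((1 / c) ^ n) * (\<Prod>k\<in>Hor ` {..<m}. ennreal (exp ((w - z) / w * \<bar>f k\<bar>))) \<partial>weights J)"
  proof (rule \<Phi>(2))
    have "(\<lambda>f. ennreal (exp ((w - z) / w * \<bar>f k\<bar>))) \<in> borel_measurable (weights J)" if "k \<in> Hor ` {..<m}" for k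
    proof -
      have "k \<in> J" using that subsetD[OF J(2)] by auto
      then show ?thesis using measurable_coordinate[of k J] by measurable
    qed
    then show "(\<lambda>f. ennreal ((1 / c) ^ n) * (\<Prod>k\<in>Hor ` {..<m}. ennreal (exp ((w - z) / w * \<bar>f k\<bar>)))) \<in> borel_measurable (weights J)"
      by (intro borel_measurable_times_ennreal borel_measurable_prod_ennreal) auto
  qed
  also have "\<dots> = ennreal ((1 / c) ^ n) * (\<Prod>k\<in>Hor ` {..<m}. \<integral>\<^sup>+y. ennreal (exp ((w - z) / w * \<bar>y\<bar>)) \<partial>wlaw k)"
  proof -
    have sub: "Hor ` {..<m} \<subseteq> J" using subsetD[OF J(2)] by auto
    have "(\<lambda>f. \<Prod>k\<in>Hor ` {..<m}. ennreal (exp ((w - z) / w * \<bar>f k\<bar>))) \<in> borel_measurable (weights J)"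
    proof (rule borel_measurable_prod_ennreal)
      fix k assume "k \<in> Hor ` {..<m}"
      then have "k \<in> J" using sub by auto
      then show "(\<lambda>f. ennreal (exp ((w - z) / w * \<bar>f k\<bar>))) \<in> borel_measurable (weights J)"
        using measurable_coordinate[of k J] by measurable
    qed
    from nn_integral_cmult[OF this] nn_integral_weights_prod[OF J(1) sub, of "\<lambda>_ y. ennreal (exp ((w - z) / w * \<bar>y\<bar>))"]
    show ?thesis by simp
  qed
  also have "(\<Prod>k\<in>Hor ` {..<m}. \<integral>\<^sup>+y. ennreal (exp ((w - z) / w * \<bar>y\<bar>)) \<partial>wlaw k) = ennreal ((w / z) ^ m)"
  proof -
    \<comment> \<open>The moment of an exponential of rate \<open>w\<close> at \<open>w - z\<close>
      is \<open>w / (w - (w - z))\<close>, finite because \<open>z\<close> is positive.\<close>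
    have "(w - z) / w < 1" "1 / (1 - (w - z) / w) = w / z" using w z by (simp_all add: field_simps)
    then have "(\<integral>\<^sup>+y. ennreal (exp ((w - z) / w * \<bar>y\<bar>)) \<partial>Exp1) = ennreal (w / z)"
      using nn_integral_Exp1_exp_abs by metis
    then have "(\<Prod>k\<in>Hor ` {..<m}. \<integral>\<^sup>+y. ennreal (exp ((w - z) / w * \<bar>y\<bar>)) \<partial>wlaw k) = ennreal (w / z) ^ m"
      by (subst prod.reindex) (auto simp: inj_on_def)
    then show ?thesis using w z by (simp add: ennreal_power)
  qed
  finally show ?thesis unfolding cn using w z by (simp add: ennreal_mult[symmetric] mult.commute)
qed

section \<open>Exit probabilities of the stationary model\<close>

text \<open>Keeping \<open>\<theta>\<close> on both sides of the inequality covers both tails: a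
  negative \<open>\<theta>\<close> bounds the probability that \<open>X\<close> is at most
  \<open>t\<close>.\<close>

lemma (in prob_space) exponential_markov:
  assumes X: "X \<in> borel_measurable M" and B: "0 \<le> B" "(\<integral>\<^sup>+x. ennreal (exp (\<theta> * X x)) \<partial>M) \<le> ennreal B"
  shows "measure M {x \<in> space M. \<theta> * t \<le> \<theta> * X x} \<le> exp (-(\<theta> * t)) * B"
proof -
  have "emeasure M {x \<in> space M. \<theta> * t \<le> \<theta> * X x} = (\<integral>\<^sup>+x. indicator {x \<in> space M. \<theta> * t \<le> \<theta> * X x} x \<partial>M)"
    using X by (intro nn_integral_indicator[symmetric]) measurable
  also have "\<dots> \<le> (\<integral>\<^sup>+x. ennreal (exp (-(\<theta> * t))) * ennreal (exp (\<theta> * X x)) \<partial>M)"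
    by (intro nn_integral_mono)
       (auto simp: indicator_def ennreal_mult[symmetric] exp_add[symmetric] simp flip: ennreal_1 intro!: ennreal_leI)
  also have "\<dots> = ennreal (exp (-(\<theta> * t))) * (\<integral>\<^sup>+x. ennreal (exp (\<theta> * X x)) \<partial>M)"
    using X by (intro nn_integral_cmult) measurable
  also have "\<dots> \<le> ennreal (exp (-(\<theta> * t)) * B)"
    using B by (simp add: ennreal_mult mult_left_mono)
  finally show ?thesis using B(1) by (simp add: emeasure_eq_measure)
qed

text \<open>The two boundaries are separated by a level \<open>t\<close> and an intermediate rate
  \<open>w'\<close>. Let \<open>G\<close> be the passage time with rates \<open>w'\<close> and
  \<open>1 - w\<close>. Either \<open>G\<close> is at most \<open>t\<close>, a lower tail event, or
  \<open>G\<close> exceeds \<open>t\<close>. In the second case the horizontal boundary, already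
  ahead at rate \<open>w\<close>, also wins at the smaller rate \<open>w'\<close>, and its passage
  time exceeds \<open>t\<close>; adding a vertical boundary of rate \<open>1 - z\<close> bounds this
  by an upper tail. Both moments are known exactly.\<close>

lemma exit_probability_le:
  assumes w: "0 < z" "z < w'" "w' < w" "w < 1" and J: "finite J" "rect_coords m n \<subseteq> J"
  shows "measure (weights J) {f \<in> space (weights J). lp 0 (1/(1-w)) f m n < lp (1/w) 0 f m n}
    \<le> exp (-((w' - z) * t)) * ((w' / z) ^ m * ((1 - z) / (1 - w')) ^ n)
      + exp ((w - w') * t) * ((w' / w) ^ m * ((1 - w) / (1 - w')) ^ n)"
proof -
  interpret prob_space "weights J" by (rule prob_space_weights)
  note lpm = measurable_lp[OF J(2), measurable]
  let ?A = "{f \<in> space (weights J). (w' - z) * t \<le> (w' - z) * lp (1/w') (1/(1-z)) f m n}"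
  let ?B = "{f \<in> space (weights J). (w' - w) * t \<le> (w' - w) * lp (1/w') (1/(1-w)) f m n}"
  have A: "measure (weights J) ?A \<le> exp (-((w' - z) * t)) * ((w' / z) ^ m * ((1 - z) / (1 - w')) ^ n)"
    using w by (intro exponential_markov lpm) (simp_all add: nn_integral_exp_lp[OF _ _ _ _ J])
  have B: "measure (weights J) ?B \<le> exp (-((w' - w) * t)) * ((w' / w) ^ m * ((1 - w) / (1 - w')) ^ n)"
    using w by (intro exponential_markov lpm) (simp_all add: nn_integral_exp_lp[OF _ _ _ _ J])
  have "{f \<in> space (weights J). lp 0 (1/(1-w)) f m n < lp (1/w) 0 f m n} \<subseteq> ?A \<union> ?B"
  proof safe
    fix f assume lt: "lp 0 (1/(1-w)) f m n < lp (1/w) 0 f m n"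
      and nB: "\<not> (w' - w) * t \<le> (w' - w) * lp (1/w') (1/(1-w)) f m n"
    have "t < lp (1/w') (1/(1-w)) f m n" using nB w by (simp add: mult_le_cancel_left)
    also have "\<dots> = max (lp (1/w') 0 f m n) (lp 0 (1/(1-w)) f m n)"
      using w by (intro lp_max) auto
    also have "\<dots> = lp (1/w') 0 f m n"
      using lt lp_mono[of "1/w" 0 "1/w'" 0 f m n] w by (simp add: frac_le)
    also have "\<dots> \<le> lp (1/w') (1/(1-z)) f m n"
      using w by (intro lp_mono) auto
    finally show "(w' - z) * t \<le> (w' - z) * lp (1/w') (1/(1-z)) f m n"
      using w by (simp add: mult_le_cancel_left)
  qed
  then have "measure (weights J) {f \<in> space (weights J). lp 0 (1/(1-w)) f m n < lp (1/w) 0 f m n}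
      \<le> measure (weights J) (?A \<union> ?B)"
    by (intro finite_measure_mono) measurable
  also have "\<dots> \<le> measure (weights J) ?A + measure (weights J) ?B"
    by (intro measure_Un_le) measurable
  finally show ?thesis using A B by (simp add: algebra_simps)
qed

text \<open>The function \<open>\<Psi>\<close> is the cumulant generating function of the stationary passage time; its
  inflection point \<open>x0\<close> is the parameter whose characteristic direction is \<open>(m, n)\<close>.\<close>

lemma cumulant_taylor:
  fixes m n :: nat and x x0 :: real
  defines "\<Psi> \<equiv> \<lambda>x. m * ln x - n * ln (1 - x)"
  assumes mn: "0 < m" "0 < n" and x0: "x0 = sqrt m / (sqrt m + sqrt n)" and x: "0 < x" "x < 1" "x \<noteq> x0"
  obtains \<xi> where "min x x0 < \<xi>" "\<xi> < max x x0"
    "\<Psi> x = \<Psi> x0 + (sqrt m + sqrt n)^2 * (x - x0) + (2 * m / \<xi>^3 + 2 * n / (1-\<xi>)^3) / 6 * (x - x0)^3"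
proof -
  define q where "q = sqrt m + sqrt n"
  have q: "0 < q" using mn by (simp add: q_def add_pos_pos)
  have x0': "0 < x0" "x0 < 1" "1 - x0 = sqrt n / q"
    using mn q by (simp_all add: x0 q_def[symmetric] field_simps) (simp_all add: q_def)
  define diff where "diff = (\<lambda>(k::nat) x. if k = 0 then \<Psi> x else if k = 1 then m / x + n / (1-x)
     else if k = 2 then - (m / x^2) + n / (1-x)^2 else 2 * m / x^3 + 2 * n / (1-x)^3 :: real)"
  have D: "(diff k has_real_derivative diff (Suc k) t) (at t)" if "k < 3" "0 < t" "t < 1" for k t
  proof -
    have "k = 0 \<or> k = 1 \<or> k = 2" using that by auto
    then show ?thesis
    proof (elim disjE)
      assume "k = 0"
      then show ?thesis using that unfolding diff_def \<Psi>_def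
        by (auto intro!: derivative_eq_intros simp: field_simps)
    next
      assume "k = 1"
      then show ?thesis using that unfolding diff_def
        by (auto intro!: derivative_eq_intros simp: field_simps power2_eq_square)
    next
      assume "k = 2"
      have "((\<lambda>x. - (m / x^2)) has_real_derivative 2 * m / t^3) (at t)"
        using that by (auto intro!: derivative_eq_intros simp: field_simps power2_eq_square power3_eq_cube)
      moreover have "((\<lambda>x. n / (1-x)^2) has_real_derivative 2 * n / (1-t)^3) (at t)"
        using that
        by (auto intro!: derivative_eq_intros simp: divide_simps) (auto simp: eval_nat_numeral algebra_simps)
      ultimately show ?thesis
        using DERIV_add \<open>k = 2\<close> unfolding diff_def by fastforce
    qed
  qed
  have "\<exists>t. (if x < x0 then x < t \<and> t < x0 else x0 < t \<and> t < x) \<and>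
      \<Psi> x = (\<Sum>k<3. (diff k x0 / fact k) * (x - x0)^k) + (diff 3 t / fact 3) * (x - x0)^3"
  proof (rule Taylor)
    show "\<forall>k t. k < 3 \<and> min x x0 \<le> t \<and> t \<le> max x x0 \<longrightarrow> (diff k has_real_derivative diff (Suc k) t) (at t)"
    proof (intro allI impI)
      fix k :: nat and t :: real assume "k < 3 \<and> min x x0 \<le> t \<and> t \<le> max x x0"
      then show "(diff k has_real_derivative diff (Suc k) t) (at t)"
        using x x0' by (intro D) (auto simp: min_def max_def split: if_splits)
    qed
    show "diff 0 = \<Psi>" by (auto simp: diff_def)
  qed (use x in auto)
  then obtain t where t: "if x < x0 then x < t \<and> t < x0 else x0 < t \<and> t < x"
     "\<Psi> x = (\<Sum>k<3. (diff k x0 / fact k) * (x - x0)^k) + (diff 3 t / fact 3) * (x - x0)^3" by blast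
  \<comment> \<open>The slope at \<open>x0\<close> is the limit shape value
    \<open>(sqrt m + sqrt n)^2\<close> of the passage time. With the vanishing second derivative
    below, only the cubic term distinguishes parameters near \<open>x0\<close>.\<close>
  have d1: "diff 1 x0 = q^2"
    using mn q unfolding diff_def x0'(3) by (simp add: x0 q_def[symmetric] field_simps power2_eq_square)
       (simp add: q_def algebra_simps)
  have d2: "diff 2 x0 = 0"
    using mn q unfolding diff_def x0'(3) by (simp add: x0 q_def[symmetric] power_divide)
  have d0: "diff 0 x0 = \<Psi> x0" and d3: "diff 3 t = 2 * m / t^3 + 2 * n / (1-t)^3" by (simp_all add: diff_def)
  show thesis
  proof (rule that[of t])
    show "min x x0 < t" "t < max x x0" using t(1) by (auto split: if_splits)
    have "(\<Sum>k<3. (diff k x0 / fact k) * (x - x0)^k) = diff 0 x0 + diff 1 x0 * (x - x0) + diff 2 x0 / 2 * (x - x0)^2"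
      by (simp add: eval_nat_numeral)
    then show "\<Psi> x = \<Psi> x0 + (sqrt m + sqrt n)^2 * (x - x0) + (2 * m / t^3 + 2 * n / (1-t)^3) / 6 * (x - x0)^3"
      using t(2) unfolding d0 d1 d2 d3 by (simp add: q_def fact_numeral)
  qed
qed

text \<open>The intermediate rate is \<open>x0\<close> itself, so both exponents are differences of
  \<open>\<Psi>\<close> from its inflection point. Their linear parts cancel against the main part
  \<open>Q\<close> of the level, and the correction \<open>s\<close> competes with the cubic
  terms.\<close>

lemma exit_probability:
  assumes mn: "0 < m" "0 < n" and J: "finite J" "rect_coords m n \<subseteq> J"
    and x0: "x0 = sqrt m / (sqrt m + sqrt n)" and h: "0 < h" "1/4 \<le> x0 - h" "w = x0 + 16 * h" "w \<le> 3/4"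
  shows "measure (weights J) {f \<in> space (weights J). lp 0 (1/(1-w)) f m n < lp (1/w) 0 f m n}
    \<le> 2 * exp (- (20 * (m + n) * h^3))"
proof -
  define \<Psi> where "\<Psi> x = m * ln x - n * ln (1 - x)" for x :: real
  define z where "z = x0 - h"
  \<comment> \<open>Between \<open>1/4\<close> and \<open>3/4\<close> the third derivative of
    \<open>\<Psi>\<close> is at most \<open>128 * (m + n)\<close>, so the upper tail loses at most
    \<open>64/3 * (m + n) * h^3\<close>; \<open>h * s\<close> is twice that. On the other side the
    third derivative is at least \<open>2 * (m + n)\<close>, and the distance \<open>16 * h\<close>
    makes the cubic gain \<open>4096/3\<close> twice the loss \<open>16 * 128/3\<close> caused by
    \<open>s\<close>.\<close>
  define s where "s = 128 / 3 * (m + n) * h^2"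
  define Q where "Q = (sqrt m + sqrt n)^2"
  define t where "t = Q + s"
  have o: "0 < z" "z < x0" "x0 < w" "w < 1" "0 < x0" "x0 < 1" using h by (auto simp: z_def)
  have ratio: "(x / y) ^ m * ((1 - y) / (1 - x)) ^ n = exp (\<Psi> x - \<Psi> y)"
    if "0 < x" "x < 1" "0 < y" "y < 1" for x y
  proof -
    have "(x / y) ^ m = exp (m * (ln x - ln y))" "((1 - y) / (1 - x)) ^ n = exp (n * (ln (1 - y) - ln (1 - x)))"
      using that by (simp_all add: exp_of_nat_mult exp_diff)
    then show ?thesis by (simp add: \<Psi>_def exp_add[symmetric] algebra_simps)
  qed
  obtain \<xi> where \<xi>: "min w x0 < \<xi>" "\<xi> < max w x0"
    "\<Psi> w = \<Psi> x0 + Q * (w - x0) + (2 * m / \<xi>^3 + 2 * n / (1-\<xi>)^3) / 6 * (w - x0)^3"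
    using cumulant_taylor[OF mn x0, of w] o unfolding \<Psi>_def Q_def by auto
  have "2 * (real m + n) \<le> 2 * m / \<xi>^3 + 2 * n / (1-\<xi>)^3"
  proof -
    have "0 < \<xi>" "\<xi> < 1" using \<xi> o by auto
    then have "\<xi>^3 \<le> 1" "(1-\<xi>)^3 \<le> 1" "0 < \<xi>^3" "0 < (1-\<xi>)^3" by (auto intro!: power_le_one)
    then have "2 * real m \<le> 2 * m / \<xi>^3" "2 * real n \<le> 2 * n / (1-\<xi>)^3"
      by (auto simp: pos_le_divide_eq intro!: mult_left_le)
    then show ?thesis by simp
  qed
  then have "(2 * (real m + n)) / 6 * (w - x0)^3 \<le> (2 * m / \<xi>^3 + 2 * n / (1-\<xi>)^3) / 6 * (w - x0)^3"
    using h by (intro mult_right_mono divide_right_mono) auto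
  then have "\<Psi> x0 - \<Psi> w \<le> - Q * (16 * h) - (2 * (real m + n)) / 6 * (16 * h)^3"
    using \<xi>(3) h by simp
  then have e1: "(w - x0) * t + (\<Psi> x0 - \<Psi> w) \<le> - (20 * (m + n) * h^3)"
  proof -
    have "(w - x0) * t = 16 * h * Q + 16 * (128 / 3) * (m + n) * h^3"
      using h by (simp add: t_def s_def algebra_simps power2_eq_square power3_eq_cube)
    moreover have "(16 * h)^3 = 4096 * h^3" by (simp add: power_mult_distrib)
    moreover have "0 \<le> (m + n) * h^3" using h by simp
    ultimately show ?thesis using \<open>\<Psi> x0 - \<Psi> w \<le> _\<close> by (simp add: field_simps)
  qed
  obtain \<eta> where \<eta>: "min z x0 < \<eta>" "\<eta> < max z x0"
    "\<Psi> z = \<Psi> x0 + Q * (z - x0) + (2 * m / \<eta>^3 + 2 * n / (1-\<eta>)^3) / 6 * (z - x0)^3"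
    using cumulant_taylor[OF mn x0, of z] o unfolding \<Psi>_def Q_def by auto
  have "2 * m / \<eta>^3 + 2 * n / (1-\<eta>)^3 \<le> 128 * (real m + n)"
  proof -
    have "1/4 \<le> \<eta>" "1/4 \<le> 1 - \<eta>" using \<eta> o h by (auto simp: z_def)
    then have "(1/4)^3 \<le> \<eta>^3" "(1/4)^3 \<le> (1-\<eta>)^3" by (auto intro!: power_mono)
    then have "2 * real m / \<eta>^3 \<le> 2 * m / (1/4)^3" "2 * real n / (1-\<eta>)^3 \<le> 2 * n / (1/4)^3"
      using \<open>1/4 \<le> \<eta>\<close> \<open>1/4 \<le> 1 - \<eta>\<close> by (auto intro!: divide_left_mono simp: zero_less_mult_iff)
    then show ?thesis by (simp add: power3_eq_cube)
  qed
  then have "(2 * m / \<eta>^3 + 2 * n / (1-\<eta>)^3) / 6 * h^3 \<le> (128 * (real m + n)) / 6 * h^3"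
    using h by (intro mult_right_mono divide_right_mono) auto
  moreover have "(z - x0)^3 = - (h^3)" by (simp add: z_def power3_eq_cube)
  ultimately have "\<Psi> x0 - \<Psi> z \<le> Q * h + (128 * (real m + n)) / 6 * h^3"
    using \<eta>(3) by (simp add: z_def)
  then have e2: "- ((x0 - z) * t) + (\<Psi> x0 - \<Psi> z) \<le> - (20 * (m + n) * h^3)"
  proof -
    have "(x0 - z) * t = h * Q + (128 / 3) * (m + n) * h^3"
      by (simp add: z_def t_def s_def algebra_simps power2_eq_square power3_eq_cube)
    moreover have "0 \<le> (m + n) * h^3" using h by simp
    ultimately show ?thesis using \<open>\<Psi> x0 - \<Psi> z \<le> _\<close> by (simp add: field_simps)
  qed
  have "measure (weights J) {f \<in> space (weights J). lp 0 (1/(1-w)) f m n < lp (1/w) 0 f m n}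
    \<le> exp (-((x0 - z) * t)) * exp (\<Psi> x0 - \<Psi> z) + exp ((w - x0) * t) * exp (\<Psi> x0 - \<Psi> w)"
    using exit_probability_le[OF o(1-4) J, of t] ratio[of x0 z] ratio[of x0 w] o by simp
  also have "\<dots> = exp (-((x0 - z) * t) + (\<Psi> x0 - \<Psi> z)) + exp ((w - x0) * t + (\<Psi> x0 - \<Psi> w))"
    by (simp only: exp_add)
  also have "\<dots> \<le> exp (- (20 * (m + n) * h^3)) + exp (- (20 * (m + n) * h^3))"
    by (intro add_mono, unfold exp_le_cancel_iff, rule e2, rule e1)
  finally show ?thesis by simp
qed

section \<open>Maximal inequality along an antidiagonal\<close>

text \<open>Step \<open>s\<close> up the antidiagonal from \<open>(m, n)\<close> gains the increment
  of row \<open>n + s\<close> and loses that of column \<open>m - 1 - s\<close>. The coefficient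
  \<open>e\<close>, either 0 or 1, switches the profile; its first \<open>k0\<close> increments
  already belong to time 0, as the walk starts at the point reached after \<open>k0\<close>
  steps.\<close>

definition walk :: "real \<Rightarrow> nat \<Rightarrow> real \<Rightarrow> real \<Rightarrow> nat \<Rightarrow> nat \<Rightarrow> (idx \<Rightarrow> real) \<Rightarrow> nat \<Rightarrow> real" where
  "walk e k0 a b m n f t = e * (\<Sum>i=1..k0 + t. f (Zet i))
     + (\<Sum>s<t. b * \<bar>f (Ver (n + s))\<bar> - a * \<bar>f (Hor (m - 1 - s))\<bar>)"

lemma walk_Suc:
  "walk e k0 a b m n f (Suc t) = walk e k0 a b m n f t
     + (e * f (Zet (k0 + Suc t)) + b * \<bar>f (Ver (n + t))\<bar> - a * \<bar>f (Hor (m - 1 - t))\<bar>)"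
  by (simp add: walk_def algebra_simps)

lemma walk_upd:
  assumes "s \<le> t" "t < m"
  shows "walk e k0 a b m n (f(Zet (k0 + Suc t) := y)) s = walk e k0 a b m n f s"
    and "walk e k0 a b m n (f(Ver (n + t) := y)) s = walk e k0 a b m n f s"
    and "walk e k0 a b m n (f(Hor (m - 1 - t) := y)) s = walk e k0 a b m n f s"
  using assms by (auto simp: walk_def intro!: arg_cong2[where f="(+)"] arg_cong2[where f="(*)"] sum.cong)

definition path_coords :: "nat \<Rightarrow> nat \<Rightarrow> nat \<Rightarrow> idx set" where
  "path_coords k0 m n = Zet ` {1..k0 + m} \<union> Ver ` {..<n + m} \<union> Hor ` {..<m}"

lemma measurable_walk:
  assumes "path_coords k0 m n \<subseteq> J" "t \<le> m"
  shows "(\<lambda>f. walk e k0 a b m n f t) \<in> borel_measurable (weights J)"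
proof -
  have "(\<lambda>f. f (Zet i)) \<in> borel_measurable (weights J)" if "i \<in> {1..k0 + t}" for i
    using that assms by (intro measurable_coordinate) (auto simp: path_coords_def)
  moreover have "(\<lambda>f. f (Ver (n + s))) \<in> borel_measurable (weights J)" if "s \<in> {..<t}" for s
    using that assms by (intro measurable_coordinate) (auto simp: path_coords_def)
  moreover have "(\<lambda>f. f (Hor (m - 1 - s))) \<in> borel_measurable (weights J)" if "s \<in> {..<t}" for s
    using that assms by (intro measurable_coordinate) (auto simp: path_coords_def)
  ultimately show ?thesis
    unfolding walk_def
    by (intro borel_measurable_add borel_measurable_times borel_measurable_sum borel_measurable_diff
        borel_measurable_abs borel_measurable_const) auto
qed

text \<open>The step from \<open>t\<close> involves three coordinates on which \<open>X\<close> does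
  not depend, and these are integrated out one after the other. The profile moment is only bounded,
  by \<open>Z\<close>, so that one statement serves both values of \<open>e\<close>.\<close>

lemma nn_integral_walk_step:
  assumes J: "finite J" "path_coords k0 m n \<subseteq> J" and t: "t < m"
    and \<theta>: "\<theta> * b < 1" "- \<theta> * a < 1"
    and Z: "(\<integral>\<^sup>+z. ennreal (exp (\<theta> * (e * z))) \<partial>X_law (1/2)) \<le> ennreal Z" "0 \<le> Z"
    and X: "X \<in> borel_measurable (weights J)"
    and indep: "\<And>f y. X (f(Zet (k0 + Suc t) := y)) = X f" "\<And>f y. X (f(Ver (n + t) := y)) = X f"
      "\<And>f y. X (f(Hor (m - 1 - t) := y)) = X f"
  shows "(\<integral>\<^sup>+f. X f * ennreal (exp (\<theta> * (walk e k0 a b m n f (Suc t) - walk e k0 a b m n f t))) \<partial>weights J)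
     \<le> (\<integral>\<^sup>+f. X f \<partial>weights J) * ennreal (Z / ((1 - \<theta> * b) * (1 + \<theta> * a)))"
proof -
  have in_J: "Zet (k0 + Suc t) \<in> J" "Ver (n + t) \<in> J" "Hor (m - 1 - t) \<in> J"
    using J(2) t by (auto simp: path_coords_def)
  define kz kv kh where "kz = Zet (k0 + Suc t)" and "kv = Ver (n + t)" and "kh = Hor (m - 1 - t)"
  note k_def = kz_def kv_def kh_def
  have k: "kz \<in> J" "kv \<in> J" "kh \<in> J" "kz \<noteq> kv" "kz \<noteq> kh" "kv \<noteq> kh" using in_J by (simp_all add: k_def)
  have law: "wlaw kz = X_law (1/2)" "wlaw kv = Exp1" "wlaw kh = Exp1" by (simp_all add: k_def)
  note indep' = indep[folded k_def]
  define u1 where "u1 y = ennreal (exp (\<theta> * (e * y)))" for y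
  define u2 where "u2 y = ennreal (exp ((\<theta> * b) * \<bar>y\<bar>))" for y
  define u3 where "u3 y = ennreal (exp ((- \<theta> * a) * \<bar>y\<bar>))" for y
  have [measurable]: "u1 \<in> borel_measurable borel" "u2 \<in> borel_measurable borel" "u3 \<in> borel_measurable borel"
    unfolding u1_def u2_def u3_def by measurable
  note [measurable] = X measurable_coordinate[OF k(1)] measurable_coordinate[OF k(2)]
  have X1: "(\<lambda>f. X f * u1 (f kz)) \<in> borel_measurable (weights J)"
    and X2: "(\<lambda>f. X f * u1 (f kz) * u2 (f kv)) \<in> borel_measurable (weights J)" by measurable
  have split: "ennreal (exp (\<theta> * (walk e k0 a b m n f (Suc t) - walk e k0 a b m n f t)))
      = u1 (f kz) * u2 (f kv) * u3 (f kh)" for f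
    unfolding walk_Suc u1_def u2_def u3_def k_def
    by (simp add: ennreal_mult[symmetric] exp_add[symmetric] algebra_simps)
  have "(\<integral>\<^sup>+f. X f * ennreal (exp (\<theta> * (walk e k0 a b m n f (Suc t) - walk e k0 a b m n f t))) \<partial>weights J)
      = (\<integral>\<^sup>+f. (X f * u1 (f kz) * u2 (f kv)) * u3 (f kh) \<partial>weights J)"
    unfolding split by (simp only: mult.assoc)
  also have "\<dots> = (\<integral>\<^sup>+f. (X f * u1 (f kz)) * u2 (f kv) \<partial>weights J) * (\<integral>\<^sup>+y. u3 y \<partial>Exp1)"
    using nn_integral_weights_peel[OF J(1) k(3) X2, of u3] k by (simp add: indep' law)
  also have "\<dots> = (\<integral>\<^sup>+f. X f * u1 (f kz) \<partial>weights J) * (\<integral>\<^sup>+y. u2 y \<partial>Exp1) * (\<integral>\<^sup>+y. u3 y \<partial>Exp1)"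
    using nn_integral_weights_peel[OF J(1) k(2) X1, of u2] k by (simp add: indep' law)
  also have "\<dots> = (\<integral>\<^sup>+f. X f \<partial>weights J) * (\<integral>\<^sup>+y. u1 y \<partial>X_law (1/2)) * (\<integral>\<^sup>+y. u2 y \<partial>Exp1) * (\<integral>\<^sup>+y. u3 y \<partial>Exp1)"
    using nn_integral_weights_peel[OF J(1) k(1) X, of u1] by (simp add: indep' law)
  also have "\<dots> \<le> (\<integral>\<^sup>+f. X f \<partial>weights J) * ennreal Z * ennreal (1 / (1 - \<theta> * b)) * ennreal (1 / (1 - (- \<theta> * a)))"
    unfolding u2_def u3_def nn_integral_Exp1_exp_abs[OF \<theta>(1)] nn_integral_Exp1_exp_abs[OF \<theta>(2)]
    using Z(1) by (intro mult_right_mono mult_left_mono) (simp_all add: u1_def)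
  also have "\<dots> = (\<integral>\<^sup>+f. X f \<partial>weights J) * ennreal (Z / ((1 - \<theta> * b) * (1 + \<theta> * a)))"
    using \<theta> Z(2) by (simp add: mult.assoc ennreal_mult[symmetric])
  finally show ?thesis .
qed

lemma nn_integral_exp_walk:
  assumes J: "finite J" "path_coords k0 m n \<subseteq> J" and t: "t \<le> m"
    and \<theta>: "\<theta> * b < 1" "- \<theta> * a < 1"
    and Z: "(\<integral>\<^sup>+z. ennreal (exp (\<theta> * (e * z))) \<partial>X_law (1/2)) \<le> ennreal Z" "0 \<le> Z"
  shows "(\<integral>\<^sup>+f. ennreal (exp (\<theta> * walk e k0 a b m n f t)) \<partial>weights J)
     \<le> ennreal (Z ^ k0 * (Z / ((1 - \<theta> * b) * (1 + \<theta> * a))) ^ t)"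
  using t
proof (induction t)
  case 0
  have "(\<integral>\<^sup>+f. ennreal (exp (\<theta> * walk e k0 a b m n f 0)) \<partial>weights J)
      = (\<integral>\<^sup>+f. (\<Prod>k\<in>Zet ` {1..k0}. ennreal (exp (\<theta> * (e * f k)))) \<partial>weights J)"
    by (intro nn_integral_cong, subst prod.reindex)
       (auto simp: inj_on_def walk_def prod_ennreal exp_sum[symmetric] sum_distrib_left)
  also have "\<dots> = (\<Prod>k\<in>Zet ` {1..k0}. \<integral>\<^sup>+z. ennreal (exp (\<theta> * (e * z))) \<partial>wlaw k)"
    using J by (intro nn_integral_weights_prod[where u="\<lambda>k z. ennreal (exp (\<theta> * (e * z)))"]) (auto simp: path_coords_def)
  also have "\<dots> = (\<integral>\<^sup>+z. ennreal (exp (\<theta> * (e * z))) \<partial>X_law (1/2)) ^ k0"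
    by (subst prod.reindex) (auto simp: inj_on_def)
  also have "\<dots> \<le> ennreal Z ^ k0" by (intro power_mono Z) simp
  finally show ?case using Z(2) by (simp add: ennreal_power)
next
  case (Suc t)
  have "(\<integral>\<^sup>+f. ennreal (exp (\<theta> * walk e k0 a b m n f (Suc t))) \<partial>weights J)
     = (\<integral>\<^sup>+f. ennreal (exp (\<theta> * walk e k0 a b m n f t)) *
          ennreal (exp (\<theta> * (walk e k0 a b m n f (Suc t) - walk e k0 a b m n f t))) \<partial>weights J)"
    by (simp add: ennreal_mult[symmetric] exp_add[symmetric] algebra_simps)
  also have "\<dots> \<le> (\<integral>\<^sup>+f. ennreal (exp (\<theta> * walk e k0 a b m n f t)) \<partial>weights J) * ennreal (Z / ((1 - \<theta> * b) * (1 + \<theta> * a)))"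
  proof (rule nn_integral_walk_step[OF J _ \<theta> Z])
    have "(\<lambda>f. walk e k0 a b m n f t) \<in> borel_measurable (weights J)"
      using Suc.prems by (intro measurable_walk[OF J(2)]) simp
    then show "(\<lambda>f. ennreal (exp (\<theta> * walk e k0 a b m n f t))) \<in> borel_measurable (weights J)" by measurable
  qed (use Suc.prems in \<open>simp_all only: walk_upd[OF order_refl] Suc_le_eq\<close>)
  also have "\<dots> \<le> ennreal (Z ^ k0 * (Z / ((1 - \<theta> * b) * (1 + \<theta> * a))) ^ t) * ennreal (Z / ((1 - \<theta> * b) * (1 + \<theta> * a)))"
    using Suc by (intro mult_right_mono) auto
  also have "\<dots> = ennreal (Z ^ k0 * (Z / ((1 - \<theta> * b) * (1 + \<theta> * a))) ^ Suc t)"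
    using \<theta> Z(2) by (subst ennreal_mult[symmetric]) (auto simp: mult_ac)
  finally show ?case .
qed

text \<open>Ville's inequality: the exponential of the walk is a supermartingale, here stopped at the
  first time at which it reaches the level \<open>-y\<close>.\<close>

lemma walk_hitting_probability:
  assumes J: "finite J" "path_coords k0 m n \<subseteq> J" and T: "\<tau> \<le> T" "T \<le> m"
    and \<theta>: "0 \<le> \<theta>" "\<theta> * b < 1" "0 \<le> a"
    and Z: "(\<integral>\<^sup>+z. ennreal (exp (\<theta> * (e * z))) \<partial>X_law (1/2)) \<le> ennreal Z" "0 \<le> Z"
    and sup: "\<tau> = T \<or> Z / ((1 - \<theta> * b) * (1 + \<theta> * a)) \<le> 1"
  shows "measure (weights J) {f \<in> space (weights J). \<exists>t\<in>{\<tau>..T}. - y \<le> walk e k0 a b m n f t}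
    \<le> exp (\<theta> * y) * (Z ^ k0 * (Z / ((1 - \<theta> * b) * (1 + \<theta> * a))) ^ \<tau>)"
proof -
  interpret prob_space "weights J" by (rule prob_space_weights)
  define \<phi> where "\<phi> = Z / ((1 - \<theta> * b) * (1 + \<theta> * a))"
  have \<theta>': "- \<theta> * a < 1" using \<theta> mult_nonneg_nonneg[OF \<theta>(1,3)] by linarith
  have \<phi>: "0 \<le> \<phi>" using \<theta> \<theta>' Z by (simp add: \<phi>_def)
  define W where "W = walk e k0 a b m n"
  have W_meas: "(\<lambda>f. W f t) \<in> borel_measurable (weights J)" if "t \<le> m" for t
    unfolding W_def by (rule measurable_walk[OF J(2) that])
  define N where "N t f \<longleftrightarrow> (\<forall>s\<in>{\<tau>..<t}. W f s < - y)" for t f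
  have N_meas: "Measurable.pred (weights J) (N t)" if "t \<le> m" for t
    unfolding N_def
  proof (rule pred_intros_finite(3)[rotated])
    fix s assume "s \<in> {\<tau>..<t}"
    then have "(\<lambda>f. W f s) \<in> borel_measurable (weights J)" using W_meas that by simp
    then show "Measurable.pred (weights J) (\<lambda>f. W f s < - y)" by measurable
  qed simp
  define E where "E t f = ennreal (exp (\<theta> * (W f t + y)))" for t f
  have E_meas: "E t \<in> borel_measurable (weights J)" if "t \<le> m" for t
    using W_meas[OF that] unfolding E_def by measurable
  have E_ge: "1 \<le> E t f" if "- y \<le> W f t" for t f
    unfolding E_def using that \<theta>(1) by (simp flip: ennreal_1)
  \<comment> \<open>The expected value at time \<open>t\<close> of the process that follows
    \<open>E\<close> until the first hit in \<open>{\<tau>..<t}\<close> and is frozen at 1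
    afterwards. Since \<open>E\<close> is at least 1 at a hit, freezing at 1 never increases
    it.\<close>
  define u where "u t = (\<integral>\<^sup>+f. (if N t f then E t f else 1) \<partial>weights J)" for t
  have u: "u t \<le> u \<tau>" if "\<tau> \<le> t" "t \<le> T" for t
    using that
  proof (induction t rule: dec_induct)
    case (step t)
    then have t: "t < m" "\<phi> \<le> 1" using T sup by (auto simp: \<phi>_def)
    define X where "X f = (if N (Suc t) f then E t f else 0)" for f
    have NS: "Measurable.pred (weights J) (N (Suc t))" using N_meas[of "Suc t"] t by simp
    have X_meas: "X \<in> borel_measurable (weights J)"
      unfolding X_def
    proof (rule measurable_If)
      show "E t \<in> borel_measurable (weights J)" using E_meas t by simp
      show "{f \<in> space (weights J). N (Suc t) f} \<in> sets (weights J)" using NS by measurable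
    qed simp
    have not_N: "{f \<in> space (weights J). \<not> N (Suc t) f} \<in> sets (weights J)"
      using NS by measurable
    have X_upd: "X (f(k := v)) = X f" if "\<And>s. s \<le> t \<Longrightarrow> W (f(k := v)) s = W f s" for f k v
      using that by (simp add: X_def N_def E_def)
    have XE: "(if N (Suc t) f then E (Suc t) f else 0) = X f * ennreal (exp (\<theta> * (W f (Suc t) - W f t)))" for f
      by (simp add: X_def E_def ennreal_mult[symmetric] exp_add[symmetric] algebra_simps)
    have XE_meas: "(\<lambda>f. X f * ennreal (exp (\<theta> * (W f (Suc t) - W f t)))) \<in> borel_measurable (weights J)"
    proof -
      have [measurable]: "(\<lambda>f. W f t) \<in> borel_measurable (weights J)" "(\<lambda>f. W f (Suc t)) \<in> borel_measurable (weights J)"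
        using W_meas t by simp_all
      show ?thesis using X_meas by measurable
    qed
    have "u (Suc t) = (\<integral>\<^sup>+f. X f * ennreal (exp (\<theta> * (W f (Suc t) - W f t)))
          + indicator {f \<in> space (weights J). \<not> N (Suc t) f} f \<partial>weights J)"
      unfolding u_def XE[symmetric] by (intro nn_integral_cong) (auto simp: indicator_def)
    also have "\<dots> = (\<integral>\<^sup>+f. X f * ennreal (exp (\<theta> * (W f (Suc t) - W f t))) \<partial>weights J)
          + emeasure (weights J) {f \<in> space (weights J). \<not> N (Suc t) f}"
      using XE_meas not_N by (subst nn_integral_add) auto
    also have "(\<integral>\<^sup>+f. X f * ennreal (exp (\<theta> * (W f (Suc t) - W f t))) \<partial>weights J) \<le> (\<integral>\<^sup>+f. X f \<partial>weights J) * ennreal \<phi>"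
      unfolding W_def \<phi>_def
    proof (rule nn_integral_walk_step[OF J t(1) \<theta>(2) \<theta>' Z X_meas])
      show "X (f(Zet (k0 + Suc t) := v)) = X f" for f v
        by (rule X_upd) (simp only: W_def walk_upd t)
      show "X (f(Ver (n + t) := v)) = X f" for f v
        by (rule X_upd) (simp only: W_def walk_upd t)
      show "X (f(Hor (m - 1 - t) := v)) = X f" for f v
        by (rule X_upd) (simp only: W_def walk_upd t)
    qed
    also have "(\<integral>\<^sup>+f. X f \<partial>weights J) * ennreal \<phi> \<le> (\<integral>\<^sup>+f. X f \<partial>weights J) * 1"
      using t(2) by (intro mult_left_mono) (simp_all flip: ennreal_1)
    also have "(\<integral>\<^sup>+f. X f \<partial>weights J) * 1 + emeasure (weights J) {f \<in> space (weights J). \<not> N (Suc t) f}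
        = (\<integral>\<^sup>+f. X f + indicator {f \<in> space (weights J). \<not> N (Suc t) f} f \<partial>weights J)"
      using X_meas not_N by (subst nn_integral_add) auto
    also have "\<dots> \<le> u t"
      unfolding u_def
    proof (rule nn_integral_mono)
      fix f assume "f \<in> space (weights J)"
      have "N (Suc t) f \<longleftrightarrow> N t f \<and> W f t < - y"
        using step.hyps by (auto simp: N_def less_Suc_eq)
      then show "X f + indicator {f \<in> space (weights J). \<not> N (Suc t) f} f \<le> (if N t f then E t f else 1)"
        using E_ge[of f t] by (auto simp: X_def indicator_def not_less)
    qed
    finally show ?case using step by (meson Suc_leD add_right_mono order_trans)
  qed simp
  have hit_meas: "{f \<in> space (weights J). \<exists>t\<in>{\<tau>..T}. - y \<le> W f t} \<in> sets (weights J)"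
  proof -
    have "Measurable.pred (weights J) (\<lambda>f. \<exists>t\<in>{\<tau>..T}. - y \<le> W f t)"
    proof (rule pred_intros_finite(4)[rotated])
      fix s assume "s \<in> {\<tau>..T}"
      then have "(\<lambda>f. W f s) \<in> borel_measurable (weights J)" using W_meas T by simp
      then show "Measurable.pred (weights J) (\<lambda>f. - y \<le> W f s)" by measurable
    qed simp
    then show ?thesis by (simp add: pred_def)
  qed
  have "emeasure (weights J) {f \<in> space (weights J). \<exists>t\<in>{\<tau>..T}. - y \<le> W f t} \<le> u T"
    unfolding u_def nn_integral_indicator[OF hit_meas, symmetric]
  proof (rule nn_integral_mono)
    fix f show "indicator {f \<in> space (weights J). \<exists>t\<in>{\<tau>..T}. - y \<le> W f t} f \<le> (if N T f then E T f else 1)"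
      using E_ge[of f T] by (auto simp: indicator_def N_def not_less) (metis atLeastAtMost_iff atLeastLessThan_iff le_neq_implies_less not_le)
  qed
  also have "\<dots> \<le> u \<tau>" using u T by simp
  also have "u \<tau> = (\<integral>\<^sup>+f. ennreal (exp (\<theta> * y)) * ennreal (exp (\<theta> * W f \<tau>)) \<partial>weights J)"
    unfolding u_def by (intro nn_integral_cong)
      (simp add: N_def E_def ennreal_mult[symmetric] exp_add[symmetric] algebra_simps)
  also have "\<dots> = ennreal (exp (\<theta> * y)) * (\<integral>\<^sup>+f. ennreal (exp (\<theta> * W f \<tau>)) \<partial>weights J)"
    using W_meas[of \<tau>] T by (intro nn_integral_cmult) simp
  also have "\<dots> \<le> ennreal (exp (\<theta> * y)) * ennreal (Z ^ k0 * \<phi> ^ \<tau>)"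
    unfolding W_def \<phi>_def using T by (intro mult_left_mono nn_integral_exp_walk[OF J _ \<theta>(2) \<theta>' Z]) auto
  finally show ?thesis
    using \<phi> Z(2) by (simp add: emeasure_eq_measure ennreal_mult[symmetric] W_def \<phi>_def)
qed

text \<open>A sweep of the region below the antidiagonal turns the increments of the stationary
  passage time into single coordinates. It leaves the profile alone and preserves the law, so both
  events have the same probability.\<close>

lemma antidiagonal_increments:
  assumes w: "0 < w" "w < 1" and n: "0 < n" and J: "finite J" "rect_coords (m + n) (m + n) \<subseteq> J" "Zet ` {1..k0 + m} \<subseteq> J"
    and T: "T < m"
  shows "measure (weights J) {f \<in> space (weights J). \<exists>t\<in>{\<tau>..T}.
        - y \<le> e * (\<Sum>i=1..k0 + t. f (Zet i)) + (lp (1/w) (1/(1-w)) f (m - t) (n + t) - lp (1/w) (1/(1-w)) f m n)}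
    = measure (weights J) {f \<in> space (weights J). \<exists>t\<in>{\<tau>..T}. - y \<le> walk e k0 (1/w) (1/(1-w)) m n f t}"
proof -
  interpret prob_space "weights J" by (rule prob_space_weights)
  define G where "G = lp (1/w) (1/(1-w))"
  define W where "W = walk e k0 (1/w) (1/(1-w)) m n"
  \<comment> \<open>Cells whose upper right corner lies on or below the antidiagonal of
    \<open>(m, n)\<close>. The boundary passes through \<open>(m - t, n + t)\<close> and
    \<open>(m - Suc t, n + t)\<close> alternately, which gives one column and one row per
    step.\<close>
  define S where "S = {(i, j). i + j + 2 \<le> m + n}"
  have sub: "S \<subseteq> {..<m + n} \<times> {..<m + n}" by (auto simp: S_def)
  have S: "finite S" "down_closed S"
    using finite_subset[OF sub] by (auto simp: S_def down_closed_def)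
  obtain \<Phi> where \<Phi>: "\<Phi> \<in> measurable (weights J) (weights J)"
    "\<And>F. F \<in> borel_measurable (weights J) \<Longrightarrow> (\<integral>\<^sup>+f. F (\<Phi> f) \<partial>weights J) = (\<integral>\<^sup>+f. F f \<partial>weights J)"
    "\<And>f. swept w S f (\<Phi> f)"
  proof -
    have "Hor i \<in> J \<and> Ver j \<in> J \<and> Blk i j \<in> J" if "(i, j) \<in> S" for i j
      using that subsetD[OF sub that] subsetD[OF J(2)] by auto
    from sweep_exists[OF w J(1) S this] that show thesis by blast
  qed
  have inc: "W (\<Phi> f) t = e * (\<Sum>i=1..k0 + t. f (Zet i)) + (G f (m - t) (n + t) - G f m n)" if "t \<le> T" for f t
    using that
  proof (induction t)
    case 0
    then show ?case by (simp add: W_def walk_def sweptD(2)[OF \<Phi>(3)])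
  next
    case (Suc t)
    have m: "m - t = Suc (m - Suc t)" "m - 1 - t = m - Suc t" using Suc.prems T by auto
    have "\<bar>\<Phi> f (Hor (m - Suc t))\<bar> = w * (G f (Suc (m - Suc t)) (n + t) - G f (m - Suc t) (n + t))"
      unfolding G_def using Suc.prems T n by (intro sweptD(3)[OF \<Phi>(3)]) (auto simp: S_def)
    moreover have "\<bar>\<Phi> f (Ver (n + t))\<bar> = (1 - w) * (G f (m - Suc t) (Suc (n + t)) - G f (m - Suc t) (n + t))"
      unfolding G_def using Suc.prems T n by (intro sweptD(4)[OF \<Phi>(3)]) (auto simp: S_def)
    ultimately have "1/(1-w) * \<bar>\<Phi> f (Ver (n + t))\<bar> - 1/w * \<bar>\<Phi> f (Hor (m - Suc t))\<bar>
      = G f (m - Suc t) (n + Suc t) - G f (m - t) (n + t)" using w by (simp add: m)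
    moreover have "\<Phi> f (Zet (k0 + Suc t)) = f (Zet (k0 + Suc t))" by (rule sweptD(2)[OF \<Phi>(3)])
    ultimately show ?case
      using Suc unfolding W_def walk_Suc m(2) by (simp add: algebra_simps)
  qed
  have hit_meas: "{f \<in> space (weights J). \<exists>t\<in>{\<tau>..T}. - y \<le> W f t} \<in> sets (weights J)"
  proof -
    have "Measurable.pred (weights J) (\<lambda>f. \<exists>t\<in>{\<tau>..T}. - y \<le> W f t)"
    proof (rule pred_intros_finite(4)[rotated])
      fix s assume s: "s \<in> {\<tau>..T}"
      have "path_coords k0 m n \<subseteq> J" using J subsetD[OF J(2)] by (auto simp: path_coords_def)
      then have "(\<lambda>f. W f s) \<in> borel_measurable (weights J)"
        unfolding W_def using s T by (intro measurable_walk) auto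
      then show "Measurable.pred (weights J) (\<lambda>f. - y \<le> W f s)" by measurable
    qed simp
    then show ?thesis by (simp add: pred_def)
  qed
  let ?H = "{f \<in> space (weights J). \<exists>t\<in>{\<tau>..T}. - y \<le> W f t}"
  let ?K = "{f \<in> space (weights J). \<exists>t\<in>{\<tau>..T}. - y \<le> e * (\<Sum>i=1..k0 + t. f (Zet i)) + (G f (m - t) (n + t) - G f m n)}"
  have pre: "?K = \<Phi> -` ?H \<inter> space (weights J)"
  proof (rule set_eqI)
    fix f
    have "(\<exists>t\<in>{\<tau>..T}. - y \<le> e * (\<Sum>i=1..k0 + t. f (Zet i)) + (G f (m - t) (n + t) - G f m n))
        \<longleftrightarrow> (\<exists>t\<in>{\<tau>..T}. - y \<le> W (\<Phi> f) t)"
      by (intro bex_cong refl) (simp only: inc atLeastAtMost_iff)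
    then show "f \<in> ?K \<longleftrightarrow> f \<in> \<Phi> -` ?H \<inter> space (weights J)"
      using measurable_space[OF \<Phi>(1), of f] by blast
  qed
  have K: "?K \<in> sets (weights J)" unfolding pre by (rule measurable_sets[OF \<Phi>(1) hit_meas])
  have "emeasure (weights J) ?K = (\<integral>\<^sup>+f. indicator ?H (\<Phi> f) \<partial>weights J)"
    unfolding nn_integral_indicator[OF K, symmetric]
    by (intro nn_integral_cong, unfold pre) (simp add: indicator_def)
  also have "\<dots> = emeasure (weights J) ?H"
    using \<Phi>(2)[of "indicator ?H"] hit_meas by simp
  finally show ?thesis by (simp add: emeasure_eq_measure G_def W_def)
qed

section \<open>Exit points on the right\<close>

lemma nn_integral_exponential_density:
  assumes r: "0 < r" and [measurable]: "g \<in> borel_measurable borel"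
  shows "(\<integral>\<^sup>+x. g x \<partial>density lborel (exponential_density r)) = (\<integral>\<^sup>+x. g (x / r) \<partial>Exp1)"
proof -
  have "(\<integral>\<^sup>+x. g (x / r) \<partial>Exp1) = ennreal r * (\<integral>\<^sup>+x. ennreal (exp (-(r*x))) * indicator {0..} x * g (r * x / r) \<partial>lborel)"
    by (rule nn_integral_Exp1_rate[OF r]) simp
  also have "\<dots> = (\<integral>\<^sup>+x. ennreal r * (ennreal (exp (-(r*x))) * indicator {0..} x * g x) \<partial>lborel)"
    using r by (subst nn_integral_cmult) auto
  also have "\<dots> = (\<integral>\<^sup>+x. ennreal (exponential_density r x) * g x \<partial>lborel)"
    using r by (intro nn_integral_cong)
      (auto simp: exponential_density_def indicator_def ennreal_mult mult.assoc mult.commute mult.left_commute)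
  also have "\<dots> = (\<integral>\<^sup>+x. g x \<partial>density lborel (exponential_density r))"
    by (subst nn_integral_density) auto
  finally show ?thesis by simp
qed

lemma nn_integral_exp_X_law:
  assumes "0 \<le> \<theta>" "\<theta> < 1/2"
  shows "(\<integral>\<^sup>+z. ennreal (exp (\<theta> * z)) \<partial>X_law (1/2)) = ennreal (1 / (1 - 4 * \<theta>^2))"
proof -
  let ?D = "density lborel (exponential_density (1/2))"
  interpret D: prob_space ?D by (rule prob_space_exponential_density) simp
  have half: "1 - 1/2 = (1/2 :: real)" by simp
  have "(\<integral>\<^sup>+z. ennreal (exp (\<theta> * z)) \<partial>X_law (1/2)) = (\<integral>\<^sup>+p. ennreal (exp (\<theta> * (fst p - snd p))) \<partial>(?D \<Otimes>\<^sub>M ?D))"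
    unfolding X_law_def half by (subst nn_integral_distr) (auto simp: split_beta')
  also have "\<dots> = (\<integral>\<^sup>+x. \<integral>\<^sup>+y. ennreal (exp (\<theta> * x)) * ennreal (exp (- \<theta> * y)) \<partial>?D \<partial>?D)"
    by (subst D.nn_integral_fst[symmetric])
       (auto intro!: nn_integral_cong simp: ennreal_mult[symmetric] exp_add[symmetric] algebra_simps)
  also have "\<dots> = (\<integral>\<^sup>+x. ennreal (exp (\<theta> * x)) \<partial>?D) * (\<integral>\<^sup>+y. ennreal (exp (- \<theta> * y)) \<partial>?D)"
    by (simp add: nn_integral_cmult nn_integral_multc)
  also have "(\<integral>\<^sup>+x. ennreal (exp (\<theta> * x)) \<partial>?D) = ennreal (1 / (1 - 2 * \<theta>))"
    using nn_integral_Exp1_exp[of "2 * \<theta>"] assms by (subst nn_integral_exponential_density) (auto simp: mult_ac)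
  also have "(\<integral>\<^sup>+y. ennreal (exp (- \<theta> * y)) \<partial>?D) = ennreal (1 / (1 - (- 2 * \<theta>)))"
    using nn_integral_Exp1_exp[of "- 2 * \<theta>"] assms by (subst nn_integral_exponential_density) (auto simp: mult_ac)
  also have "ennreal (1 / (1 - 2 * \<theta>)) * ennreal (1 / (1 - (- 2 * \<theta>))) = ennreal (1 / (1 - 4 * \<theta>^2))"
    using assms by (subst ennreal_mult[symmetric]) (auto simp: power2_eq_square algebra_simps)
  finally show ?thesis .
qed

text \<open>For \<open>e = 0\<close> the integral is 1, which is below the bound because
  \<open>4 * \<theta>^2 < 1\<close>. Deterministic and random profiles can thus share one
  estimate.\<close>

lemma nn_integral_exp_X_law_le:
  assumes "0 \<le> \<theta>" "\<theta> < 1/2" "e = 0 \<or> e = 1"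
  shows "(\<integral>\<^sup>+z. ennreal (exp (\<theta> * (e * z))) \<partial>X_law (1/2)) \<le> ennreal (1 / (1 - 4 * \<theta>^2))"
proof (cases "e = 0")
  case True
  interpret prob_space "X_law (1/2)" by (rule prob_space_X_law) auto
  have "\<theta>^2 < (1/2)^2" using assms by (intro power_strict_mono) auto
  then have "1 \<le> 1 / (1 - 4 * \<theta>^2)" by (simp add: power2_eq_square)
  then show ?thesis using True emeasure_space_1 ennreal_leI[of 1 "1 / (1 - 4 * \<theta>^2)"] by simp
next
  case False
  then show ?thesis using assms nn_integral_exp_X_law[of \<theta>] by simp
qed

text \<open>Reversing the paths turns the excluded starting point into an excluded end point.\<close>

definition lp_open :: "(idx \<Rightarrow> real) \<Rightarrow> nat \<Rightarrow> nat \<Rightarrow> real" where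
  "lp_open f i j = lp 0 0 f i j - \<bar>f (Blk (i - 1) (j - 1))\<bar>"

text \<open>In coordinates seen from the target, the value at \<open>(m - k, n + k)\<close> is
  \<open>L\<close> from the starting point \<open>k\<close>. The event says that some
  \<open>k\<close> of size at least \<open>K\<close>, with its profile value added, does as well as
  the starting point 0. As \<open>m\<close> exceeds the first coordinate of the target by 1, the
  range \<open>k < m\<close> is the constraint that \<open>k\<close> lies in
  \<open>Cset\<close>.\<close>

definition exit_event :: "real \<Rightarrow> nat \<Rightarrow> nat \<Rightarrow> nat \<Rightarrow> (idx \<Rightarrow> real) \<Rightarrow> bool" where
  "exit_event e m n K f \<longleftrightarrow> (\<exists>k\<in>{K..<m}. lp_open f m n \<le> e * (\<Sum>i=1..k. f (Zet i)) + lp_open f (m - k) (n + k))"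

text \<open>Five exceptional events: the comparison fails at \<open>k0\<close> with
  \<open>w1\<close> (\<open>A\<close>) or at 0 with \<open>w2\<close> (\<open>B\<close>); the weight
  at the starting point 0 is at least \<open>s\<close> (\<open>D\<close>); the stationary increment
  from 0 to \<open>k0\<close> is at least \<open>y\<close> (\<open>E\<close>); the dominating walk
  beyond \<open>k0\<close>, with the profile added, still reaches \<open>- (y + s)\<close>
  (\<open>F\<close>). Of the two end weights removed by \<open>lp_open\<close>, the one at
  \<open>k\<close> helps and is dropped; the one at 0 is what \<open>D\<close> pays for.\<close>

lemma exit_event_le:
  assumes mn: "0 < n" "k0 < m" "k0 \<le> K" and e: "e = 0 \<or> e = 1"
    and J: "finite J" "rect_coords (m + n) (m + n) \<subseteq> J" "Zet ` {1..m} \<subseteq> J"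
    and w1: "0 < w1" "w1 < 1" and w2: "0 < w2" "w2 < 1"
    and \<theta>1: "0 \<le> \<theta>1" "\<theta>1 < 1/2" "\<theta>1 / (1 - w1) < 1"
    and \<phi>1: "1 / (1 - 4 * \<theta>1^2) / ((1 - \<theta>1 / (1 - w1)) * (1 + \<theta>1 / w1)) \<le> 1"
    and \<theta>2: "0 \<le> \<theta>2" "\<theta>2 < 1/2" "\<theta>2 / (1 - w2) < 1"
  shows "measure (weights J) {f \<in> space (weights J). exit_event e m n K f}
    \<le> measure (weights J) {f \<in> space (weights J). lp 0 (1/(1-w1)) f (m - k0) (n + k0) < lp (1/w1) 0 f (m - k0) (n + k0)}
     + measure (weights J) {f \<in> space (weights J). lp 0 (1/(1-w2)) f m n < lp (1/w2) 0 f m n}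
     + 2 * exp (- s / 2)
     + exp (- \<theta>2 * y) * (1 / ((1 - \<theta>2 / (1 - w2)) * (1 + \<theta>2 / w2))) ^ k0
     + exp (\<theta>1 * (y + s)) * ((1 / (1 - 4 * \<theta>1^2)) ^ k0
         * (1 / (1 - 4 * \<theta>1^2) / ((1 - \<theta>1 / (1 - w1)) * (1 + \<theta>1 / w1))) ^ (K - k0))"
proof -
  interpret prob_space "weights J" by (rule prob_space_weights)
  have sq: "4 * \<theta>1^2 < 1"
  proof -
    have "\<theta>1^2 < (1/2)^2" using \<theta>1 by (intro power_strict_mono) auto
    then show ?thesis by (simp add: power2_eq_square)
  qed
  define k where "k = Blk (m - 1) (n - 1)"
  have kJ: "k \<in> J" unfolding k_def using mn by (intro subsetD[OF J(2)]) auto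
  define A where "A = {f \<in> space (weights J). lp 0 (1/(1-w1)) f (m - k0) (n + k0) < lp (1/w1) 0 f (m - k0) (n + k0)}"
  define B where "B = {f \<in> space (weights J). lp 0 (1/(1-w2)) f m n < lp (1/w2) 0 f m n}"
  define D where "D = {f \<in> space (weights J). s \<le> \<bar>f k\<bar>}"
  define E where "E = {f \<in> space (weights J). \<exists>t\<in>{k0..k0}. - (- y) \<le> 0 * (\<Sum>i=1..0 + t. f (Zet i)) +
      (lp (1/w2) (1/(1-w2)) f (m - t) (n + t) - lp (1/w2) (1/(1-w2)) f m n)}"
  define F where "F = {f \<in> space (weights J). \<exists>t\<in>{K - k0..m - k0 - 1}. - (y + s) \<le> e * (\<Sum>i=1..k0 + t. f (Zet i)) +
      (lp (1/w1) (1/(1-w1)) f (m - k0 - t) (n + k0 + t) - lp (1/w1) (1/(1-w1)) f (m - k0) (n + k0))}"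
  have sub: "rect_coords i j \<subseteq> J" if "i \<le> m + n" "j \<le> m + n" for i j
    using rect_coords_mono[OF that] J(2) by blast
  have lp_meas: "(\<lambda>f. lp a b f i j) \<in> borel_measurable (weights J)" if "i \<le> m + n" "j \<le> m + n" for a b i j
    by (rule measurable_lp[OF sub[OF that]])
  have Zet_meas: "(\<lambda>f. \<Sum>i=1..l. f (Zet i)) \<in> borel_measurable (weights J)" if "l \<le> m" for l
    using that J(3) by (intro borel_measurable_sum measurable_coordinate) auto
  have A_meas: "A \<in> sets (weights J)" and B_meas: "B \<in> sets (weights J)"
    unfolding A_def B_def using mn lp_meas by (auto intro!: borel_measurable_less)
  have D_meas: "D \<in> sets (weights J)"
    unfolding D_def using measurable_coordinate[OF kJ] by measurable
  have E_meas: "E \<in> sets (weights J)"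
    unfolding E_def
  proof (rule sets.sets_Collect_finite_Ex)
    fix t assume "t \<in> {k0..k0}"
    then show "{f \<in> space (weights J). - (- y) \<le> 0 * (\<Sum>i=1..0 + t. f (Zet i)) +
      (lp (1/w2) (1/(1-w2)) f (m - t) (n + t) - lp (1/w2) (1/(1-w2)) f m n)} \<in> sets (weights J)"
      using mn by (intro borel_measurable_le borel_measurable_add borel_measurable_diff borel_measurable_times
        lp_meas Zet_meas borel_measurable_const) auto
  qed simp
  have F_meas: "F \<in> sets (weights J)"
    unfolding F_def
  proof (rule sets.sets_Collect_finite_Ex)
    fix t assume "t \<in> {K - k0..m - k0 - 1}"
    then show "{f \<in> space (weights J). - (y + s) \<le> e * (\<Sum>i=1..k0 + t. f (Zet i)) +
      (lp (1/w1) (1/(1-w1)) f (m - k0 - t) (n + k0 + t) - lp (1/w1) (1/(1-w1)) f (m - k0) (n + k0))} \<in> sets (weights J)"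
      using mn by (intro borel_measurable_le borel_measurable_add borel_measurable_diff borel_measurable_times
        lp_meas Zet_meas borel_measurable_const) auto
  qed simp
  have "{f \<in> space (weights J). exit_event e m n K f} \<subseteq> A \<union> B \<union> D \<union> E \<union> F"
  proof (rule subsetI, rule ccontr)
    fix f assume "f \<in> {f \<in> space (weights J). exit_event e m n K f}" "f \<notin> A \<union> B \<union> D \<union> E \<union> F"
    then have f: "f \<in> space (weights J)" and ev: "exit_event e m n K f"
      and nA: "f \<notin> A" and nB: "f \<notin> B" and nD: "f \<notin> D" and nE: "f \<notin> E" and nF: "f \<notin> F"
      by auto
    from ev obtain i where i: "K \<le> i" "i < m" "lp_open f m n \<le> e * (\<Sum>i=1..i. f (Zet i)) + lp_open f (m - i) (n + i)"
      by (auto simp: exit_event_def)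
    define t where "t = i - k0"
    have t: "i = k0 + t" "t \<in> {K - k0..m - k0 - 1}" "t \<le> m - k0" using i mn by (auto simp: t_def)
    have "lp 0 0 f (m - k0 - t) (n + k0 + t) - lp 0 0 f (m - k0) (n + k0)
        \<le> lp (1/w1) (1/(1-w1)) f (m - k0 - t) (n + k0 + t) - lp (1/w1) (1/(1-w1)) f (m - k0) (n + k0)"
      using nA f w1 t by (intro lp_antidiagonal_compare) (auto simp: A_def)
    moreover have "lp 0 0 f (m - k0) (n + k0) - lp 0 0 f m n
        \<le> lp (1/w2) (1/(1-w2)) f (m - k0) (n + k0) - lp (1/w2) (1/(1-w2)) f m n"
      using nB f w2 mn by (intro lp_antidiagonal_compare) (auto simp: B_def)
    moreover have "lp (1/w2) (1/(1-w2)) f (m - k0) (n + k0) - lp (1/w2) (1/(1-w2)) f m n < y"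
      using nE f by (auto simp: E_def)
    moreover have "\<bar>f (Blk (m - 1) (n - 1))\<bar> < s" using nD f by (auto simp: D_def k_def)
    moreover have "lp 0 0 f m n - \<bar>f (Blk (m - 1) (n - 1))\<bar>
        \<le> e * (\<Sum>i=1..k0 + t. f (Zet i)) + (lp 0 0 f (m - k0 - t) (n + k0 + t) - \<bar>f (Blk (m - i - 1) (n + i - 1))\<bar>)"
      using i(3) t by (simp add: lp_open_def add.assoc)
    moreover have "0 \<le> \<bar>f (Blk (m - i - 1) (n + i - 1))\<bar>" by simp
    ultimately have "- (y + s) \<le> e * (\<Sum>i=1..k0 + t. f (Zet i)) +
      (lp (1/w1) (1/(1-w1)) f (m - k0 - t) (n + k0 + t) - lp (1/w1) (1/(1-w1)) f (m - k0) (n + k0))"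
      by linarith
    then have "f \<in> F" using f t(2) unfolding F_def by blast
    with nF show False by blast
  qed
  then have "measure (weights J) {f \<in> space (weights J). exit_event e m n K f} \<le> measure (weights J) (A \<union> B \<union> D \<union> E \<union> F)"
    using A_meas B_meas D_meas E_meas F_meas by (intro finite_measure_mono) auto
  also have "\<dots> \<le> measure (weights J) A + measure (weights J) B + measure (weights J) D + measure (weights J) E + measure (weights J) F"
    using A_meas B_meas D_meas E_meas F_meas by (intro order_trans[OF measure_Un_le] add_mono) auto
  also have "measure (weights J) D \<le> 2 * exp (- s / 2)"
  proof -
    have "(\<integral>\<^sup>+f. ennreal (exp (1/2 * \<bar>f k\<bar>)) \<partial>weights J) = (\<integral>\<^sup>+f. 1 * ennreal (exp (1/2 * \<bar>f k\<bar>)) \<partial>weights J)"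
      by simp
    also have "\<dots> = (\<integral>\<^sup>+f. 1 \<partial>weights J) * (\<integral>\<^sup>+y. ennreal (exp (1/2 * \<bar>y\<bar>)) \<partial>wlaw k)"
      by (rule nn_integral_weights_peel[OF J(1) kJ]) auto
    also have "\<dots> = ennreal 2"
      using nn_integral_Exp1_exp_abs[of "1/2"] emeasure_space_1 by (simp add: k_def)
    finally have "measure (weights J) {f \<in> space (weights J). 1/2 * s \<le> 1/2 * \<bar>f k\<bar>} \<le> exp (-(1/2 * s)) * 2"
      using measurable_coordinate[OF kJ] by (intro exponential_markov) auto
    then show ?thesis by (simp add: D_def mult.commute)
  qed
  also have "measure (weights J) E \<le> exp (- \<theta>2 * y) * (1 / ((1 - \<theta>2 / (1 - w2)) * (1 + \<theta>2 / w2))) ^ k0"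
  proof -
    \<comment> \<open>A single time and no profile: the walk bound is applied with
      \<open>e = 0\<close>, offset 0 and both ends of the interval equal to
      \<open>k0\<close>.\<close>
    have "measure (weights J) E = measure (weights J) {f \<in> space (weights J). \<exists>t\<in>{k0..k0}. - (- y) \<le> walk 0 0 (1/w2) (1/(1-w2)) m n f t}"
      unfolding E_def using mn J by (intro antidiagonal_increments[OF w2]) auto
    also have "\<dots> \<le> exp (\<theta>2 * (- y)) * (1 ^ 0 * (1 / ((1 - \<theta>2 * (1/(1-w2))) * (1 + \<theta>2 * (1/w2)))) ^ k0)"
    proof (rule walk_hitting_probability[OF J(1)])
      interpret X: prob_space "X_law (1/2)" by (rule prob_space_X_law) auto
      show "(\<integral>\<^sup>+z. ennreal (exp (\<theta>2 * (0 * z))) \<partial>X_law (1/2)) \<le> ennreal 1" using X.emeasure_space_1 by simp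
      show "path_coords 0 m n \<subseteq> J" using J(3) subsetD[OF J(2)] by (auto simp: path_coords_def)
    qed (use mn w2 \<theta>2 in auto)
    finally show ?thesis by simp
  qed
  also have "measure (weights J) F \<le> exp (\<theta>1 * (y + s)) * ((1 / (1 - 4 * \<theta>1^2)) ^ k0
         * (1 / (1 - 4 * \<theta>1^2) / ((1 - \<theta>1 / (1 - w1)) * (1 + \<theta>1 / w1))) ^ (K - k0))"
  proof (cases "K - k0 \<le> m - k0 - 1")
    case True
    have mk: "m - k0 + (n + k0) = m + n" "Zet ` {1..k0 + (m - k0)} \<subseteq> J" using mn J(3) by auto
    have "measure (weights J) F = measure (weights J) {f \<in> space (weights J).
        \<exists>t\<in>{K - k0..m - k0 - 1}. - (y + s) \<le> walk e k0 (1/w1) (1/(1-w1)) (m - k0) (n + k0) f t}"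
      unfolding F_def using mn J mk by (intro antidiagonal_increments[OF w1]) auto
    also have "\<dots> \<le> exp (\<theta>1 * (y + s)) * ((1 / (1 - 4 * \<theta>1^2)) ^ k0 *
        (1 / (1 - 4 * \<theta>1^2) / ((1 - \<theta>1 * (1/(1 - w1))) * (1 + \<theta>1 * (1/w1)))) ^ (K - k0))"
    proof (rule walk_hitting_probability[OF J(1)])
      show "path_coords k0 (m - k0) (n + k0) \<subseteq> J" using mk subsetD[OF J(2)] by (auto simp: path_coords_def)
      show "(\<integral>\<^sup>+z. ennreal (exp (\<theta>1 * (e * z))) \<partial>X_law (1/2)) \<le> ennreal (1 / (1 - 4 * \<theta>1^2))"
        by (rule nn_integral_exp_X_law_le[OF \<theta>1(1,2) e])
    qed (use True w1 \<theta>1 \<phi>1 sq in auto)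
    finally show ?thesis by simp
  next
    case False
    then have "F = {}" by (auto simp: F_def)
    moreover have "0 \<le> 1 + \<theta>1 / w1" "0 \<le> 1 - \<theta>1 / (1 - w1)" using \<theta>1 w1 by auto
    ultimately show ?thesis using sq by simp
  qed
  finally show ?thesis by (simp add: A_def B_def)
qed

section \<open>Choice of the parameters on the scale \<open>n powr (2/3)\<close>\<close>

lemma inflection_point:
  fixes m n :: real
  assumes "0 < m" "0 < n" and x0: "x0 = sqrt m / (sqrt m + sqrt n)"
  obtains q where "m + n \<le> q" "q \<le> 2 * (m + n)" "x0 = 1/2 + (m - n) / (2 * q)"
proof
  define a b where "a = sqrt m" and "b = sqrt n"
  have ab: "0 < a" "0 < b" "m = a^2" "n = b^2" using assms by (simp_all add: a_def b_def)
  show "m + n \<le> (sqrt m + sqrt n)^2" using ab(1,2) unfolding a_def[symmetric] b_def[symmetric] ab(3,4)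
    by (simp add: power2_sum)
  show "(sqrt m + sqrt n)^2 \<le> 2 * (m + n)" unfolding a_def[symmetric] b_def[symmetric] ab(3,4)
    using sum_squares_bound[of a b] ab(1,2) by (simp add: power2_sum)
  \<comment> \<open>Expanding the fraction by \<open>a + b\<close> removes the square roots from the
    numerator: the parameter depends on \<open>m - n\<close> linearly, up to a denominator known
    within a factor 2.\<close>
  have "a / (a + b) = 1/2 + (a^2 - b^2) / (2 * (a + b)^2)"
    using ab by (simp add: divide_simps power2_eq_square) (simp add: algebra_simps)
  then show "x0 = 1/2 + (m - n) / (2 * (sqrt m + sqrt n)^2)"
    using ab(1,2) by (simp add: x0 a_def[symmetric] b_def[symmetric] ab(3,4))
qed

text \<open>Frees \<open>w\<close> from the exact relation to \<open>h\<close>: the previous bound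
  is used with \<open>(w - x0) / 16\<close> in place of \<open>h\<close>. The hypothesis
  \<open>w + 4 \<le> 17 * x0\<close> states that this step below \<open>x0\<close> stays above
  \<open>1/4\<close>.\<close>

lemma exit_probability_gap:
  assumes mn: "0 < m" "0 < n" and J: "finite J" "rect_coords m n \<subseteq> J"
    and x0: "x0 = sqrt m / (sqrt m + sqrt n)"
    and h: "0 < h" "x0 + 16 * h \<le> w" "w \<le> 3/4" "w + 4 \<le> 17 * x0"
  shows "measure (weights J) {f \<in> space (weights J). lp 0 (1/(1-w)) f m n < lp (1/w) 0 f m n}
    \<le> 2 * exp (- (20 * (m + n) * h^3))"
proof -
  have "h^3 \<le> ((w - x0) / 16)^3" using h by (intro power_mono) auto
  then have "20 * (real m + n) * h^3 \<le> 20 * (real m + n) * ((w - x0) / 16)^3"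
    by (intro mult_left_mono) auto
  then have le: "2 * exp (- (20 * (m + n) * ((w - x0) / 16)^3)) \<le> 2 * exp (- (20 * (m + n) * h^3))" by simp
  have "w = x0 + 16 * ((w - x0) / 16)" by (simp add: field_simps)
  moreover have "1/4 \<le> x0 - (w - x0) / 16" using h(4) by (simp add: field_simps)
  ultimately
  have "measure (weights J) {f \<in> space (weights J). lp 0 (1/(1-w)) f m n < lp (1/w) 0 f m n}
    \<le> 2 * exp (- (20 * (m + n) * ((w - x0) / 16)^3))"
    using exit_probability[OF mn J x0, of "(w - x0) / 16" w] h by simp
  from order_trans[OF this le] show ?thesis by simp
qed

text \<open>For \<open>w = 1/2 - u\<close> and exponent \<open>\<theta>\<close> the factor with
  profile is \<open>(1 - 4*u^2) / ((1 - 4*\<theta>^2) * (1 - 4*(u - \<theta>)^2))\<close>. The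
  denominator is symmetric under \<open>\<theta>\<close> to \<open>u - \<theta>\<close> and largest
  at \<open>u/2\<close>, whence this exponent. What remains is
  \<open>1 - 4*x \<le> (1 - x)^3\<close> at \<open>x = u^2\<close>.\<close>

lemma walk_factor_contracting:
  fixes u :: real
  assumes "0 < u" "u < 1/2"
  shows "1 / (1 - 4 * (u/2)^2) / ((1 - (u/2) / (1 - (1/2 - u))) * (1 + (u/2) / (1/2 - u))) \<le> exp (- (u^2))"
proof -
  have sq: "u^2 < (1/2)^2" using assms by (intro power_strict_mono) auto
  have "(1 - (u/2) / (1 - (1/2 - u))) * (1 + (u/2) / (1/2 - u)) = (1 - u^2) / (1 - 4 * u^2)"
    using assms sq by (simp add: divide_simps power2_eq_square) (simp add: algebra_simps)
  then have "1 / (1 - 4 * (u/2)^2) / ((1 - (u/2) / (1 - (1/2 - u))) * (1 + (u/2) / (1/2 - u))) = (1 - 4 * u^2) / (1 - u^2)^2"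
    using sq by (simp add: power_divide) (simp add: power2_eq_square)
  also have "\<dots> \<le> 1 - u^2"
  proof -
    have "1 - 4 * x \<le> (1 - x) * (1 - x)^2" if "0 \<le> x" "x < 1/4" for x :: real
    proof -
      have "(1 - x) * (1 - x)^2 - (1 - 4 * x) = x * (1 + x * (3 - x))"
        by (simp add: power2_eq_square algebra_simps)
      moreover have "0 \<le> x * (1 + x * (3 - x))" using that by auto
      ultimately show ?thesis by linarith
    qed
    from this[of "u^2"] sq show ?thesis by (simp add: pos_divide_le_eq power2_eq_square)
  qed
  also have "\<dots> \<le> exp (- (u^2))" using exp_ge_add_one_self[of "- (u^2)"] by simp
  finally show ?thesis .
qed

text \<open>Here the drift is positive and no profile is present; the factor is
  \<open>(1 - 4*v^2) / (1 - 4*(v + \<theta>)^2)\<close>. With \<open>v\<close> and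
  \<open>\<theta>\<close> of order \<open>n powr (-1/3)\<close> it stays bounded when raised to a
  power of order \<open>n powr (2/3)\<close>.\<close>

lemma walk_factor_expanding:
  fixes v \<theta> :: real
  assumes "0 \<le> v" "0 \<le> \<theta>" "v + \<theta> \<le> 1/4"
  shows "1 / ((1 - \<theta> / (1 - (1/2 + v))) * (1 + \<theta> / (1/2 + v))) \<le> exp (8 * (v + \<theta>)^2)"
proof -
  define p where "p = v + \<theta>"
  have "p^2 \<le> (1/4)^2" using assms unfolding p_def by (intro power_mono) auto
  then have p: "p^2 \<le> 1/16" by (simp add: power2_eq_square)
  have v: "v^2 \<le> p^2" using assms unfolding p_def by (intro power_mono) auto
  have "(1 - \<theta> / (1 - (1/2 + v))) * (1 + \<theta> / (1/2 + v)) = (1 - 4 * p^2) / (1 - 4 * v^2)"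
    using assms v p by (simp add: p_def divide_simps power2_eq_square) (simp add: algebra_simps)
  then have "1 / ((1 - \<theta> / (1 - (1/2 + v))) * (1 + \<theta> / (1/2 + v))) = (1 - 4 * v^2) / (1 - 4 * p^2)"
    using p v by simp
  also have "\<dots> \<le> 1 / (1 - 4 * p^2)" using p by (intro divide_right_mono) auto
  also have "\<dots> \<le> 1 + 8 * p^2"
  proof -
    have "1 \<le> (1 + 8 * x) * (1 - 4 * x)" if "0 \<le> x" "x \<le> 1/16" for x :: real
    proof -
      have "(1 + 8 * x) * (1 - 4 * x) - 1 = x * (4 - 32 * x)" by (simp add: algebra_simps)
      moreover have "0 \<le> x * (4 - 32 * x)" using that by (intro mult_nonneg_nonneg) auto
      ultimately show ?thesis by linarith
    qed
    from this[of "p^2"] p show ?thesis by (simp add: pos_divide_le_eq)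
  qed
  also have "\<dots> \<le> exp (8 * p^2)" using exp_ge_add_one_self[of "8 * p^2"] by simp
  finally show ?thesis by (simp add: p_def)
qed

text \<open>Everything is measured in \<open>\<sigma>\<close>, the cube root of \<open>n\<close>:
  starting points in \<open>\<sigma>^2\<close>, passage time differences in \<open>\<sigma>\<close>,
  parameters in \<open>1 / \<sigma>\<close>. The comparison parameters are \<open>1/2 - u\<close>
  and \<open>1/2 + v\<close>, the exponents \<open>u/2\<close> and \<open>1 / \<sigma>\<close>, the
  levels \<open>y * \<sigma>\<close> and \<open>\<sigma>\<close>. Each of the five terms of
  \<open>exit_event_le\<close> receives \<open>\<epsilon> / 5\<close>.\<close>

lemma exit_event_le_epsilon:
  fixes n :: nat and D :: int and A C \<sigma> y r \<epsilon> :: real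
  assumes \<sigma>: "real n = \<sigma>^3" "1 \<le> \<sigma>" "32 * A \<le> \<sigma>" and A: "0 \<le> C" "C + 2 \<le> A" and D: "\<bar>real_of_int D\<bar> \<le> C * \<sigma>^2 + 1"
    and eps: "2 * exp (- (40 * A^3 / 2^24)) \<le> \<epsilon> / 5" "2 * exp (- \<sigma> / 2) \<le> \<epsilon> / 5"
      "exp (- y + 24 * A * (A + 1)^2) \<le> \<epsilon> / 5" "exp (A * (y + 1) / 8 + A^3 / 4 - A^2 * (r - 2 * A) / 256) \<le> \<epsilon> / 5"
    and y: "0 \<le> y" and r: "2 * A \<le> r" and K: "r * \<sigma>^2 \<le> K" and e: "e = 0 \<or> e = 1"
    and J: "finite J" "rect_coords (2 * n + 2) (2 * n + 2) \<subseteq> J" "Zet ` {1..nat (int n + 1 + D)} \<subseteq> J"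
  shows "measure (weights J) {f \<in> space (weights J). exit_event e (nat (int n + 1 + D)) (nat (int n + 1 - D)) K f} \<le> \<epsilon>"
proof -
  define N where "N = \<sigma>^3 + 1"
  have pow: "\<sigma>^2 \<ge> 1" "\<sigma>^3 = \<sigma> * \<sigma>^2" "\<sigma>^2 > 0" "\<sigma>^3 \<ge> 1"
    using \<sigma> by (auto simp: power2_eq_square power3_eq_cube intro!: one_le_power mult_ge1_I)
  have A2: "2 \<le> A" using A by simp
  have CA: "C * \<sigma>^2 + 1 \<le> (A - 1) * \<sigma>^2"
    using mult_right_mono[of "C + 1" "A - 1" "\<sigma>^2"] A pow by (simp add: algebra_simps)
  have A\<sigma>: "32 * A * \<sigma>^2 \<le> \<sigma>^3" using \<sigma>(3) pow by (simp add: mult_right_mono)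
  have DA: "\<bar>real_of_int D\<bar> \<le> (A - 1) * \<sigma>^2" using D CA by linarith
  define d where "d = \<lceil>A * \<sigma>^2\<rceil>"
  have d: "A * \<sigma>^2 \<le> d" "d \<le> A * \<sigma>^2 + 1" by (simp_all add: d_def)
  have d_nonneg: "0 \<le> d"
  proof -
    have "0 \<le> A * \<sigma>^2" using A2 pow by simp
    with d(1) have "0 \<le> real_of_int d" by linarith
    then show ?thesis by simp
  qed
  have d2: "d \<le> 2 * A * \<sigma>^2" using d pow mult_mono[of 1 A 1 "\<sigma>^2"] A2 by simp
  have d3: "d \<le> \<sigma>^3 / 16" using d2 A\<sigma> by simp
  have expand: "(A - 1) * \<sigma>^2 = A * \<sigma>^2 - \<sigma>^2" by (simp add: algebra_simps)
  have Dd: "0 \<le> D + d" using DA d(1) pow unfolding expand by linarith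
  have D_small: "\<bar>real_of_int D\<bar> \<le> \<sigma>^3 / 16" using DA A\<sigma> pow unfolding expand by linarith
  \<comment> \<open>The shift by \<open>D\<close> makes the base point
    \<open>(m0 - k0, n0 + k0)\<close> equal to \<open>(N - d, N + d)\<close> for every displacement
    \<open>D\<close> of the target.\<close>
  define m0 n0 k0 where "m0 = nat (int n + 1 + D)" and "n0 = nat (int n + 1 - D)" and "k0 = nat (D + d)"
  have nint: "real_of_int (int n) = \<sigma>^3" using \<sigma>(1) by simp
  have pos: "0 < int n + 1 + D" "0 < int n + 1 - D" "D + d < int n + 1 + D"
    using D_small d3 nint pow by linarith+
  have m0: "real m0 = N + D" "0 < m0" using pos nint by (simp_all add: m0_def N_def)
  have n0: "real n0 = N - D" "0 < n0" using pos nint by (simp_all add: n0_def N_def)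
  have k0: "real k0 = D + d" "k0 < m0" using pos Dd by (simp_all add: k0_def m0_def)
  have m1: "real (m0 - k0) = N - d" "0 < m0 - k0" using k0 m0 by (simp_all add: of_nat_diff)
  have n1: "real (n0 + k0) = N + d" "0 < n0 + k0" using k0 n0 by simp_all
  have sum0: "m0 + n0 = 2 * n + 2" using pos by (simp add: m0_def n0_def)
  have sum1: "m0 - k0 + (n0 + k0) = 2 * n + 2" using sum0 k0 by simp
  have k0A: "k0 \<le> 2 * A * \<sigma>^2"
    using k0(1) DA d(2) pow unfolding expand by linarith
  have k0K: "k0 \<le> K"
  proof -
    have "2 * A * \<sigma>^2 \<le> r * \<sigma>^2" using r by (intro mult_right_mono) auto
    then show ?thesis using k0A K by linarith
  qed
  have N: "\<sigma>^3 \<le> N" "N \<le> 2 * \<sigma>^3" "0 < N" using pow by (simp_all add: N_def)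
  \<comment> \<open>At the base point the characteristic parameter is \<open>1/2 - d / q\<close>
    with \<open>q\<close> between \<open>2 * N\<close> and \<open>4 * N\<close>, hence between
    \<open>1/2 - 4 * u\<close> and \<open>1/2 - 2 * u\<close>. So \<open>1/2 - u\<close> exceeds it
    by at least \<open>u\<close> and still gives a negative drift.\<close>
  define u where "u = d / (8 * N)"
  have u_ge: "A / (16 * \<sigma>) \<le> u"
  proof -
    have "A / (16 * \<sigma>) = A * \<sigma>^2 / (16 * \<sigma>^3)" using \<sigma> by (simp add: power2_eq_square power3_eq_cube)
    also have "\<dots> \<le> d / (8 * N)" using d(1) d_nonneg N A2 pow by (intro frac_le) auto
    finally show ?thesis by (simp add: u_def)
  qed
  have u_le: "u \<le> A / (4 * \<sigma>)"
  proof -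
    have "u \<le> 2 * A * \<sigma>^2 / (8 * \<sigma>^3)" unfolding u_def using d2 d_nonneg N A2 pow by (intro frac_le) auto
    also have "\<dots> = A / (4 * \<sigma>)" using \<sigma> by (simp add: power2_eq_square power3_eq_cube)
    finally show ?thesis .
  qed
  have u_pos: "0 < u" using u_ge A2 \<sigma> by (meson divide_pos_pos less_le_trans mult_pos_pos zero_less_numeral zero_less_one not_le order_less_le_trans)
  have A_div: "A / \<sigma> \<le> 1/32" using \<sigma> by (simp add: divide_le_eq)
  have u_small: "u \<le> 1/128"
  proof -
    have "A / (4 * \<sigma>) = A / \<sigma> / 4" by simp
    then show ?thesis using u_le A_div by linarith
  qed
  have rect_coords_le: "rect_coords i j \<subseteq> J" if "i \<le> 2 * n + 2" "j \<le> 2 * n + 2" for i j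
    using rect_coords_mono[OF that] J(2) by blast
  \<comment> \<open>Both comparisons have total size \<open>2 * N\<close>, and both gaps allow
    \<open>h\<close> to be \<open>A / (256 * \<sigma>)\<close> or more; \<open>2^24\<close> is the
    cube of 256.\<close>
  have tail: "2 * exp (- (20 * x * h^3)) \<le> \<epsilon> / 5" if x: "x = 2 * N" and h: "A / (256 * \<sigma>) \<le> h" for x h :: real
  proof -
    have "(A / (256 * \<sigma>))^3 \<le> h^3" using h A2 \<sigma> by (intro power_mono) auto
    then have "20 * (2 * \<sigma>^3) * (A / (256 * \<sigma>))^3 \<le> 20 * x * h^3"
      unfolding x using N pow A2 \<sigma> by (intro mult_mono) auto
    moreover have "20 * (2 * \<sigma>^3) * (A / (256 * \<sigma>))^3 = 40 * A^3 / 2^24"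
      using \<sigma> by (simp add: power_divide power_mult_distrib)
    ultimately have "exp (- (20 * x * h^3)) \<le> exp (- (40 * A^3 / 2^24))" by simp
    then show ?thesis using eps(1) by linarith
  qed
  have P1: "measure (weights J) {f \<in> space (weights J). lp 0 (1/(1-(1/2-u))) f (m0 - k0) (n0 + k0) < lp (1/(1/2-u)) 0 f (m0 - k0) (n0 + k0)} \<le> \<epsilon> / 5"
  proof -
    obtain q where q: "N - d + (N + d) \<le> q" "q \<le> 2 * (N - d + (N + d))"
      "sqrt (m0 - k0) / (sqrt (m0 - k0) + sqrt (n0 + k0)) = 1/2 + ((N - d) - (N + d)) / (2 * q)"
      using inflection_point[of "real (m0 - k0)" "real (n0 + k0)" _ thesis] m1 n1 by auto
    define x0 where "x0 = sqrt (m0 - k0) / (sqrt (m0 - k0) + sqrt (n0 + k0))"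
    have x0: "x0 = 1/2 - d / q" using q(3) by (simp add: x0_def)
    have "d / (4 * N) \<le> d / q" "d / q \<le> d / (2 * N)"
      using q(1,2) N d d_nonneg A2 pow by (auto intro!: divide_left_mono mult_pos_pos)
    then have gap: "x0 + u \<le> 1/2 - u" "1/2 - 4 * u \<le> x0" 
    proof -
      have "d / (4 * N) = 2 * u" "d / (2 * N) = 4 * u" by (simp_all add: u_def)
      then show "x0 + u \<le> 1/2 - u" "1/2 - 4 * u \<le> x0"
        using \<open>d / (4 * N) \<le> d / q\<close> \<open>d / q \<le> d / (2 * N)\<close> unfolding x0 by linarith+
    qed
    have "measure (weights J) {f \<in> space (weights J). lp 0 (1/(1-(1/2-u))) f (m0 - k0) (n0 + k0) < lp (1/(1/2-u)) 0 f (m0 - k0) (n0 + k0)}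
        \<le> 2 * exp (- (20 * (real (m0 - k0) + real (n0 + k0)) * (u / 16)^3))"
      using m1 n1 gap u_pos u_small sum1 J(1)
      by (intro exit_probability_gap[OF _ _ _ _ x0_def] rect_coords_le) auto
    also have "\<dots> \<le> \<epsilon> / 5"
      using u_ge m1 n1 by (intro tail) auto
    finally show ?thesis .
  qed
  \<comment> \<open>The target is within \<open>A * \<sigma>^2\<close> of the diagonal, so its
    characteristic parameter is within \<open>v / 2\<close> of \<open>1/2\<close>, and
    \<open>1/2 + v\<close> keeps a gap of \<open>v / 2\<close>.\<close>
  define v where "v = A / \<sigma>"
  have v: "0 < v" "v \<le> 1/32" using A2 \<sigma> A_div by (simp_all add: v_def)
  have P2: "measure (weights J) {f \<in> space (weights J). lp 0 (1/(1-(1/2+v))) f m0 n0 < lp (1/(1/2+v)) 0 f m0 n0} \<le> \<epsilon> / 5"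
  proof -
    obtain q where q: "N + D + (N - D) \<le> q" "q \<le> 2 * (N + D + (N - D))"
      "sqrt m0 / (sqrt m0 + sqrt n0) = 1/2 + ((N + D) - (N - D)) / (2 * q)"
      using inflection_point[of "real m0" "real n0" _ thesis] m0 n0 by auto
    define x0 where "x0 = sqrt m0 / (sqrt m0 + sqrt n0)"
    have x0: "x0 = 1/2 + D / q" using q(3) by (simp add: x0_def)
    have "\<bar>D / q\<bar> \<le> \<bar>D\<bar> / (2 * N)" using q(1) N by (auto simp: abs_divide intro!: divide_left_mono mult_pos_pos)
    also have "\<dots> \<le> A * \<sigma>^2 / (2 * \<sigma>^3)"
      using DA N pow unfolding expand by (intro frac_le) auto
    also have "\<dots> = v / 2" using \<sigma> by (simp add: v_def power2_eq_square power3_eq_cube)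
    finally have gap: "x0 \<le> 1/2 + v / 2" "1/2 - v / 2 \<le> x0" unfolding x0 by linarith+
    have "measure (weights J) {f \<in> space (weights J). lp 0 (1/(1-(1/2+v))) f m0 n0 < lp (1/(1/2+v)) 0 f m0 n0}
        \<le> 2 * exp (- (20 * (real m0 + real n0) * (v / 32)^3))"
      using m0 n0 gap v sum0 J(1)
      by (intro exit_probability_gap[OF _ _ _ _ x0_def] rect_coords_le) auto
    also have "\<dots> \<le> \<epsilon> / 5"
      using m0 n0 A2 \<sigma> by (intro tail) (auto simp: v_def field_simps)
    finally show ?thesis .
  qed
  define \<theta> where "\<theta> = 1 / \<sigma>"
  have \<theta>: "0 < \<theta>" "\<theta> \<le> 1/64" using \<sigma> A2 by (auto simp: \<theta>_def divide_le_eq)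
  have P4: "exp (- \<theta> * (y * \<sigma>)) * (1 / ((1 - \<theta> / (1 - (1/2+v))) * (1 + \<theta> / (1/2+v)))) ^ k0 \<le> \<epsilon> / 5"
  proof -
    have "0 \<le> 1 / ((1 - \<theta> / (1 - (1/2+v))) * (1 + \<theta> / (1/2+v)))"
      using \<theta> v by (auto simp: divide_simps)
    then have "(1 / ((1 - \<theta> / (1 - (1/2+v))) * (1 + \<theta> / (1/2+v)))) ^ k0 \<le> exp (8 * (v + \<theta>)^2) ^ k0"
      using \<theta> v by (intro power_mono walk_factor_expanding) auto
    also have "\<dots> = exp (k0 * (8 * (v + \<theta>)^2))" by (simp add: exp_of_nat_mult)
    also have "\<dots> \<le> exp (24 * A * (A + 1)^2)"
    proof -
      have "v + \<theta> = (A + 1) / \<sigma>" by (simp add: v_def \<theta>_def add_divide_distrib)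
      then have "k0 * (8 * (v + \<theta>)^2) \<le> 2 * A * \<sigma>^2 * (8 * ((A + 1) / \<sigma>)^2)"
        using k0A by (simp only: mult_right_mono zero_le_power2 mult_nonneg_nonneg zero_le_numeral)
      also have "\<dots> = 16 * A * (A + 1)^2" using \<sigma> by (simp add: power_divide)
      also have "\<dots> \<le> 24 * A * (A + 1)^2" using A2 by (intro mult_right_mono) auto
      finally show ?thesis by simp
    qed
    finally have "exp (- \<theta> * (y * \<sigma>)) * (1 / ((1 - \<theta> / (1 - (1/2+v))) * (1 + \<theta> / (1/2+v)))) ^ k0
        \<le> exp (- y) * exp (24 * A * (A + 1)^2)" using \<sigma> by (simp add: \<theta>_def)
    also have "\<dots> = exp (- y + 24 * A * (A + 1)^2)" by (simp add: exp_add[symmetric])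
    finally show ?thesis using eps(3) by linarith
  qed
  let ?Z = "1 / (1 - 4 * (u/2)^2)"
  let ?\<phi> = "?Z / ((1 - (u/2) / (1 - (1/2 - u))) * (1 + (u/2) / (1/2 - u)))"
  have usq: "0 \<le> u^2" "u^2 \<le> 1/2"
    using u_pos u_small power_mono[of u "1/2" 2] by (auto simp: power2_eq_square)
  have \<phi>_le: "?\<phi> \<le> exp (- (u^2))" using walk_factor_contracting[of u] u_pos u_small by simp
  have \<phi>_nonneg: "0 \<le> ?\<phi>"
    using u_pos u_small usq by (intro divide_nonneg_nonneg mult_nonneg_nonneg) (auto simp: power_divide divide_simps)
  have P5: "exp (u/2 * (y * \<sigma> + \<sigma>)) * (?Z ^ k0 * ?\<phi> ^ (K - k0)) \<le> \<epsilon> / 5"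
  proof -
    \<comment> \<open>The profile increments before \<open>k0\<close> meet no compensating drift. As
      \<open>k0\<close> is of order \<open>\<sigma>^2\<close> and \<open>u\<close> of order
      \<open>1 / \<sigma>\<close>, they cost only a constant factor.\<close>
    have "?Z \<le> exp (2 * u^2)"
    proof -
      have "1 \<le> (1 + 2 * x) * (1 - x)" if "0 \<le> x" "x \<le> 1/2" for x :: real
        using mult_nonneg_nonneg[of x "1 - 2 * x"] that by (simp add: algebra_simps)
      from this[OF usq] have "?Z \<le> 1 + 2 * u^2" using usq by (simp add: power_divide pos_divide_le_eq)
      then show ?thesis using exp_ge_add_one_self[of "2 * u^2"] by linarith
    qed
    moreover have "0 \<le> ?Z" using usq by (simp add: power_divide)
    ultimately have "?Z ^ k0 \<le> exp (2 * u^2) ^ k0" by (intro power_mono)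
    also have "\<dots> = exp (k0 * (2 * u^2))" by (simp add: exp_of_nat_mult)
    also have "\<dots> \<le> exp (A^3 / 4)"
    proof -
      have "u^2 \<le> (A / (4 * \<sigma>))^2" using u_le u_pos by (intro power_mono) auto
      then have "k0 * (2 * u^2) \<le> 2 * A * \<sigma>^2 * (2 * (A / (4 * \<sigma>))^2)"
        using k0A A2 by (intro mult_mono) auto
      also have "\<dots> = A^3 / 4" using \<sigma> by (simp add: power_divide power_mult_distrib power2_eq_square power3_eq_cube)
      finally show ?thesis by simp
    qed
    finally have Z: "?Z ^ k0 \<le> exp (A^3 / 4)" .
    have "?\<phi> ^ (K - k0) \<le> exp (- (u^2)) ^ (K - k0)" using \<phi>_le \<phi>_nonneg by (intro power_mono)
    also have "\<dots> = exp ((K - k0) * (- (u^2)))" by (rule exp_of_nat_mult[symmetric])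
    also have "\<dots> \<le> exp (- (A^2 * (r - 2 * A) / 256))"
    proof -
      have "(r - 2 * A) * \<sigma>^2 \<le> real (K - k0)" using K k0A k0K by (simp add: of_nat_diff algebra_simps)
      moreover have "(A / (16 * \<sigma>))^2 \<le> u^2" using u_ge A2 \<sigma> by (intro power_mono) auto
      ultimately have "(r - 2 * A) * \<sigma>^2 * (A / (16 * \<sigma>))^2 \<le> real (K - k0) * u^2"
        using r by (intro mult_mono) auto
      moreover have "(r - 2 * A) * \<sigma>^2 * (A / (16 * \<sigma>))^2 = A^2 * (r - 2 * A) / 256"
        using \<sigma> by (simp add: power_divide power_mult_distrib)
      ultimately show ?thesis by simp
    qed
    finally have \<phi>: "?\<phi> ^ (K - k0) \<le> exp (- (A^2 * (r - 2 * A) / 256))" .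
    have "u/2 * (y * \<sigma> + \<sigma>) \<le> (A / (4 * \<sigma>)) / 2 * (y * \<sigma> + \<sigma>)"
      using u_le y \<sigma> by (intro mult_right_mono) auto
    also have "\<dots> = A * (y + 1) / 8" using \<sigma> by (simp add: field_simps)
    finally have "exp (u/2 * (y * \<sigma> + \<sigma>)) \<le> exp (A * (y + 1) / 8)" by simp
    then have "exp (u/2 * (y * \<sigma> + \<sigma>)) * (?Z ^ k0 * ?\<phi> ^ (K - k0)) \<le> exp (A * (y + 1) / 8) * (exp (A^3 / 4) * exp (- (A^2 * (r - 2 * A) / 256)))"
      using Z \<phi> \<phi>_nonneg usq by (intro mult_mono mult_nonneg_nonneg zero_le_power) (auto simp: power_divide)
    also have "\<dots> = exp (A * (y + 1) / 8 + A^3 / 4 - A^2 * (r - 2 * A) / 256)" by (simp add: exp_add[symmetric])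
    finally show ?thesis using eps(4) by linarith
  qed
  have "?\<phi> \<le> 1" using \<phi>_le usq by (meson exp_le_one_iff neg_le_0_iff_le order_trans)
  then have "measure (weights J) {f \<in> space (weights J). exit_event e m0 n0 K f}
    \<le> measure (weights J) {f \<in> space (weights J). lp 0 (1/(1-(1/2-u))) f (m0 - k0) (n0 + k0) < lp (1/(1/2-u)) 0 f (m0 - k0) (n0 + k0)}
     + measure (weights J) {f \<in> space (weights J). lp 0 (1/(1-(1/2+v))) f m0 n0 < lp (1/(1/2+v)) 0 f m0 n0}
     + 2 * exp (- \<sigma> / 2)
     + exp (- \<theta> * (y * \<sigma>)) * (1 / ((1 - \<theta> / (1 - (1/2+v))) * (1 + \<theta> / (1/2+v)))) ^ k0
     + exp (u/2 * (y * \<sigma> + \<sigma>)) * (?Z ^ k0 * ?\<phi> ^ (K - k0))"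
    using n0 k0 k0K e J u_pos u_small v \<theta> sum0
    by (intro exit_event_le) (auto simp: m0_def[symmetric] divide_less_eq)
  also have "\<dots> \<le> \<epsilon> / 5 + \<epsilon> / 5 + \<epsilon> / 5 + \<epsilon> / 5 + \<epsilon> / 5"
    by (intro add_mono P1 P2 eps(2) P4 P5)
  finally show ?thesis by (simp add: m0_def n0_def)
qed

section \<open>Up-right paths\<close>

definition up_right_paths :: "pt \<Rightarrow> pt \<Rightarrow> pt list set" where
  "up_right_paths p x = {ps. up_right_path ps p x}"

lemma up_right_path_Cons:
  "up_right_path (p # ps) q x \<longleftrightarrow> p = q \<and> (ps = [] \<and> q = x \<or>
     up_right_path ps (fst q + 1, snd q) x \<or> up_right_path ps (fst q, snd q + 1) x)"
proof (cases ps)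
  case Nil
  then show ?thesis by (auto simp: up_right_path_def)
next
  case (Cons p' ps')
  have all_nat: "(\<forall>i. Q i) \<longleftrightarrow> Q 0 \<and> (\<forall>i. Q (Suc i))" for Q :: "nat \<Rightarrow> bool"
    by (metis nat.exhaust)
  show ?thesis
    unfolding up_right_path_def Cons by (subst all_nat) auto
qed

lemma up_right_path_le:
  "up_right_path ps p x \<Longrightarrow> fst p \<le> fst x \<and> snd p \<le> snd x"
proof (induction ps arbitrary: p)
  case Nil
  then show ?case by (simp add: up_right_path_def)
next
  case (Cons a ps)
  then consider "p = x" | "up_right_path ps (fst p + 1, snd p) x" | "up_right_path ps (fst p, snd p + 1) x"
    by (auto simp: up_right_path_Cons)
  then show ?case using Cons.IH by cases fastforce+
qed

lemma up_right_paths_rec: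
  "up_right_paths p x = (if p = x then {[p]} else {})
     \<union> (#) p ` up_right_paths (fst p + 1, snd p) x \<union> (#) p ` up_right_paths (fst p, snd p + 1) x"
proof (rule set_eqI)
  fix ps
  show "ps \<in> up_right_paths p x \<longleftrightarrow> ps \<in> (if p = x then {[p]} else {})
     \<union> (#) p ` up_right_paths (fst p + 1, snd p) x \<union> (#) p ` up_right_paths (fst p, snd p + 1) x"
    by (cases ps) (auto simp: up_right_paths_def up_right_path_Cons up_right_path_def[of "[]"])
qed

lemma up_right_paths_empty: "\<not> (fst p \<le> fst x \<and> snd p \<le> snd x) \<Longrightarrow> up_right_paths p x = {}"
  using up_right_path_le unfolding up_right_paths_def by blast

lemma passage_time_Cons:
  assumes "ps \<in> up_right_paths p x"
  shows "passage_time w (q # ps) = w p + passage_time w ps"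
  using assms by (cases ps) (auto simp: up_right_paths_def up_right_path_def passage_time_def)

lemma Max_passage_time_Cons:
  assumes "finite (up_right_paths p x)" "up_right_paths p x \<noteq> {}"
  shows "Max (passage_time w ` (#) q ` up_right_paths p x) = w p + LPP w p x"
proof -
  have "passage_time w ` (#) q ` up_right_paths p x = (\<lambda>t. w p + t) ` passage_time w ` up_right_paths p x"
    unfolding image_image by (intro image_cong refl passage_time_Cons)
  also have "Max \<dots> = w p + Max (passage_time w ` up_right_paths p x)"
    using assms by (intro mono_Max_commute[symmetric]) (auto simp: mono_def)
  finally show ?thesis by (simp add: LPP_def up_right_paths_def)
qed

text \<open>Paths are decomposed by their first step, which is the last step of the recursion seen
  from the target. Nothing is required of the starting weight, since \<open>lp_open\<close> removes
  it; on the antidiagonal the model provides none. Finiteness and nonemptiness travel along because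
  \<open>Max\<close> is meaningful only with them.\<close>

lemma LPP_eq_lp_open:
  fixes x1 x2 :: int
  assumes w: "\<And>a b. a \<le> i \<Longrightarrow> b \<le> j \<Longrightarrow> (a, b) \<noteq> (i, j) \<Longrightarrow> f (Blk a b) = w (x1 - int a, x2 - int b) \<and> 0 \<le> f (Blk a b)"
  shows "finite (up_right_paths (x1 - int i, x2 - int j) (x1, x2)) \<and> up_right_paths (x1 - int i, x2 - int j) (x1, x2) \<noteq> {}
    \<and> LPP w (x1 - int i, x2 - int j) (x1, x2) = lp_open f (Suc i) (Suc j)"
  using w
proof (induction "i + j" arbitrary: i j rule: less_induct)
  case less
  define P where "P i j = up_right_paths (x1 - int i, x2 - int j) (x1, x2)" for i j :: nat
  define p where "p = (x1 - int i, x2 - int j)"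
  have LPP: "LPP w p (x1, x2) = Max (passage_time w ` P i j)"
    by (simp add: LPP_def P_def p_def up_right_paths_def)
  have left: "finite (P i' j') \<and> P i' j' \<noteq> {} \<and> Max (passage_time w ` (#) p ` P i' j') = lp 0 0 f (Suc i') (Suc j')"
    if "i' \<le> i" "j' \<le> j" "(i', j') \<noteq> (i, j)" for i' j'
  proof -
    have lt: "i' + j' < i + j" using that by (cases "i' = i") auto
    have pre: "f (Blk a b) = w (x1 - int a, x2 - int b) \<and> 0 \<le> f (Blk a b)"
      if ab: "a \<le> i'" "b \<le> j'" "(a, b) \<noteq> (i', j')" for a b
    proof (rule less.prems)
      show "a \<le> i" "b \<le> j" using ab \<open>i' \<le> i\<close> \<open>j' \<le> j\<close> by auto
      have "a + b < i + j" using ab lt by linarith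
      then show "(a, b) \<noteq> (i, j)" by auto
    qed
    have IH: "finite (P i' j')" "P i' j' \<noteq> {}" "LPP w (x1 - int i', x2 - int j') (x1, x2) = lp_open f (Suc i') (Suc j')"
      using less.hyps[OF lt pre] unfolding P_def by blast+
    moreover have "Max (passage_time w ` (#) p ` P i' j') = w (x1 - int i', x2 - int j') + LPP w (x1 - int i', x2 - int j') (x1, x2)"
      using IH(1,2) unfolding P_def by (intro Max_passage_time_Cons)
    moreover have "w (x1 - int i', x2 - int j') = \<bar>f (Blk i' j')\<bar>" using less.prems[OF that] by simp
    ultimately show ?thesis by (simp add: lp_open_def)
  qed
  \<comment> \<open>When only one first step is possible, the other entry of the maximum is 0 and
    loses against a nonnegative passage time.\<close>
  have zero: "lp 0 0 f k 0 = 0" "lp 0 0 f 0 k = 0" for k by (induction k) auto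
  have nonneg: "0 \<le> lp 0 0 f k l" for k l by (rule lp_nonneg) auto
  have rec: "P i j = (if i = 0 \<and> j = 0 then {[p]} else {})
     \<union> (if i = 0 then {} else (#) p ` P (i - 1) j) \<union> (if j = 0 then {} else (#) p ` P i (j - 1))"
  proof -
    have "up_right_paths (fst p + 1, snd p) (x1, x2) = (if i = 0 then {} else P (i - 1) j)"
      by (cases i) (auto simp: P_def p_def up_right_paths_empty)
    moreover have "up_right_paths (fst p, snd p + 1) (x1, x2) = (if j = 0 then {} else P i (j - 1))"
      by (cases j) (auto simp: P_def p_def up_right_paths_empty)
    moreover have "p = (x1, x2) \<longleftrightarrow> i = 0 \<and> j = 0" by (auto simp: p_def)
    ultimately show ?thesis
      using up_right_paths_rec[of p "(x1, x2)"] by (simp add: P_def p_def)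
  qed
  have lpo: "lp_open f (Suc i) (Suc j) = max (lp 0 0 f i (Suc j)) (lp 0 0 f (Suc i) j)"
    by (simp add: lp_open_def)
  have "finite (P i j) \<and> P i j \<noteq> {} \<and> Max (passage_time w ` P i j) = max (lp 0 0 f i (Suc j)) (lp 0 0 f (Suc i) j)"
  proof (cases "i = 0"; cases "j = 0")
    assume "i = 0" "j = 0"
    moreover from this have "P i j = {[p]}" by (subst rec) simp
    ultimately show ?thesis by (simp add: zero passage_time_def)
  next
    assume ij: "i = 0" "j \<noteq> 0"
    have r: "P i j = (#) p ` P i (j - 1)" using ij by (subst rec) simp
    show ?thesis using ij left[of i "j - 1"] nonneg[of "Suc i" j] unfolding r by (simp add: zero)
  next
    assume ij: "i \<noteq> 0" "j = 0"
    have r: "P i j = (#) p ` P (i - 1) j" using ij by (subst rec) simp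
    show ?thesis using ij left[of "i - 1" j] nonneg[of i "Suc j"] unfolding r by (simp add: zero)
  next
    assume ij: "i \<noteq> 0" "j \<noteq> 0"
    have r: "P i j = (#) p ` P (i - 1) j \<union> (#) p ` P i (j - 1)" using ij by (subst rec) simp
    show ?thesis using ij left[of "i - 1" j] left[of i "j - 1"] unfolding r image_Un by (simp add: Max_Un)
  qed
  then show ?case unfolding lpo LPP[symmetric] by (simp add: P_def p_def)
qed

lemma up_right_path_swap:
  "up_right_path (map prod.swap ps) (prod.swap p) (prod.swap x) \<longleftrightarrow> up_right_path ps p x"
proof (induction ps arbitrary: p)
  case Nil
  then show ?case by (simp add: up_right_path_def)
next
  case (Cons a ps)
  have "up_right_path (map prod.swap ps) (snd p + 1, fst p) (prod.swap x) \<longleftrightarrow> up_right_path ps (fst p, snd p + 1) x"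
    "up_right_path (map prod.swap ps) (snd p, fst p + 1) (prod.swap x) \<longleftrightarrow> up_right_path ps (fst p + 1, snd p) x"
    using Cons[of "(fst p, snd p + 1)"] Cons[of "(fst p + 1, snd p)"] by simp_all
  moreover have "prod.swap q = prod.swap q' \<longleftrightarrow> q = q'" for q q' :: pt by (auto simp: prod_eq_iff)
  ultimately show ?case by (simp add: up_right_path_Cons) blast
qed

text \<open>Reflection in the diagonal exchanges the two kinds of steps. It carries the starting
  point \<open>k\<close> to \<open>- k\<close> and so turns exits on the left into exits on the
  right.\<close>

lemma LPP_swap: "LPP (\<lambda>p. w (prod.swap p)) (prod.swap p) (prod.swap x) = LPP w p x"
proof -
  have "passage_time (\<lambda>p. w (prod.swap p)) ` {ps. up_right_path ps (prod.swap p) (prod.swap x)}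
      = passage_time w ` {ps. up_right_path ps p x}"
  proof (intro set_eqI iffI)
    fix t assume "t \<in> passage_time w ` {ps. up_right_path ps p x}"
    then obtain ps where "t = passage_time w ps" "up_right_path ps p x" by auto
    then show "t \<in> passage_time (\<lambda>p. w (prod.swap p)) ` {ps. up_right_path ps (prod.swap p) (prod.swap x)}"
      using up_right_path_swap[of ps p x]
      by (intro image_eqI[where x="map prod.swap ps"]) (auto simp: passage_time_def map_tl[symmetric] comp_def)
  next
    fix t assume "t \<in> passage_time (\<lambda>p. w (prod.swap p)) ` {ps. up_right_path ps (prod.swap p) (prod.swap x)}"
    then obtain ps where "t = passage_time (\<lambda>p. w (prod.swap p)) ps" "up_right_path ps (prod.swap p) (prod.swap x)" by auto
    then show "t \<in> passage_time w ` {ps. up_right_path ps p x}"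
      using up_right_path_swap[of ps "prod.swap p" "prod.swap x"]
      by (intro image_eqI[where x="map prod.swap ps"]) (auto simp: passage_time_def map_tl[symmetric] comp_def)
  qed
  then show ?thesis by (simp add: LPP_def)
qed

text \<open>The maximum is over a finite set containing 0, where the profile vanishes, so a
  maximiser beats the plain value \<open>L\<close> from 0.\<close>

lemma exit_pt_properties:
  assumes x: "0 \<le> fst x" "0 \<le> snd x" and b0: "b 0 = 0"
  shows "exit_pt w b x \<in> Cset x"
    and "ereal (Lk w 0 x) \<le> b (exit_pt w b x) + ereal (Lk w (exit_pt w b x) x)"
proof -
  have C: "Cset x \<subseteq> {- snd x..fst x}" "0 \<in> Cset x" using x by (auto simp: Cset_def)
  have fin: "finite (Cset x)" by (rule finite_subset[OF C(1)]) simp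
  let ?g = "\<lambda>k. b k + ereal (Lk w k x)"
  let ?S = "{k \<in> Cset x. ?g k = Lb w b x}"
  have "Lb w b x \<in> ?g ` Cset x" unfolding Lb_def using fin C(2) by (intro Max_in) auto
  then have "?S \<noteq> {}" by auto
  then have "exit_pt w b x \<in> ?S" unfolding exit_pt_def using fin by (intro Max_in) auto
  then show "exit_pt w b x \<in> Cset x" and "ereal (Lk w 0 x) \<le> b (exit_pt w b x) + ereal (Lk w (exit_pt w b x) x)"
  proof -
    assume Z: "exit_pt w b x \<in> ?S"
    show "exit_pt w b x \<in> Cset x" using Z by simp
    have "?g 0 \<le> Lb w b x" unfolding Lb_def using fin C(2) by (intro Max_ge) auto
    then show "ereal (Lk w 0 x) \<le> b (exit_pt w b x) + ereal (Lk w (exit_pt w b x) x)"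
      using Z b0 by simp
  qed
qed

text \<open>Lattice weights and profile increments get renamed as \<open>idx\<close> coordinates. An
  injective renaming maps finite subfamilies to finite subfamilies, so the product formula carries
  over.\<close>

lemma (in prob_space) indep_vars_reindex:
  assumes ind: "indep_vars (\<lambda>_. N) X (h ` I)" and h: "inj_on h I"
  shows "indep_vars (\<lambda>_. N) (\<lambda>i. X (h i)) I"
proof -
  let ?F = "\<lambda>j. {X j -` A \<inter> space M | A. A \<in> sets N}"
  have rv: "\<forall>i\<in>h ` I. random_variable N (X i)" and iset: "indep_sets ?F (h ` I)"
    using ind by (auto simp: indep_vars_def2)
  have "indep_sets (\<lambda>i. ?F (h i)) I"
    unfolding indep_sets_def
  proof (intro conjI ballI allI impI)
    fix i assume "i \<in> I" then show "?F (h i) \<subseteq> events" using iset by (auto simp: indep_sets_def)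
  next
    fix J A assume J: "J \<subseteq> I" "J \<noteq> {}" "finite J" and A: "A \<in> Pi J (\<lambda>i. ?F (h i))"
    have inj: "inj_on h J" using h J(1) by (rule inj_on_subset)
    let ?B = "\<lambda>k. A (the_inv_into J h k)"
    have inv: "the_inv_into J h (h j) = j" if "j \<in> J" for j using inj that by (rule the_inv_into_f_f)
    have "?B \<in> Pi (h ` J) ?F" using A inv by (auto simp: Pi_def)
    moreover have "h ` J \<subseteq> h ` I" "h ` J \<noteq> {}" "finite (h ` J)" using J by auto
    ultimately have "prob (\<Inter>k\<in>h ` J. ?B k) = (\<Prod>k\<in>h ` J. prob (?B k))"
      using iset unfolding indep_sets_def by blast
    then show "prob (\<Inter>j\<in>J. A j) = (\<Prod>j\<in>J. prob (A j))"
      using inj inv by (simp add: prod.reindex)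
  qed
  then show ?thesis using rv by (simp add: indep_vars_def2)
qed

section \<open>Transfer to the model and tightness\<close>

lemma measurable_lp00:
  assumes "\<And>a b. a < i \<Longrightarrow> b < j \<Longrightarrow> Blk a b \<in> J"
  shows "(\<lambda>f. lp 0 0 f i j) \<in> borel_measurable (weights J)"
  using assms
proof (induction "0 :: real" "0 :: real" "\<lambda>_ :: idx. 0 :: real" i j rule: lp.induct)
  case (4 i j)
  then have "(\<lambda>f. f (Blk i j)) \<in> borel_measurable (weights J)" by (intro measurable_coordinate) auto
  with 4 show ?case by simp
qed simp_all

lemma lp_open_Suc: "lp_open f (Suc i) (Suc j) = max (lp 0 0 f i (Suc j)) (lp 0 0 f (Suc i) j)"
  by (simp add: lp_open_def)

text \<open>Removing the corner weight leaves only cells strictly below the antidiagonal of that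
  corner, exactly those for which the model has weights.\<close>

lemma lp_open_cong:
  assumes "0 < i" "0 < j" "\<And>a b. a + b + 2 < i + j \<Longrightarrow> f (Blk a b) = g (Blk a b)"
  shows "lp_open f i j = lp_open g i j"
proof -
  obtain i' j' where ij: "i = Suc i'" "j = Suc j'" using assms(1,2) by (metis gr0_implies_Suc)
  have "lp 0 0 f i' (Suc j') = lp 0 0 g i' (Suc j')" "lp 0 0 f (Suc i') j' = lp 0 0 g (Suc i') j'"
    using assms(3) ij by (auto intro!: lp00_cong)
  then show ?thesis by (simp add: ij lp_open_Suc)
qed

lemma measurable_lp_open:
  assumes "0 < i" "0 < j" "\<And>a b. a + b + 2 < i + j \<Longrightarrow> Blk a b \<in> J"
  shows "(\<lambda>f. lp_open f i j) \<in> borel_measurable (weights J)"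
proof -
  obtain i' j' where ij: "i = Suc i'" "j = Suc j'" using assms(1,2) by (metis gr0_implies_Suc)
  have "(\<lambda>f. lp 0 0 f i' (Suc j')) \<in> borel_measurable (weights J)"
    "(\<lambda>f. lp 0 0 f (Suc i') j') \<in> borel_measurable (weights J)"
    using assms(3) ij by (auto intro!: measurable_lp00)
  then show ?thesis unfolding ij lp_open_Suc by measurable
qed

lemma distr_weights_restrict:
  assumes "finite J" "I \<subseteq> J"
  shows "distr (weights J) (weights I) (\<lambda>f. restrict f I) = weights I"
proof -
  interpret product_prob_space wlaw J by (intro product_prob_spaceI prob_space_wlaw)
  show ?thesis using assms by (intro distr_PiM_restrict_finite) (auto intro: finite_subset)
qed

lemma exit_event_cong:
  assumes "0 < n" "\<And>i. 1 \<le> i \<Longrightarrow> i \<le> m \<Longrightarrow> f (Zet i) = g (Zet i)" "\<And>a b. a + b + 2 < m + n \<Longrightarrow> f (Blk a b) = g (Blk a b)"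
  shows "exit_event e m n K f \<longleftrightarrow> exit_event e m n K g"
proof -
  have "lp_open f (m - k) (n + k) = lp_open g (m - k) (n + k)" if "k < m" for k
    using assms(1,3) that by (intro lp_open_cong) auto
  moreover have "(\<Sum>i=1..k. f (Zet i)) = (\<Sum>i=1..k. g (Zet i))" if "k < m" for k
    using assms(2) that by (intro sum.cong) auto
  moreover have "lp_open f m n = lp_open g m n" if "0 < m"
    using assms(1,3) that by (intro lp_open_cong) auto
  ultimately show ?thesis unfolding exit_event_def by (cases "m = 0") (auto intro!: bex_cong)
qed

lemma measurable_exit_event:
  assumes "0 < m" "0 < n" "Zet ` {1..m} \<subseteq> J" "\<And>a b. a + b + 2 < m + n \<Longrightarrow> Blk a b \<in> J"
  shows "{f \<in> space (weights J). exit_event e m n K f} \<in> sets (weights J)"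
  unfolding exit_event_def
proof (rule sets.sets_Collect_finite_Ex)
  fix k assume k: "k \<in> {K..<m}"
  have "(\<lambda>f. \<Sum>i=1..k. f (Zet i)) \<in> borel_measurable (weights J)"
    using assms(3) k by (intro borel_measurable_sum measurable_coordinate) auto
  moreover have "(\<lambda>f. lp_open f m n) \<in> borel_measurable (weights J)"
    using assms by (intro measurable_lp_open) auto
  moreover have "(\<lambda>f. lp_open f (m - k) (n + k)) \<in> borel_measurable (weights J)"
    using assms k by (intro measurable_lp_open) auto
  ultimately show "{f \<in> space (weights J). lp_open f m n \<le> e * (\<Sum>i=1..k. f (Zet i)) + lp_open f (m - k) (n + k)} \<in> sets (weights J)"
    by measurable
qed simp

text \<open>The hypotheses of the theorem as one predicate, so that they can be invoked again for
  the reflected weights.\<close>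

definition lpp_model :: "'s measure \<Rightarrow> (pt \<Rightarrow> 's \<Rightarrow> real) \<Rightarrow> (nat \<Rightarrow> 's \<Rightarrow> real) \<Rightarrow> bool" where
  "lpp_model M \<omega> \<zeta> \<longleftrightarrow> prob_space M \<and>
     prob_space.indep_vars M (\<lambda>_. borel) (\<lambda>i. case i of Inl p \<Rightarrow> \<omega> p | Inr k \<Rightarrow> \<zeta> k)
       (Inl ` {p. fst p + snd p > 0} \<union> Inr ` {1..}) \<and>
     (\<forall>p. fst p + snd p > 0 \<longrightarrow> distributed M lborel (\<omega> p) (exponential_density 1)) \<and>
     (\<forall>i\<ge>1. \<zeta> i \<in> borel_measurable M \<and> distr M borel (\<zeta> i) = X_law (1/2))"

lemma lpp_modelD:
  assumes "lpp_model M \<omega> \<zeta>"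
  shows "prob_space M"
    and "prob_space.indep_vars M (\<lambda>_. borel) (\<lambda>i. case i of Inl p \<Rightarrow> \<omega> p | Inr k \<Rightarrow> \<zeta> k)
       (Inl ` {p. fst p + snd p > 0} \<union> Inr ` {1..})"
    and "fst p + snd p > 0 \<Longrightarrow> distributed M lborel (\<omega> p) (exponential_density 1)"
    and "1 \<le> i \<Longrightarrow> \<zeta> i \<in> borel_measurable M" and "1 \<le> i \<Longrightarrow> distr M borel (\<zeta> i) = X_law (1/2)"
  using assms unfolding lpp_model_def by blast+

lemma lpp_model_swap:
  assumes "lpp_model M \<omega> \<zeta>"
  shows "lpp_model M (\<lambda>p. \<omega> (prod.swap p)) \<zeta>"
proof -
  interpret prob_space M by (rule lpp_modelD(1)[OF assms])
  define h :: "pt + nat \<Rightarrow> pt + nat" where "h = map_sum prod.swap id"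
  let ?S = "Inl ` {p :: pt. fst p + snd p > 0} \<union> Inr ` {1::nat..}"
  let ?X = "\<lambda>i. case i of Inl p \<Rightarrow> \<omega> p | Inr k \<Rightarrow> \<zeta> k"
  have swap: "prod.swap ` {p :: pt. fst p + snd p > 0} = {p. fst p + snd p > 0}"
  proof (intro set_eqI iffI)
    fix p :: pt assume "p \<in> {p. fst p + snd p > 0}"
    then show "p \<in> prod.swap ` {p. fst p + snd p > 0}" by (intro image_eqI[of _ _ "prod.swap p"]) auto
  qed auto
  have "h ` ?S = Inl ` prod.swap ` {p :: pt. fst p + snd p > 0} \<union> Inr ` {1::nat..}"
    by (simp add: h_def image_Un image_image)
  then have hS: "h ` ?S = ?S" unfolding swap .
  have inj: "inj_on h ?S" by (auto simp: inj_on_def h_def)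
  have "indep_vars (\<lambda>_. borel) ?X (h ` ?S)" unfolding hS by (rule lpp_modelD(2)[OF assms])
  from indep_vars_reindex[OF this inj] have "indep_vars (\<lambda>_. borel) (\<lambda>i. ?X (h i)) ?S" .
  moreover have "(\<lambda>i. ?X (h i)) = (\<lambda>i. case i of Inl p \<Rightarrow> \<omega> (prod.swap p) | Inr k \<Rightarrow> \<zeta> k)"
    by (rule ext) (simp add: h_def split: sum.split)
  ultimately have ind: "indep_vars (\<lambda>_. borel) (\<lambda>i. case i of Inl p \<Rightarrow> \<omega> (prod.swap p) | Inr k \<Rightarrow> \<zeta> k) ?S"
    by simp
  show ?thesis unfolding lpp_model_def
    by (intro conjI allI impI prob_space_axioms ind lpp_modelD(3-5)[OF assms]) simp_all
qed

text \<open>The path event is only enclosed in a measurable set \<open>B\<close>, so its own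
  measurability never has to be shown. \<open>B\<close> is the preimage of the exit event under the
  coordinates read off from the model, enlarged by a null set.\<close>

lemma exit_transfer:
  fixes n :: nat and D :: int
  assumes model: "lpp_model M \<omega> \<zeta>" and D: "\<bar>D\<bar> \<le> int n"
    and J: "finite J" "rect_coords (2 * n + 2) (2 * n + 2) \<subseteq> J" "Zet ` {1..nat (int n + 1 + D)} \<subseteq> J"
  shows "\<exists>B\<in>sets M. measure M B \<le> measure (weights J) {f \<in> space (weights J). exit_event e (nat (int n + 1 + D)) (nat (int n + 1 - D)) K f} \<and>
    {s \<in> space M. \<exists>k. K \<le> k \<and> int k \<le> int n + D \<and> Lk (\<lambda>p. \<omega> p s) 0 (int n + D, int n - D)
        \<le> e * (\<Sum>i=1..k. \<zeta> i s) + Lk (\<lambda>p. \<omega> p s) (int k) (int n + D, int n - D)} \<subseteq> B"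
proof -
  interpret prob_space M by (rule lpp_modelD(1)[OF model])
  define x1 x2 where "x1 = int n + D" and "x2 = int n - D"
  define m n0 where "m = nat (int n + 1 + D)" and "n0 = nat (int n + 1 - D)"
  have mn: "0 < m" "0 < n0" "m + n0 = 2 * n + 2" "int m = x1 + 1" "int n0 = x2 + 1"
    using D by (auto simp: m_def n0_def x1_def x2_def)
  \<comment> \<open>The coordinates of the target sum to \<open>2 * n\<close>, so these are the
    cells whose lattice point has positive coordinate sum. \<open>I\<close> is smaller than
    \<open>J\<close>: auxiliary boundary weights and the remaining cells have no counterpart in the
    model, and the exit event does not depend on them.\<close>
  define A where "A = {(i, j). i + j < 2 * n}"
  define I where "I = Zet ` {1..m} \<union> (\<lambda>(i, j). Blk i j) ` A"
  have sub: "A \<subseteq> {..<2*n} \<times> {..<2*n}" by (auto simp: A_def)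
  have fin: "finite A" by (rule finite_subset[OF sub]) simp
  have I: "finite I" "I \<noteq> {}" using fin mn(1) by (auto simp: I_def)
  have IJ: "I \<subseteq> J"
    using J(3) subsetD[OF J(2)] by (auto simp: I_def A_def m_def)
  have Blk_I: "Blk a b \<in> I \<longleftrightarrow> a + b < 2 * n" for a b by (auto simp: I_def A_def)
  have Zet_I: "Zet i \<in> I \<longleftrightarrow> 1 \<le> i \<and> i \<le> m" for i by (auto simp: I_def)
  let ?X = "\<lambda>i. case i of Inl p \<Rightarrow> \<omega> p | Inr k \<Rightarrow> \<zeta> k"
  \<comment> \<open>The value \<open>Inr 0\<close> for boundary coordinates is a dummy;
    \<open>I\<close> contains none of them, and the profile increments start at 1.\<close>
  define h :: "idx \<Rightarrow> pt + nat" where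
    "h k = (case k of Blk i j \<Rightarrow> Inl (x1 - int i, x2 - int j) | Zet i \<Rightarrow> Inr i | _ \<Rightarrow> Inr 0)" for k
  have pos: "fst (x1 - int i, x2 - int j) + snd (x1 - int i, x2 - int j) > 0" if "i + j < 2 * n" for i j
    using that by (simp add: x1_def x2_def)
  have inj: "inj_on h I" by (auto simp: inj_on_def I_def h_def)
  have "h ` I \<subseteq> Inl ` {p. fst p + snd p > 0} \<union> Inr ` {1..}"
    using pos by (auto simp: I_def h_def A_def)
  moreover have "indep_vars (\<lambda>_. borel) ?X (Inl ` {p. fst p + snd p > 0} \<union> Inr ` {1..})"
    by (rule lpp_modelD(2)[OF model])
  ultimately have "indep_vars (\<lambda>_. borel) ?X (h ` I)" by (rule indep_vars_subset[rotated])
  from indep_vars_reindex[OF this inj] have ind: "indep_vars (\<lambda>_. borel) (\<lambda>i. ?X (h i)) I" .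
  define Y where "Y = (\<lambda>i. ?X (h i))"
  have Y_simps: "Y (Blk a b) = \<omega> (x1 - int a, x2 - int b)" "Y (Zet k) = \<zeta> k" for a b k
    by (simp_all add: Y_def h_def)
  note ind = ind[folded Y_def]
  have law: "Y i \<in> borel_measurable M \<and> distr M borel (Y i) = wlaw i" if "i \<in> I" for i
  proof (cases i)
    case (Blk a b)
    then have d: "distributed M lborel (\<omega> (x1 - int a, x2 - int b)) (exponential_density 1)"
      using that pos[of a b] Blk_I by (intro lpp_modelD(3)[OF model]) simp
    have "distr M borel (\<omega> (x1 - int a, x2 - int b)) = distr M lborel (\<omega> (x1 - int a, x2 - int b))"
      by (intro distr_cong) auto
    also have "\<dots> = Exp1" unfolding Exp1_def by (rule distributed_distr_eq_density[OF d])
    finally show ?thesis using Blk distributed_measurable[OF d] by (simp add: Y_simps)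
  next
    case (Zet k)
    then have "1 \<le> k" using that by (simp add: Zet_I)
    then show ?thesis using Zet lpp_modelD(4,5)[OF model] by (simp add: Y_simps)
  qed (use that in \<open>auto simp: I_def\<close>)
  define F where "F s = (\<lambda>i\<in>I. Y i s)" for s
  have F_eq: "F = (\<lambda>s. \<lambda>i\<in>I. Y i s)" by (rule ext) (simp only: F_def)
  have rv: "Y i \<in> borel_measurable M" if "i \<in> I" for i using law[OF that] by (rule conjunct1)
  have sets: "sets (weights I) = sets (PiM I (\<lambda>_. borel))" by (intro sets_PiM_cong) simp_all
  have "distr M (weights I) F = distr M (PiM I (\<lambda>_. borel)) F" by (intro distr_cong sets refl)
  also have "\<dots> = (\<Pi>\<^sub>M i\<in>I. distr M borel (Y i))"
  proof -
    have "indep_vars (\<lambda>_. borel) Y I \<longleftrightarrow> distr M (PiM I (\<lambda>_. borel)) (\<lambda>s. \<lambda>i\<in>I. Y i s) = (\<Pi>\<^sub>M i\<in>I. distr M borel (Y i))"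
      by (rule indep_vars_iff_distr_eq_PiM'[of I Y "\<lambda>_. borel", OF I(2) rv])
    with ind show ?thesis unfolding F_eq by (rule iffD1[rotated])
  qed
  also have "\<dots> = weights I"
  proof (rule PiM_cong[OF refl])
    fix i assume "i \<in> I"
    then show "distr M borel (Y i) = wlaw i" using law by blast
  qed
  finally have dF: "distr M (weights I) F = weights I" .
  have F_meas: "F \<in> measurable M (weights I)"
    unfolding F_eq
  proof (rule measurable_restrict)
    fix i assume "i \<in> I"
    then show "Y i \<in> measurable M (wlaw i)" using rv[of i] by (simp cong: measurable_cong_sets)
  qed
  let ?E = "\<lambda>J. {f \<in> space (weights J). exit_event e m n0 K f}"
  have E_meas: "?E I \<in> sets (weights I)"
  proof (rule measurable_exit_event[OF mn(1,2)])
    show "Zet ` {1..m} \<subseteq> I" by (simp add: I_def)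
    show "Blk a b \<in> I" if "a + b + 2 < m + n0" for a b using that mn(3) by (simp add: Blk_I)
  qed
  have restr: "(\<lambda>f. restrict f I) \<in> measurable (weights J) (weights I)"
    using IJ by (intro measurable_restrict_subset)
  have "measure (weights I) (?E I) = measure (weights J) ((\<lambda>f. restrict f I) -` ?E I \<inter> space (weights J))"
    by (rule measure_distr[OF restr E_meas, unfolded distr_weights_restrict[OF J(1) IJ]])
  also have "(\<lambda>f. restrict f I) -` ?E I \<inter> space (weights J) = ?E J"
  proof (rule set_eqI)
    fix f
    have "exit_event e m n0 K (restrict f I) \<longleftrightarrow> exit_event e m n0 K f"
    proof (rule exit_event_cong[OF mn(2)])
      show "restrict f I (Zet i) = f (Zet i)" if "1 \<le> i" "i \<le> m" for i
        using that by (simp add: Zet_I)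
      show "restrict f I (Blk a b) = f (Blk a b)" if "a + b + 2 < m + n0" for a b
        using that mn(3) by (simp add: Blk_I)
    qed
    moreover have "f \<in> space (weights J) \<Longrightarrow> restrict f I \<in> space (weights I)"
      by (rule measurable_space[OF restr])
    ultimately show "f \<in> (\<lambda>f. restrict f I) -` ?E I \<inter> space (weights J) \<longleftrightarrow> f \<in> ?E J"
      unfolding vimage_def Int_iff mem_Collect_eq by (elim conjE | intro iffI conjI | simp)+
  qed
  finally have E_eq: "measure (weights I) (?E I) = measure (weights J) (?E J)" .
  define B1 where "B1 = F -` ?E I \<inter> space M"
  have B1: "B1 \<in> sets M" "measure M B1 = measure (weights J) (?E J)"
    unfolding B1_def E_eq[symmetric]
    using measurable_sets[OF F_meas E_meas] measure_distr[OF F_meas E_meas, unfolded dF] by (simp_all only:)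
  have "AE s in M. \<forall>p\<in>A. 0 \<le> \<omega> (x1 - int (fst p), x2 - int (snd p)) s"
  proof (subst AE_finite_all[OF fin], intro ballI)
    fix p assume "p \<in> A"
    then have i: "Blk (fst p) (snd p) \<in> I" by (auto simp: I_def split_beta)
    have "AE y in distr M borel (Y (Blk (fst p) (snd p))). 0 \<le> y"
    proof -
      have "distr M borel (Y (Blk (fst p) (snd p))) = Exp1" using law[OF i] by simp
      then show ?thesis using AE_Exp1_nonneg by (rule ssubst)
    qed
    from AE_distrD[OF conjunct1[OF law[OF i]] this] show "AE s in M. 0 \<le> \<omega> (x1 - int (fst p), x2 - int (snd p)) s"
      by (simp add: Y_simps)
  qed
  \<comment> \<open>Outside \<open>N\<close> the weights in use are nonnegative, and the absolute
    values inside \<open>lp\<close> change nothing.\<close>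
  then obtain N where N: "N \<in> sets M" "emeasure M N = 0"
    "{s \<in> space M. \<not> (\<forall>p\<in>A. 0 \<le> \<omega> (x1 - int (fst p), x2 - int (snd p)) s)} \<subseteq> N" by (rule AE_E)
  have "measure M (B1 \<union> N) \<le> measure M B1 + measure M N" using B1 N by (intro measure_Un_le)
  also have "measure M N = 0" using N(2) by (simp add: measure_def)
  finally have le: "measure M (B1 \<union> N) \<le> measure (weights J) (?E J)" using B1 by simp
  have subset: "{s \<in> space M. \<exists>k. K \<le> k \<and> int k \<le> int n + D \<and> Lk (\<lambda>p. \<omega> p s) 0 (x1, x2)
        \<le> e * (\<Sum>i=1..k. \<zeta> i s) + Lk (\<lambda>p. \<omega> p s) (int k) (x1, x2)} \<subseteq> B1 \<union> N"
  proof (rule subsetI, rule ccontr)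
    fix s assume s: "s \<in> {s \<in> space M. \<exists>k. K \<le> k \<and> int k \<le> int n + D \<and> Lk (\<lambda>p. \<omega> p s) 0 (x1, x2)
        \<le> e * (\<Sum>i=1..k. \<zeta> i s) + Lk (\<lambda>p. \<omega> p s) (int k) (x1, x2)}" and nB: "s \<notin> B1 \<union> N"
    then have sM: "s \<in> space M" by simp
    from s obtain k where k: "K \<le> k" "int k \<le> x1" "Lk (\<lambda>p. \<omega> p s) 0 (x1, x2)
        \<le> e * (\<Sum>i=1..k. \<zeta> i s) + Lk (\<lambda>p. \<omega> p s) (int k) (x1, x2)"
      unfolding x1_def[symmetric] by blast
    have nonneg: "0 \<le> \<omega> (x1 - int a, x2 - int b) s" if "a + b < 2 * n" for a b
    proof -
      have "(a, b) \<in> A" using that by (simp add: A_def)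
      moreover have "\<forall>p\<in>A. 0 \<le> \<omega> (x1 - int (fst p), x2 - int (snd p)) s" using nB N(3) sM by blast
      ultimately have "0 \<le> \<omega> (x1 - int (fst (a, b)), x2 - int (snd (a, b))) s" by (rule bspec[rotated])
      then show ?thesis by simp
    qed
    have FB: "F s (Blk a b) = \<omega> (x1 - int a, x2 - int b) s" if "a + b < 2 * n" for a b
      using that by (simp add: F_def Blk_I Y_simps)
    have FZ: "F s (Zet i) = \<zeta> i s" if "1 \<le> i" "i \<le> m" for i
      using that by (simp add: F_def Zet_I Y_simps)
    have L: "Lk (\<lambda>p. \<omega> p s) (int l) (x1, x2) = lp_open (F s) (m - l) (n0 + l)" if "int l \<le> x1" for l
    proof -
      have l: "l < m" using that mn by linarith
      define i j where "i = m - 1 - l" and "j = n0 + l - 1"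
      have ij: "Suc i = m - l" "Suc j = n0 + l" "x1 - int i = int l" "x2 - int j = - int l" "i + j = 2 * n"
        using l mn unfolding i_def j_def by linarith+
      have "LPP (\<lambda>p. \<omega> p s) (x1 - int i, x2 - int j) (x1, x2) = lp_open (F s) (Suc i) (Suc j)"
      proof -
        have cond: "F s (Blk a b) = \<omega> (x1 - int a, x2 - int b) s \<and> 0 \<le> F s (Blk a b)"
          if ab: "a \<le> i" "b \<le> j" "(a, b) \<noteq> (i, j)" for a b
        proof -
          have "a < i \<or> b < j" using ab by auto
          then have "a + b < 2 * n" using ab(1,2) ij(5) by linarith
          then show ?thesis using FB nonneg by simp
        qed
        show ?thesis
          by (rule LPP_eq_lp_open[where w="\<lambda>p. \<omega> p s" and f="F s", THEN conjunct2, THEN conjunct2]) (rule cond)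
      qed
      then show ?thesis unfolding Lk_def ij .
    qed
    have km: "k < m" using k(2) mn by linarith
    have "lp_open (F s) m n0 \<le> e * (\<Sum>i=1..k. F s (Zet i)) + lp_open (F s) (m - k) (n0 + k)"
    proof -
      have "(\<Sum>i=1..k. F s (Zet i)) = (\<Sum>i=1..k. \<zeta> i s)" using FZ km by (intro sum.cong) auto
      moreover have "int 0 \<le> x1" using mn by linarith
      ultimately show ?thesis using k(3) L[OF k(2)] L[of 0] by simp
    qed
    then have "exit_event e m n0 K (F s)" unfolding exit_event_def using k(1) km by (intro bexI[of _ k]) auto
    then have "s \<in> B1" using sM measurable_space[OF F_meas sM] by (simp add: B1_def)
    then show False using nB by simp
  qed
  show ?thesis
    by (rule bexI[of _ "B1 \<union> N"], rule conjI[OF le[unfolded m_def n0_def] subset[unfolded x1_def x2_def]])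
       (rule sets.Un[OF B1(1) N(1)])
qed

lemma exp_minus_le:
  fixes x \<delta> :: real
  assumes "0 < \<delta>" "\<bar>ln \<delta>\<bar> \<le> x"
  shows "exp (- x) \<le> \<delta>"
proof -
  have "exp (- x) \<le> exp (ln \<delta>)"
    unfolding exp_le_cancel_iff using assms(2) by linarith
  then show ?thesis using assms(1) by simp
qed

text \<open>Uniformity in \<open>D\<close> lets one statement serve the target displaced by
  \<open>D\<close> and its mirror image displaced by \<open>- D\<close>. The summand 1 is slack for
  rounding.\<close>

lemma right_exit_tight:
  assumes model: "lpp_model M \<omega> \<zeta>" and C: "0 \<le> C" and \<epsilon>: "0 < \<epsilon>" and e: "e = 0 \<or> e = 1"
  obtains r0 where "\<And>r. r0 \<le> r \<Longrightarrow> \<forall>\<^sub>F n in sequentially. \<forall>D. \<bar>real_of_int D\<bar> \<le> C * real n powr (2/3) + 1 \<longrightarrow>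
     \<bar>D\<bar> \<le> int n \<and> (\<exists>B\<in>sets M. measure M B \<le> \<epsilon> \<and>
      {s \<in> space M. \<exists>k. r * real n powr (2/3) \<le> real k \<and> int k \<le> int n + D \<and> Lk (\<lambda>p. \<omega> p s) 0 (int n + D, int n - D)
        \<le> e * (\<Sum>i=1..k. \<zeta> i s) + Lk (\<lambda>p. \<omega> p s) (int k) (int n + D, int n - D)} \<subseteq> B)"
proof -
  \<comment> \<open>Two of the five error terms carry a factor 2 in front of the exponential, hence
    half of \<open>\<epsilon> / 5\<close>.\<close>
  define \<delta> where "\<delta> = \<epsilon> / 10"
  define \<kappa> where "\<kappa> = \<bar>ln \<delta>\<bar>"
  \<comment> \<open>The constants are fixed in order: \<open>A\<close> makes both comparisons
    reliable, \<open>y\<close> then outweighs the growth \<open>24 * A * (A + 1)^2\<close> on the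
    way to \<open>k0\<close>, and \<open>r0\<close> finally lets the negative drift beat all terms
    in \<open>A\<close> and \<open>y\<close>.\<close>
  define A where "A = C + 2 + 2^24 * \<kappa>"
  define y where "y = 24 * A * (A + 1)^2 + \<kappa>"
  define r0 where "r0 = 2 * A + 256 * (\<kappa> + A * (y + 1) / 8 + A^3 / 4)"
  have \<delta>: "0 < \<delta>" using \<epsilon> by (simp add: \<delta>_def)
  have \<kappa>: "0 \<le> \<kappa>" by (simp add: \<kappa>_def)
  have A: "C + 2 \<le> A" "2 \<le> A" "2^24 * \<kappa> \<le> A" using C \<kappa> by (simp_all add: A_def)
  have A_pow: "A \<le> A^3" "1 \<le> A^2" using A(2) self_le_power[of A 3] one_le_power[of A 2] by simp_all
  have y: "0 \<le> y" using A \<kappa> by (simp add: y_def)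
  show thesis
  proof (rule that[of r0])
    fix r assume r: "r0 \<le> r"
    have r2: "2 * A \<le> r" "256 * (\<kappa> + A * (y + 1) / 8 + A^3 / 4) \<le> r - 2 * A"
    proof -
      have "0 \<le> 256 * (\<kappa> + A * (y + 1) / 8 + A^3 / 4)" using A y \<kappa> by simp
      then show "2 * A \<le> r" "256 * (\<kappa> + A * (y + 1) / 8 + A^3 / 4) \<le> r - 2 * A"
        using r by (simp_all add: r0_def)
    qed
    have eps1: "2 * exp (- (40 * A^3 / 2^24)) \<le> \<epsilon> / 5"
    proof -
      have "\<kappa> \<le> 40 * A^3 / 2^24" using A A_pow \<kappa> by simp
      from exp_minus_le[OF \<delta> this[unfolded \<kappa>_def]] show ?thesis by (simp add: \<delta>_def)
    qed
    have eps3: "exp (- y + 24 * A * (A + 1)^2) \<le> \<epsilon> / 5"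
    proof -
      have "- y + 24 * A * (A + 1)^2 = - \<kappa>" by (simp add: y_def)
      then show ?thesis using exp_minus_le[OF \<delta>, of \<kappa>] \<epsilon> by (simp add: \<kappa>_def \<delta>_def)
    qed
    have eps4: "exp (A * (y + 1) / 8 + A^3 / 4 - A^2 * (r - 2 * A) / 256) \<le> \<epsilon> / 5"
    proof -
      have "1 * (r - 2 * A) \<le> A^2 * (r - 2 * A)" using r2 A_pow by (intro mult_right_mono) auto
      then have "\<kappa> \<le> - (A * (y + 1) / 8 + A^3 / 4 - A^2 * (r - 2 * A) / 256)" using r2(2) by simp
      then show ?thesis
        using exp_minus_le[OF \<delta>, of "- (A * (y + 1) / 8 + A^3 / 4 - A^2 * (r - 2 * A) / 256)"] \<epsilon>
        by (simp add: \<kappa>_def \<delta>_def)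
    qed
    \<comment> \<open>From \<open>n = L^3\<close> on, \<open>\<sigma>\<close> is large enough for
      the size conditions and for the tail of the single weight at the starting point.\<close>
    define L where "L = 32 * A + 2 * \<kappa>"
    have L: "0 < L" "32 * A \<le> L" "2 * \<kappa> \<le> L" using A \<kappa> by (simp_all add: L_def)
    show "\<forall>\<^sub>F n in sequentially. \<forall>D. \<bar>real_of_int D\<bar> \<le> C * real n powr (2/3) + 1 \<longrightarrow>
     \<bar>D\<bar> \<le> int n \<and> (\<exists>B\<in>sets M. measure M B \<le> \<epsilon> \<and>
      {s \<in> space M. \<exists>k. r * real n powr (2/3) \<le> real k \<and> int k \<le> int n + D \<and> Lk (\<lambda>p. \<omega> p s) 0 (int n + D, int n - D)
        \<le> e * (\<Sum>i=1..k. \<zeta> i s) + Lk (\<lambda>p. \<omega> p s) (int k) (int n + D, int n - D)} \<subseteq> B)"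
      using eventually_ge_at_top[of "nat \<lceil>L^3\<rceil>"]
    proof (rule eventually_mono, intro allI impI)
      fix n :: nat and D :: int
      assume n: "nat \<lceil>L^3\<rceil> \<le> n" and D: "\<bar>real_of_int D\<bar> \<le> C * real n powr (2/3) + 1"
      have nL: "L^3 \<le> real n" using n by linarith
      have "0 < L^3" using L by simp
      then have npos: "0 < real n" using nL by linarith
      define \<sigma> where "\<sigma> = real n powr (1/3)"
      have \<sigma>3: "real n = \<sigma>^3" using npos by (simp add: \<sigma>_def powr_power)
      have \<sigma>2: "real n powr (2/3) = \<sigma>^2" using npos by (simp add: \<sigma>_def powr_power)
      have "(L powr 3) powr (1/3) = L" using L unfolding powr_powr by simp
      then have "L = (L^3) powr (1/3)" using L by simp
      also have "\<dots> \<le> \<sigma>" unfolding \<sigma>_def using nL L by (intro powr_mono2) auto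
      finally have \<sigma>L: "L \<le> \<sigma>" .
      then have \<sigma>: "1 \<le> \<sigma>" "32 * A \<le> \<sigma>" "2 * \<kappa> \<le> \<sigma>" using L A by linarith+
      have D': "\<bar>real_of_int D\<bar> \<le> C * \<sigma>^2 + 1" using D by (simp add: \<sigma>2)
      have Dn: "\<bar>D\<bar> \<le> int n"
      proof -
        have "1 \<le> \<sigma>^2" using \<sigma>(1) by simp
        then have "C * \<sigma>^2 + 1 \<le> (C + 1) * \<sigma>^2" by (simp add: algebra_simps)
        also have "\<dots> \<le> \<sigma> * \<sigma>^2" using A \<sigma> by (intro mult_right_mono) auto
        also have "\<dots> = real n" by (simp add: \<sigma>3 power2_eq_square power3_eq_cube)
        finally show ?thesis using D' by linarith
      qed
      have eps2: "2 * exp (- \<sigma> / 2) \<le> \<epsilon> / 5"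
        using exp_minus_le[OF \<delta>, of "\<sigma> / 2"] \<sigma>(3) by (simp add: \<kappa>_def \<delta>_def)
      define K where "K = nat \<lceil>r * \<sigma>^2\<rceil>"
      have K: "r * \<sigma>^2 \<le> K" unfolding K_def by linarith
      define J where "J = rect_coords (2 * n + 2) (2 * n + 2) \<union> Zet ` {1..nat (int n + 1 + D)}"
      have J: "finite J" "rect_coords (2 * n + 2) (2 * n + 2) \<subseteq> J" "Zet ` {1..nat (int n + 1 + D)} \<subseteq> J"
        by (auto simp: J_def)
      define P where "P s k \<longleftrightarrow> int k \<le> int n + D \<and> Lk (\<lambda>p. \<omega> p s) 0 (int n + D, int n - D)
        \<le> e * (\<Sum>i=1..k. \<zeta> i s) + Lk (\<lambda>p. \<omega> p s) (int k) (int n + D, int n - D)" for s k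
      obtain B where B: "B \<in> sets M"
        "measure M B \<le> measure (weights J) {f \<in> space (weights J). exit_event e (nat (int n + 1 + D)) (nat (int n + 1 - D)) K f}"
        "{s \<in> space M. \<exists>k. K \<le> k \<and> P s k} \<subseteq> B"
        by (rule bexE[OF exit_transfer[OF model Dn J, of e K, folded P_def]], elim conjE, rule that)
      note B(2)
      also have "measure (weights J) {f \<in> space (weights J). exit_event e (nat (int n + 1 + D)) (nat (int n + 1 - D)) K f} \<le> \<epsilon>"
        by (rule exit_event_le_epsilon[OF \<sigma>3 \<sigma>(1,2) C A(1) D' eps1 eps2 eps3 eps4 y r2(1) K e J])
      finally have "measure M B \<le> \<epsilon>" .
      moreover have "{s \<in> space M. \<exists>k. r * real n powr (2/3) \<le> real k \<and> P s k} \<subseteq> B"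
      proof -
        have "K \<le> k" if "r * real n powr (2/3) \<le> real k" for k
          using that unfolding \<sigma>2 K_def by linarith
        then show ?thesis using B(3) by blast
      qed
      ultimately show "\<bar>D\<bar> \<le> int n \<and> (\<exists>B\<in>sets M. measure M B \<le> \<epsilon> \<and>
      {s \<in> space M. \<exists>k. r * real n powr (2/3) \<le> real k \<and> int k \<le> int n + D \<and> Lk (\<lambda>p. \<omega> p s) 0 (int n + D, int n - D)
        \<le> e * (\<Sum>i=1..k. \<zeta> i s) + Lk (\<lambda>p. \<omega> p s) (int k) (int n + D, int n - D)} \<subseteq> B)"
        unfolding P_def[symmetric] by (intro conjI Dn bexI[OF _ B(1)])
    qed
  qed
qed

lemma tightness_eqI:
  assumes "\<And>\<epsilon>. 0 < \<epsilon> \<Longrightarrow> \<exists>r0. \<forall>r\<ge>r0. \<forall>\<^sub>F n in sequentially. measure M {s \<in> space M.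
        real_of_int \<bar>exit_pt (\<lambda>p. \<omega> p s) (b s) (brk (C * real n powr (2/3)) n)\<bar> \<ge> r * real n powr (2/3)} \<le> \<epsilon>"
  shows "tightness M \<omega> b C = 0"
proof (rule antisym)
  show "tightness M \<omega> b C \<le> 0"
  proof (rule ereal_le_epsilon2)
    fix \<epsilon> :: real assume "0 < \<epsilon>"
    from assms[OF this] obtain r0 where r0: "\<And>r. r0 \<le> r \<Longrightarrow> \<forall>\<^sub>F n in sequentially. measure M {s \<in> space M.
        real_of_int \<bar>exit_pt (\<lambda>p. \<omega> p s) (b s) (brk (C * real n powr (2/3)) n)\<bar> \<ge> r * real n powr (2/3)} \<le> \<epsilon>"
      by blast
    have "tightness M \<omega> b C \<le> ereal \<epsilon>"
      unfolding tightness_def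
    proof (rule Limsup_bounded, rule eventually_mono[OF eventually_ge_at_top[of r0]])
      fix r assume "r0 \<le> r"
      from r0[OF this] show "Limsup sequentially (\<lambda>n. ereal (measure M {s \<in> space M.
        real_of_int \<bar>exit_pt (\<lambda>p. \<omega> p s) (b s) (brk (C * real n powr (2/3)) n)\<bar> \<ge> r * real n powr (2/3)})) \<le> ereal \<epsilon>"
        by (intro Limsup_bounded) simp
    qed
    then show "tightness M \<omega> b C \<le> 0 + ereal \<epsilon>" by simp
  qed
  show "0 \<le> tightness M \<omega> b C"
    unfolding tightness_def by (intro le_Limsup always_eventually allI) auto
qed

text \<open>What the five profiles share: they vanish at 0, are nonpositive on the left and at most
  \<open>e\<close> times the walk on the right. On the right the domination puts an exit into the
  event already bounded; on the left, reflection and \<open>e = 0\<close> give the same.\<close>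

lemma profile_tight:
  assumes model: "lpp_model M \<omega> \<zeta>" and C: "0 \<le> C" and e: "e = 0 \<or> e = 1"
    and b0: "\<And>s. b s 0 = 0" and neg: "\<And>s k. k < 0 \<Longrightarrow> b s k \<le> 0"
    and pos: "\<And>s k. 0 \<le> k \<Longrightarrow> b s k \<le> ereal (e * (\<Sum>i=1..nat k. \<zeta> i s))"
  shows "tightness M \<omega> b C = 0"
proof (rule tightness_eqI)
  fix \<epsilon> :: real assume "0 < \<epsilon>"
  then have \<epsilon>: "0 < \<epsilon> / 2" by simp
  interpret prob_space M by (rule lpp_modelD(1)[OF model])
  let ?\<omega>' = "\<lambda>p. \<omega> (prod.swap p)"
  obtain r1 where r1: "\<And>r. r1 \<le> r \<Longrightarrow> \<forall>\<^sub>F n in sequentially. \<forall>D. \<bar>real_of_int D\<bar> \<le> C * real n powr (2/3) + 1 \<longrightarrow>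
     \<bar>D\<bar> \<le> int n \<and> (\<exists>B\<in>sets M. measure M B \<le> \<epsilon> / 2 \<and>
      {s \<in> space M. \<exists>k. r * real n powr (2/3) \<le> real k \<and> int k \<le> int n + D \<and> Lk (\<lambda>p. \<omega> p s) 0 (int n + D, int n - D)
        \<le> e * (\<Sum>i=1..k. \<zeta> i s) + Lk (\<lambda>p. \<omega> p s) (int k) (int n + D, int n - D)} \<subseteq> B)"
    by (rule right_exit_tight[OF model C \<epsilon> e], rule that)
  obtain r2 where r2: "\<And>r. r2 \<le> r \<Longrightarrow> \<forall>\<^sub>F n in sequentially. \<forall>D. \<bar>real_of_int D\<bar> \<le> C * real n powr (2/3) + 1 \<longrightarrow>
     \<bar>D\<bar> \<le> int n \<and> (\<exists>B\<in>sets M. measure M B \<le> \<epsilon> / 2 \<and>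
      {s \<in> space M. \<exists>k. r * real n powr (2/3) \<le> real k \<and> int k \<le> int n + D \<and> Lk (\<lambda>p. ?\<omega>' p s) 0 (int n + D, int n - D)
        \<le> 0 * (\<Sum>i=1..k. \<zeta> i s) + Lk (\<lambda>p. ?\<omega>' p s) (int k) (int n + D, int n - D)} \<subseteq> B)"
    by (rule right_exit_tight[OF lpp_model_swap[OF model] C \<epsilon> disjI1[OF refl]], rule that)
  show "\<exists>r0. \<forall>r\<ge>r0. \<forall>\<^sub>F n in sequentially. measure M {s \<in> space M.
        real_of_int \<bar>exit_pt (\<lambda>p. \<omega> p s) (b s) (brk (C * real n powr (2/3)) n)\<bar> \<ge> r * real n powr (2/3)} \<le> \<epsilon>"
  proof (intro exI[of _ "max r1 r2"] allI impI)
    fix r assume "max r1 r2 \<le> r"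
    then have r: "r1 \<le> r" "r2 \<le> r" by auto
    show "\<forall>\<^sub>F n in sequentially. measure M {s \<in> space M.
        real_of_int \<bar>exit_pt (\<lambda>p. \<omega> p s) (b s) (brk (C * real n powr (2/3)) n)\<bar> \<ge> r * real n powr (2/3)} \<le> \<epsilon>"
      using r1[OF r(1)] r2[OF r(2)]
    proof eventually_elim
      case (elim n)
      define D where "D = \<lfloor>C * real n powr (2/3)\<rfloor>"
      define x where "x = (int n + D, int n - D)"
      have "0 \<le> C * real n powr (2/3)" using C by simp
      then have D: "\<bar>real_of_int D\<bar> \<le> C * real n powr (2/3) + 1" "\<bar>real_of_int (- D)\<bar> \<le> C * real n powr (2/3) + 1"
        unfolding D_def by linarith+
      obtain B1 where B1: "B1 \<in> sets M" "measure M B1 \<le> \<epsilon> / 2"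
        "\<And>s k. s \<in> space M \<Longrightarrow> r * real n powr (2/3) \<le> real k \<Longrightarrow> int k \<le> int n + D \<Longrightarrow> Lk (\<lambda>p. \<omega> p s) 0 x
        \<le> e * (\<Sum>i=1..k. \<zeta> i s) + Lk (\<lambda>p. \<omega> p s) (int k) x \<Longrightarrow> s \<in> B1"
        using elim(1)[rule_format, OF D(1)] unfolding x_def by blast
      obtain B2 where B2: "B2 \<in> sets M" "measure M B2 \<le> \<epsilon> / 2"
        "\<And>s k. s \<in> space M \<Longrightarrow> r * real n powr (2/3) \<le> real k \<Longrightarrow> int k \<le> int n - D \<Longrightarrow> Lk (\<lambda>p. ?\<omega>' p s) 0 (prod.swap x)
        \<le> Lk (\<lambda>p. ?\<omega>' p s) (int k) (prod.swap x) \<Longrightarrow> s \<in> B2"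
        using elim(2)[rule_format, OF D(2)] by (auto simp: x_def)
      have Dn: "\<bar>D\<bar> \<le> int n" using elim(1)[rule_format, OF D(1)] by blast
      have swap: "Lk (\<lambda>p. ?\<omega>' p s) (- k) (prod.swap x) = Lk (\<lambda>p. \<omega> p s) k x" for s k
        using LPP_swap[of "\<lambda>p. \<omega> p s" "(k, - k)" x] by (simp add: Lk_def)
      have brk: "brk (C * real n powr (2/3)) n = x" by (simp add: brk_def D_def x_def)
      have "{s \<in> space M. real_of_int \<bar>exit_pt (\<lambda>p. \<omega> p s) (b s) x\<bar> \<ge> r * real n powr (2/3)} \<subseteq> B1 \<union> B2"
      proof
        fix s assume s: "s \<in> {s \<in> space M. real_of_int \<bar>exit_pt (\<lambda>p. \<omega> p s) (b s) x\<bar> \<ge> r * real n powr (2/3)}"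
        define Z where "Z = exit_pt (\<lambda>p. \<omega> p s) (b s) x"
        have Zr: "s \<in> space M" "r * real n powr (2/3) \<le> real_of_int \<bar>Z\<bar>" using s by (simp_all add: Z_def)
        have Z: "Z \<in> Cset x" "ereal (Lk (\<lambda>p. \<omega> p s) 0 x) \<le> b s Z + ereal (Lk (\<lambda>p. \<omega> p s) Z x)"
          unfolding Z_def using Dn b0 by (intro exit_pt_properties; simp add: x_def)+
        show "s \<in> B1 \<union> B2"
        proof (cases "0 \<le> Z")
          case True
          have "ereal (Lk (\<lambda>p. \<omega> p s) 0 x) \<le> ereal (e * (\<Sum>i=1..nat Z. \<zeta> i s)) + ereal (Lk (\<lambda>p. \<omega> p s) Z x)"
            using Z(2) add_right_mono[OF pos[OF True]] by (rule order_trans)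
          then have "s \<in> B1"
            using B1(3)[OF Zr(1), of "nat Z"] Zr(2) True Z(1) by (simp add: Cset_def x_def)
          then show ?thesis by simp
        next
          case False
          then have "b s Z \<le> 0" using neg by simp
          then have "ereal (Lk (\<lambda>p. \<omega> p s) 0 x) \<le> 0 + ereal (Lk (\<lambda>p. \<omega> p s) Z x)"
            using Z(2) add_right_mono by (metis order_trans)
          then have "Lk (\<lambda>p. ?\<omega>' p s) 0 (prod.swap x) \<le> Lk (\<lambda>p. ?\<omega>' p s) (- Z) (prod.swap x)"
            using swap[of s 0] swap[of s Z] by simp
          then have "s \<in> B2"
            using B2(3)[OF Zr(1), of "nat (- Z)"] Zr(2) False Z(1) by (simp add: Cset_def x_def)
          then show ?thesis by simp
        qed
      qed
      then have "measure M {s \<in> space M. real_of_int \<bar>exit_pt (\<lambda>p. \<omega> p s) (b s) x\<bar> \<ge> r * real n powr (2/3)} \<le> measure M (B1 \<union> B2)"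
        using B1(1) B2(1) by (intro finite_measure_mono) auto
      also have "\<dots> \<le> measure M B1 + measure M B2" using B1(1) B2(1) by (intro measure_Un_le)
      also have "\<dots> \<le> \<epsilon>" using B1(2) B2(2) by simp
      finally show ?case by (simp add: brk)
    qed
  qed
qed

theorem theorem2:
  fixes M :: "'s measure" and \<omega> :: "pt \<Rightarrow> 's \<Rightarrow> real" and \<zeta> :: "nat \<Rightarrow> 's \<Rightarrow> real"
  assumes "prob_space M"
    and indep: "prob_space.indep_vars M (\<lambda>_. borel)
              (\<lambda>i. case i of Inl p \<Rightarrow> \<omega> p | Inr k \<Rightarrow> \<zeta> k)
              (Inl ` {p. fst p + snd p > 0} \<union> Inr ` {1..})"
    and omega_exp: "\<And>p. fst p + snd p > 0 \<Longrightarrow> distributed M lborel (\<omega> p) (exponential_density 1)"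
    and zeta_law: "\<And>i. i \<ge> 1 \<Longrightarrow> \<zeta> i \<in> borel_measurable M \<and> distr M borel (\<zeta> i) = X_law (1/2)"
  shows "\<forall>C\<ge>0.
           tightness M \<omega> (\<lambda>_. wedge) C = 0 \<and>
           tightness M \<omega> (\<lambda>_. flat) C = 0 \<and>
           tightness M \<omega> (\<lambda>_. wedge_flat) C = 0 \<and>
           tightness M \<omega> (\<lambda>s. wedge_stat (\<lambda>i. \<zeta> i s)) C = 0 \<and>
           tightness M \<omega> (\<lambda>s. flat_stat (\<lambda>i. \<zeta> i s)) C = 0"
proof (intro allI impI conjI)
  fix C :: real assume C: "0 \<le> C"
  have model: "lpp_model M \<omega> \<zeta>" unfolding lpp_model_def
    by (intro conjI allI impI assms conjunct1[OF zeta_law] conjunct2[OF zeta_law])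
  note tight = profile_tight[OF model C]
  \<comment> \<open>The coefficient of the dominating walk is 0 for the deterministic profiles and 1
    for those with a stationary right half.\<close>
  show "tightness M \<omega> (\<lambda>_. wedge) C = 0" by (rule tight[of 0]) (auto simp: wedge_def)
  show "tightness M \<omega> (\<lambda>_. flat) C = 0" by (rule tight[of 0]) (auto simp: flat_def)
  show "tightness M \<omega> (\<lambda>_. wedge_flat) C = 0" by (rule tight[of 0]) (auto simp: wedge_flat_def)
  show "tightness M \<omega> (\<lambda>s. wedge_stat (\<lambda>i. \<zeta> i s)) C = 0" by (rule tight[of 1]) (auto simp: wedge_stat_def)
  show "tightness M \<omega> (\<lambda>s. flat_stat (\<lambda>i. \<zeta> i s)) C = 0" by (rule tight[of 1]) (auto simp: flat_stat_def)
qed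

end
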